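(* Let $f\in L^2(J;L^2(\Omega))$, let $u\in V$ be the solution of the time-periodic heat problem $$\frac{\partial u}{\partial t}-\nu\Delta u=f\ \text{ in }\Omega\times J,\qquad u=0\ \text{ on }\partial\Omega\times J,\qquad u(\cdot,0)=u(\cdot,T)\ \text{ in }\Omega,$$ and let $P_h^k u:=\Pi^k(P_hu)$ be its full-discrete approximation. Then $$\|u-P_h^ku\|_{L^2(J;L^2(\Omega))}\le\Bigl\{\Bigl(\frac{3-2\kappa_1}{1-\kappa_1}\,\frac{2}{\nu}+2K_2\Bigr)C_\Omega(h)^2+\frac{2-\kappa_1}{1-\kappa_1}\,C_J(k)\Bigr\}\|f\|_{L^2(J;L^2(\Omega))},$$ where $$K_2=\frac1\nu\Bigl\{4+5(1-e^{-\nu\lambda_1T})^{-2}+\bigl(1+(1-e^{-\nu\lambda_1T})^{-2}\bigr)(1-\kappa_1)^{-2}\Bigr\}^{1/2}.$$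
   Context: Setting: $\nu>0$ is a constant, $J=(0,T)$ with $0<T<\infty$, and $\Omega\subset\mathbb{R}^d$ ($d\in\{1,2,3\}$) is a bounded convex polygonal or polyhedral domain (an interval if $d=1$). $\|v\|_{H^1_0(\Omega)}:=\|\nabla v\|_{L^2(\Omega)}$ and $\|v\|_{L^2(J;X)}^2:=\int_0^T\|v(t)\|_X^2\,dt$. $\lambda_1$ is the smallest eigenvalue of $-\Delta$ on $\Omega$ with homogeneous Dirichlet boundary condition. $V:=H^1(J;L^2(\Omega))\cap L^2(J;H^1_0(\Omega))\cap\{u : u(0)=u(T)\text{ in }H^1_0(\Omega)\}$. The problem is known to have a unique solution in $V$; the equation is understood weakly: $(u_t,w)_{L^2(\Omega)}+\nu(\nabla u,\nabla w)_{L^2(\Omega)^d}=(f,w)_{L^2(\Omega)}$ for all $w\in H^1_0(\Omega)$ and a.e. $t\in J$. Spatial discretization: $S_h\subset H^1_0(\Omega)$ is a finite-dimensional subspace. $P_h^1:H^1_0(\Omega)\to S_h$ is the $H^1_0$-projection, $(\nabla(u-P_h^1u),\nabla v_h)_{L^2(\Omega)^d}=0$ for all $v_h\in S_h$. It is assumed that $C_\Omega(h)>0$ is a constant with $\|u-P_h^1u\|_{H^1_0(\Omega)}\le C_\Omega(h)\|\Delta u\|_{L^2(\Omega)}$ for all $u\in H^1_0(\Omega)$ with $\Delta u\in L^2(\Omega)$, and $\|u-P_h^1u\|_{L^2(\Omega)}\le C_\Omega(h)\|u-P_h^1u\|_{H^1_0(\Omega)}$ for all $u\in H^1_0(\Omega)$.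 Semidiscrete projection: for $u\in V$, $P_hu\in H^1(J;S_h)$ is defined by $\bigl(\tfrac{\partial}{\partial t}(u-P_hu),v_h\bigr)_{L^2(\Omega)}+\nu(\nabla(u-P_hu),\nabla v_h)_{L^2(\Omega)^d}=0$ for all $v_h\in S_h$ and a.e. $t\in J$, together with $(P_hu)(0)=(P_hu)(T)$. Time discretization: $0=t_0<t_1<\dots<t_m=T$ are mesh points; $V^1(J):=\{w\in H^1(J): w(0)=w(T)\}$, and $V_k^1\subset V^1(J)$ is the space of continuous piecewise linear functions on this mesh. $\Pi^k:V^1(J)\to V_k^1$ is the interpolation operator, $(\Pi^kw)(t_i)=w(t_i)$ for $i=0,\dots,m$, applied to $S_h$-valued functions in the time variable. $C_J(k)>0$ is an interpolation-error constant: $\|w-\Pi^kw\|_{L^2(J)}\le C_J(k)\|w'\|_{L^2(J)}$ for all $w\in V^1(J)$. $E_h(T):S_h\to S_h$ is the semidiscrete evolution operator: $E_h(T)v_h=\phi_h(T)$, where $\phi_h\in H^1((0,T);S_h)$ solves $((\phi_h)_t,\eta_h)_{L^2(\Omega)}+\nu(\nabla\phi_h,\nabla\eta_h)_{L^2(\Omega)^d}=0$ for all $\eta_h\in S_h$, $t>0$, with $\phi_h(0)=v_h$. $\kappa_1$ is the operator norm of $E_h(T)$ on $S_h$ equipped with the norm $\|\cdot\|_{H^1_0(\Omega)}$; $E_h(T)$ is a contraction, i.e. $\kappa_1<1$. *)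

theory Defs
  imports "HOL-Analysis.Analysis"
begin

text \<open>
  Elements of \<open>L\<^sup>2\<close>-type spaces are represented by Borel measurable functions on the whole
  Euclidean space, of which only the values in the domain matter; equality of elements is equality
  almost everywhere in the domain. A time-dependent function is a curried \<open>u :: real \<Rightarrow> 'a \<Rightarrow> real\<close>.
\<close>

section \<open>Lebesgue and Sobolev spaces on a domain\<close>

definition convex_polyhedral_domain :: "'a::euclidean_space set \<Rightarrow> bool" where
  "convex_polyhedral_domain \<Omega> \<longleftrightarrow> open \<Omega> \<and> \<Omega> \<noteq> {} \<and> convex \<Omega> \<and> polytope (closure \<Omega>)"

definition L2 :: "'a::euclidean_space set \<Rightarrow> ('a \<Rightarrow> 'b::euclidean_space) set" where
  "L2 \<Omega> = {v. set_borel_measurable lborel \<Omega> v \<and> set_integrable lborel \<Omega> (\<lambda>x. (norm (v x))\<^sup>2)}"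

definition inner_L2 :: "'a::euclidean_space set \<Rightarrow> ('a \<Rightarrow> 'b::euclidean_space) \<Rightarrow> ('a \<Rightarrow> 'b) \<Rightarrow> real" where
  "inner_L2 \<Omega> v w = (LINT x:\<Omega>|lborel. v x \<bullet> w x)"

definition norm_L2 :: "'a::euclidean_space set \<Rightarrow> ('a \<Rightarrow> 'b::euclidean_space) \<Rightarrow> real" where
  "norm_L2 \<Omega> v = sqrt (LINT x:\<Omega>|lborel. (norm (v x))\<^sup>2)"

primrec C_k :: "nat \<Rightarrow> ('a::euclidean_space \<Rightarrow> real) \<Rightarrow> bool" where
  "C_k 0 f \<longleftrightarrow> continuous_on UNIV f"
| "C_k (Suc k) f \<longleftrightarrow>
     f differentiable_on UNIV \<and> (\<forall>b\<in>Basis. C_k k (\<lambda>x. frechet_derivative f (at x) b))"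

definition test_functions :: "'a::euclidean_space set \<Rightarrow> ('a \<Rightarrow> real) set" where
  "test_functions \<Omega> = {\<phi>. (\<forall>k. C_k k \<phi>) \<and>
     compact (closure {x. \<phi> x \<noteq> 0}) \<and> closure {x. \<phi> x \<noteq> 0} \<subseteq> \<Omega>}"

definition has_weak_grad ::
    "'a::euclidean_space set \<Rightarrow> ('a \<Rightarrow> real) \<Rightarrow> ('a \<Rightarrow> 'a) \<Rightarrow> bool" where
  "has_weak_grad \<Omega> v G \<longleftrightarrow> v \<in> L2 \<Omega> \<and> G \<in> L2 \<Omega> \<and>
     (\<forall>\<phi>\<in>test_functions \<Omega>. \<forall>b\<in>Basis.
        (LINT x:\<Omega>|lborel. v x * frechet_derivative \<phi> (at x) b) = - (LINT x:\<Omega>|lborel. (G x \<bullet> b) * \<phi> x))"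

definition wgrad :: "'a::euclidean_space set \<Rightarrow> ('a \<Rightarrow> real) \<Rightarrow> ('a \<Rightarrow> 'a)" where
  "wgrad \<Omega> v = (SOME G. has_weak_grad \<Omega> v G)"

definition H1 :: "'a::euclidean_space set \<Rightarrow> ('a \<Rightarrow> real) set" where
  "H1 \<Omega> = {v. \<exists>G. has_weak_grad \<Omega> v G}"

definition norm_H1 :: "'a::euclidean_space set \<Rightarrow> ('a \<Rightarrow> real) \<Rightarrow> real" where
  "norm_H1 \<Omega> v = sqrt ((norm_L2 \<Omega> v)\<^sup>2 + (norm_L2 \<Omega> (wgrad \<Omega> v))\<^sup>2)"

definition H10 :: "'a::euclidean_space set \<Rightarrow> ('a \<Rightarrow> real) set" where
  "H10 \<Omega> = {v \<in> H1 \<Omega>. \<exists>\<phi> :: nat \<Rightarrow> 'a \<Rightarrow> real. (\<forall>n. \<phi> n \<in> test_functions \<Omega>) \<and>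
     (\<lambda>n. norm_H1 \<Omega> (\<lambda>x. v x - \<phi> n x)) \<longlonglongrightarrow> 0}"

definition norm_H10 :: "'a::euclidean_space set \<Rightarrow> ('a \<Rightarrow> real) \<Rightarrow> real" where
  "norm_H10 \<Omega> v = norm_L2 \<Omega> (wgrad \<Omega> v)"

text \<open>\<open>\<Delta> v = g\<close> in the sense of distributions, with \<open>g\<close> square integrable.\<close>

definition has_laplacian ::
    "'a::euclidean_space set \<Rightarrow> ('a \<Rightarrow> real) \<Rightarrow> ('a \<Rightarrow> real) \<Rightarrow> bool" where
  "has_laplacian \<Omega> v g \<longleftrightarrow> v \<in> H1 \<Omega> \<and> g \<in> L2 \<Omega> \<and>
     (\<forall>\<phi>\<in>test_functions \<Omega>. inner_L2 \<Omega> (wgrad \<Omega> v) (wgrad \<Omega> \<phi>) = - inner_L2 \<Omega> g \<phi>)"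

definition dirichlet_eigenvalue :: "'a::euclidean_space set \<Rightarrow> real \<Rightarrow> bool" where
  "dirichlet_eigenvalue \<Omega> \<mu> \<longleftrightarrow>
     (\<exists>w\<in>H10 \<Omega>. \<not> (AE x\<in>\<Omega> in lborel. w x = 0) \<and> has_laplacian \<Omega> w (\<lambda>x. - (\<mu> * w x)))"

definition lambda1 :: "'a::euclidean_space set \<Rightarrow> real" where
  "lambda1 \<Omega> = (LEAST \<mu>. dirichlet_eigenvalue \<Omega> \<mu>)"

section \<open>Function spaces on the time interval \<open>J = (0, T)\<close>\<close>

text \<open>
  \<open>L\<^sup>2(J; L\<^sup>2(\<Omega>))\<close> is identified with \<open>L\<^sup>2(J \<times> \<Omega>)\<close>.
\<close>

definition L2J_L2 :: "'a::euclidean_space set \<Rightarrow> real \<Rightarrow> (real \<Rightarrow> 'a \<Rightarrow> 'b::euclidean_space) set" where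
  "L2J_L2 \<Omega> T = {u. (\<lambda>(t, x). u t x) \<in> L2 ({0<..<T} \<times> \<Omega>)}"

definition norm_L2J_L2 :: "'a::euclidean_space set \<Rightarrow> real \<Rightarrow> (real \<Rightarrow> 'a \<Rightarrow> real) \<Rightarrow> real" where
  "norm_L2J_L2 \<Omega> T u = sqrt (LINT t:{0<..<T}|lborel. (norm_L2 \<Omega> (u t))\<^sup>2)"

definition L2J_H10 :: "'a::euclidean_space set \<Rightarrow> real \<Rightarrow> (real \<Rightarrow> 'a \<Rightarrow> real) set" where
  "L2J_H10 \<Omega> T = {u \<in> L2J_L2 \<Omega> T. (AE t\<in>{0<..<T} in lborel. u t \<in> H10 \<Omega>) \<and>
     (\<exists>G\<in>L2J_L2 \<Omega> T. AE t\<in>{0<..<T} in lborel. has_weak_grad \<Omega> (u t) (G t))}"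

text \<open>
  The weak time derivative; the identity of the two \<open>L\<^sup>2(\<Omega>)\<close>-valued integrals is read pointwise
  almost everywhere in \<open>\<Omega>\<close>.
\<close>

definition has_time_deriv ::
    "'a::euclidean_space set \<Rightarrow> real \<Rightarrow> (real \<Rightarrow> 'a \<Rightarrow> real) \<Rightarrow> (real \<Rightarrow> 'a \<Rightarrow> real) \<Rightarrow> bool" where
  "has_time_deriv \<Omega> T u g \<longleftrightarrow> u \<in> L2J_L2 \<Omega> T \<and> g \<in> L2J_L2 \<Omega> T \<and>
     (\<forall>\<phi>\<in>test_functions {0<..<T}. AE x\<in>\<Omega> in lborel.
        (LINT t:{0<..<T}|lborel. deriv \<phi> t * u t x) = - (LINT t:{0<..<T}|lborel. \<phi> t * g t x))"

definition time_deriv ::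
    "'a::euclidean_space set \<Rightarrow> real \<Rightarrow> (real \<Rightarrow> 'a \<Rightarrow> real) \<Rightarrow> (real \<Rightarrow> 'a \<Rightarrow> real)" where
  "time_deriv \<Omega> T u = (SOME g. has_time_deriv \<Omega> T u g)"

text \<open>
  \<open>H\<^sup>1(J; X)\<close> for a subspace \<open>X\<close> of \<open>L\<^sup>2(\<Omega>)\<close> with the norm of \<open>L\<^sup>2(\<Omega>)\<close>. An element is represented by
  its version that is continuous from \<open>[0, T]\<close> to \<open>L\<^sup>2(\<Omega>)\<close>, so that its values at single times, in
  particular at \<open>0\<close>, \<open>T\<close> and mesh points, are meaningful.
\<close>

definition H1J :: "'a::euclidean_space set \<Rightarrow> real \<Rightarrow> ('a \<Rightarrow> real) set \<Rightarrow> (real \<Rightarrow> 'a \<Rightarrow> real) set" where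
  "H1J \<Omega> T X = {u. (\<forall>t\<in>{0..T}. u t \<in> X) \<and>
     (\<exists>g. has_time_deriv \<Omega> T u g \<and> (AE t\<in>{0<..<T} in lborel. g t \<in> X)) \<and>
     (\<forall>s\<in>{0..T}. ((\<lambda>t. norm_L2 \<Omega> (\<lambda>x. u t x - u s x)) \<longlongrightarrow> 0) (at s within {0..T}))}"

definition V_space :: "'a::euclidean_space set \<Rightarrow> real \<Rightarrow> (real \<Rightarrow> 'a \<Rightarrow> real) set" where
  "V_space \<Omega> T = {u \<in> H1J \<Omega> T (L2 \<Omega>) \<inter> L2J_H10 \<Omega> T.
     u 0 \<in> H10 \<Omega> \<and> u T \<in> H10 \<Omega> \<and> (AE x\<in>\<Omega> in lborel. u 0 x = u T x)}"

definition periodic_heat_solution ::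
    "real \<Rightarrow> 'a::euclidean_space set \<Rightarrow> real \<Rightarrow> (real \<Rightarrow> 'a \<Rightarrow> real) \<Rightarrow> (real \<Rightarrow> 'a \<Rightarrow> real) \<Rightarrow> bool" where
  "periodic_heat_solution \<nu> \<Omega> T f u \<longleftrightarrow> u \<in> V_space \<Omega> T \<and>
     (AE t\<in>{0<..<T} in lborel. \<forall>w\<in>H10 \<Omega>.
        inner_L2 \<Omega> (time_deriv \<Omega> T u t) w + \<nu> * inner_L2 \<Omega> (wgrad \<Omega> (u t)) (wgrad \<Omega> w)
          = inner_L2 \<Omega> (f t) w)"

section \<open>Spatial discretization\<close>

definition finite_dim_subspace :: "('a \<Rightarrow> real) set \<Rightarrow> bool" where
  "finite_dim_subspace S \<longleftrightarrow> (\<exists>B. finite B \<and> S = {v. \<exists>c. v = (\<lambda>x. \<Sum>b\<in>B. c b * b x)})"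

text \<open>
  The following predicates say that a given object is the respective projection or evolution
  operator; their defining properties determine the values up to null sets of \<open>\<Omega>\<close>.
\<close>

definition is_H10_projection ::
    "'a::euclidean_space set \<Rightarrow> ('a \<Rightarrow> real) set \<Rightarrow> (('a \<Rightarrow> real) \<Rightarrow> ('a \<Rightarrow> real)) \<Rightarrow> bool" where
  "is_H10_projection \<Omega> S P \<longleftrightarrow> (\<forall>u\<in>H10 \<Omega>. P u \<in> S \<and>
     (\<forall>v\<in>S. inner_L2 \<Omega> (wgrad \<Omega> (\<lambda>x. u x - P u x)) (wgrad \<Omega> v) = 0))"

definition is_semidiscrete_projection ::
    "real \<Rightarrow> 'a::euclidean_space set \<Rightarrow> real \<Rightarrow> ('a \<Rightarrow> real) set \<Rightarrow>
       (real \<Rightarrow> 'a \<Rightarrow> real) \<Rightarrow> (real \<Rightarrow> 'a \<Rightarrow> real) \<Rightarrow> bool" where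
  "is_semidiscrete_projection \<nu> \<Omega> T S u p \<longleftrightarrow> p \<in> H1J \<Omega> T S \<and>
     (AE t\<in>{0<..<T} in lborel. \<forall>v\<in>S.
        inner_L2 \<Omega> (time_deriv \<Omega> T (\<lambda>s x. u s x - p s x) t) v
          + \<nu> * inner_L2 \<Omega> (wgrad \<Omega> (\<lambda>x. u t x - p t x)) (wgrad \<Omega> v) = 0) \<and>
     (AE x\<in>\<Omega> in lborel. p 0 x = p T x)"

definition is_evolution_operator ::
    "real \<Rightarrow> 'a::euclidean_space set \<Rightarrow> real \<Rightarrow> ('a \<Rightarrow> real) set \<Rightarrow>
       (('a \<Rightarrow> real) \<Rightarrow> ('a \<Rightarrow> real)) \<Rightarrow> bool" where
  "is_evolution_operator \<nu> \<Omega> T S E \<longleftrightarrow> (\<forall>v\<in>S. \<exists>\<phi>\<in>H1J \<Omega> T S.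
     (AE t\<in>{0<..<T} in lborel. \<forall>\<eta>\<in>S.
        inner_L2 \<Omega> (time_deriv \<Omega> T \<phi> t) \<eta> + \<nu> * inner_L2 \<Omega> (wgrad \<Omega> (\<phi> t)) (wgrad \<Omega> \<eta>) = 0) \<and>
     \<phi> 0 = v \<and> E v = \<phi> T)"

text \<open>As for \<^const>\<open>onorm\<close>, the quotient is \<open>0\<close> where the denominator vanishes.\<close>

definition opnorm_H10 ::
    "'a::euclidean_space set \<Rightarrow> ('a \<Rightarrow> real) set \<Rightarrow> (('a \<Rightarrow> real) \<Rightarrow> ('a \<Rightarrow> real)) \<Rightarrow> real" where
  "opnorm_H10 \<Omega> S E = (SUP v\<in>S. norm_H10 \<Omega> (E v) / norm_H10 \<Omega> v)"

section \<open>Time discretization\<close>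

definition V1 :: "real \<Rightarrow> (real \<Rightarrow> real) set" where
  "V1 T = {w \<in> H1 {0<..<T}. continuous_on {0..T} w \<and> w 0 = w T}"

definition is_mesh :: "real \<Rightarrow> nat \<Rightarrow> (nat \<Rightarrow> real) \<Rightarrow> bool" where
  "is_mesh T m \<tau> \<longleftrightarrow> \<tau> 0 = 0 \<and> \<tau> m = T \<and> (\<forall>i<m. \<tau> i < \<tau> (Suc i))"

definition interpolant :: "(nat \<Rightarrow> real) \<Rightarrow> (real \<Rightarrow> real) \<Rightarrow> real \<Rightarrow> real" where
  "interpolant \<tau> w t = (let i = (LEAST i. t \<le> \<tau> (Suc i)) in
     w (\<tau> i) + (t - \<tau> i) / (\<tau> (Suc i) - \<tau> i) * (w (\<tau> (Suc i)) - w (\<tau> i)))"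

definition full_discrete :: "(nat \<Rightarrow> real) \<Rightarrow> (real \<Rightarrow> 'a \<Rightarrow> real) \<Rightarrow> real \<Rightarrow> 'a \<Rightarrow> real" where
  "full_discrete \<tau> p t x = interpolant \<tau> (\<lambda>s. p s x) t"

lemma is_mesh_mono:
  assumes "is_mesh T m \<tau>" "i < j" "j \<le> m"
  shows "\<tau> i < \<tau> j"
  using assms(2,3)
proof (induction j)
  case (Suc j)
  then have "\<tau> j < \<tau> (Suc j)" using assms(1) by (auto simp: is_mesh_def)
  with Suc show ?case by (cases "i = j") auto
qed simp

text \<open>
  The formula is the piecewise linear interpolant: it is affine on every closed mesh interval and
  takes the prescribed values at both of its end points.
\<close>

lemma interpolant_on_interval:
  assumes M: "is_mesh T m \<tau>" and i: "i < m" and t: "\<tau> i \<le> t" "t \<le> \<tau> (Suc i)"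
  shows "interpolant \<tau> w t =
           w (\<tau> i) + (t - \<tau> i) / (\<tau> (Suc i) - \<tau> i) * (w (\<tau> (Suc i)) - w (\<tau> i))"
proof -
  define j where "j = (LEAST i. t \<le> \<tau> (Suc i))"
  have ji: "j \<le> i" unfolding j_def using t(2) by (rule Least_le)
  have tj: "t \<le> \<tau> (Suc j)" unfolding j_def using t(2) by (rule LeastI)
  have lt: "\<tau> j < \<tau> (Suc j)" using is_mesh_mono[OF M] ji i by simp
  show ?thesis
  proof (cases "j = i")
    case True
    then show ?thesis by (simp add: interpolant_def Let_def flip: j_def)
  next
    case False
    then have si: "Suc j \<le> i" using ji by simp
    have "\<tau> (Suc j) \<le> \<tau> i"
      using is_mesh_mono[OF M, of "Suc j" i] si i by (cases "Suc j = i") auto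
    then have e: "\<tau> (Suc j) = t" "\<tau> i = t" using tj t(1) by auto
    have "interpolant \<tau> w t = w t"
      using lt e by (simp add: interpolant_def Let_def flip: j_def)
    then show ?thesis using e by simp
  qed
qed

lemma interpolant_node:
  assumes M: "is_mesh T m \<tau>" and "0 < m" "i \<le> m"
  shows "interpolant \<tau> w (\<tau> i) = w (\<tau> i)"
proof (cases i)
  case 0
  then show ?thesis
    using interpolant_on_interval[OF M, of 0 "\<tau> 0" w] is_mesh_mono[OF M, of 0 1] assms(2) by simp
next
  case (Suc j)
  then have "\<tau> j < \<tau> i" using is_mesh_mono[OF M, of j i] assms(3) by simp
  then show ?thesis
    using interpolant_on_interval[OF M, of j "\<tau> i" w] Suc assms(3) by simp
qed

definition K2 :: "real \<Rightarrow> real \<Rightarrow> real \<Rightarrow> real \<Rightarrow> real" where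
  "K2 \<nu> \<mu> T \<kappa> = 1 / \<nu> * sqrt (4 + 5 * (1 - exp (- \<nu> * \<mu> * T)) powi (-2)
     + (1 + (1 - exp (- \<nu> * \<mu> * T)) powi (-2)) * (1 - \<kappa>) powi (-2))"

end

theory Submission
  imports Defs
begin

text \<open>
  The error is split as \<open>u - \<Pi> p = (u - p) + (p - \<Pi> p)\<close>, where \<open>p = P\<^sub>h u\<close>. Let \<open>e = u - p\<close> and
  \<open>\<theta> = P\<^sub>h\<^sup>1 u - p\<close>. In a basis \<open>(b)\<close> of \<open>S\<^sub>h\<close> that is orthonormal for the Dirichlet inner product, the
  error equation reads \<open>\<theta> = - (1/\<nu>) \<Sum> (e\<^sub>t, b) b\<close>; so \<open>(\<theta>, e)\<close> is the time derivative of
  \<open>- (1/2\<nu>) \<Sum> (e, b)\<^sup>2\<close> and integrates to \<open>0\<close> by periodicity. Hence, in space and time,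
  \<open>\<parallel>e\<parallel> \<le> \<parallel>e - \<theta>\<parallel> = \<parallel>u - P\<^sub>h\<^sup>1 u\<parallel> \<le> C\<^sub>\<Omega>\<^sup>2 \<parallel>\<Delta> u\<parallel>\<close>, and \<open>\<nu> \<parallel>\<Delta> u\<parallel> \<le> \<parallel>f\<parallel>\<close>, because
  \<open>u\<^sub>t\<close> and \<open>\<Delta> u\<close> are orthogonal by periodicity. Testing the semidiscrete equation with \<open>p\<^sub>t\<close> gives
  \<open>\<parallel>p\<^sub>t\<parallel> \<le> \<parallel>f\<parallel>\<close>, so that \<open>\<parallel>p - \<Pi> p\<parallel> \<le> C\<^sub>J \<parallel>f\<parallel>\<close>. The constants \<open>1/\<nu>\<close> and \<open>1\<close> obtained in this way
  are smaller than those of the theorem as soon as \<open>\<kappa>\<^sub>1 < 1\<close>, which follows from the decay of the Dirichlet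
  energy along the semidiscrete evolution.
\<close>

section \<open>Smooth functions\<close>

text \<open>Two obstacles shape the development. The orthogonality of the time derivative and the
  Laplacian cannot be seen by testing with the time derivative, which lies only in L2. With
  \<open>g = f - u_t\<close> one has \<open>(f, f) = (g, g) + 2 (u_t, g) + (u_t, u_t)\<close>, so
  the sign of the time integral of \<open>(u_t, g)\<close> is all that the bound on g requires, and
  this sign is what convexity of the Dirichlet energy provides. The other obstacle is that functions
  are mere representatives and that \<open>wgrad\<close> and \<open>time_deriv\<close> are choices.
  Nothing is therefore differentiated as a vector-valued function: a function of time is paired with
  a fixed element of L2, which gives an absolutely continuous scalar function, and products and
  integration by parts are applied to such scalars. Hence the sums over finite bases. These bases
  are orthonormal for a semi-inner product and span only up to null vectors; expanding one form in a
  basis made for the other is legitimate because the L2 form and the Dirichlet form have the same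
  null vectors on the Galerkin space.\<close>

lemma C_k_SucI:
  assumes "\<And>x. (f has_derivative f' x) (at x)"
    and "\<And>b. b \<in> Basis \<Longrightarrow> C_k k (\<lambda>x. f' x b)"
  shows "C_k (Suc k) f"
proof -
  have "frechet_derivative f (at x) = f' x" for x
    using frechet_derivative_at[OF assms(1)] by simp
  then show ?thesis
    using assms by (auto simp: differentiable_on_def differentiable_def)
qed

lemma C_k_Suc_has_derivative:
  assumes "C_k (Suc k) f"
  shows "(f has_derivative frechet_derivative f (at x)) (at x)"
  using assms by (simp add: differentiable_on_def frechet_derivative_works)

text \<open>The product rule leaves one factor undifferentiated, so the induction for
  \<open>C_k_mult\<close> has to lower the order of smoothness of that factor.\<close>

lemma C_k_Suc_imp_C_k: "C_k (Suc k) f \<Longrightarrow> C_k k f"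
proof (induction k arbitrary: f)
  case 0
  then show ?case by (auto intro: differentiable_imp_continuous_on)
next
  case (Suc k)
  then show ?case by (simp only: C_k.simps(2)) blast
qed

lemma C_k_imp_continuous: "C_k k f \<Longrightarrow> continuous_on UNIV f"
  by (cases k) (auto intro: differentiable_imp_continuous_on)

lemma C_k_const: "C_k k (\<lambda>x. c)"
proof (induction k arbitrary: c)
  case (Suc k)
  show ?case by (rule C_k_SucI[where f' = "\<lambda>x b. 0"]) (auto intro: Suc)
qed simp

lemma C_k_inner: "C_k k (\<lambda>x. x \<bullet> a + d)"
proof (cases k)
  case (Suc j)
  show ?thesis unfolding Suc
    by (rule C_k_SucI[where f' = "\<lambda>x b. b \<bullet> a"])
       (auto intro!: derivative_eq_intros C_k_const)
qed (simp add: continuous_intros)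

lemma C_k_add: "C_k k f \<Longrightarrow> C_k k g \<Longrightarrow> C_k k (\<lambda>x. f x + g x)"
proof (induction k arbitrary: f g)
  case (Suc k)
  show ?case
    by (rule C_k_SucI[where f' = "\<lambda>x b. frechet_derivative f (at x) b + frechet_derivative g (at x) b"])
       (use Suc in \<open>auto intro!: has_derivative_add[OF C_k_Suc_has_derivative C_k_Suc_has_derivative] simp del: C_k.simps,
          auto\<close>)
qed (simp add: continuous_intros)

lemma C_k_mult: "C_k k f \<Longrightarrow> C_k k g \<Longrightarrow> C_k k (\<lambda>x. f x * g x)"
proof (induction k arbitrary: f g)
  case (Suc k)
  have fg: "C_k k f" "C_k k g" using Suc.prems C_k_Suc_imp_C_k by blast+
  show ?case
  proof (rule C_k_SucI[where f' = "\<lambda>x b. f x * frechet_derivative g (at x) b + frechet_derivative f (at x) b * g x"])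
    fix b :: 'a assume "b \<in> Basis"
    then show "C_k k (\<lambda>x. f x * frechet_derivative g (at x) b + frechet_derivative f (at x) b * g x)"
      using Suc.prems by (intro C_k_add Suc.IH fg) auto
  qed (use Suc.prems in \<open>auto intro!: has_derivative_mult C_k_Suc_has_derivative simp del: C_k.simps\<close>)
qed (simp add: continuous_intros)

lemma C_k_prod: "(\<And>i. i \<in> I \<Longrightarrow> C_k k (f i)) \<Longrightarrow> C_k k (\<lambda>x. \<Prod>i\<in>I. f i x)"
  by (induction I rule: infinite_finite_induct) (auto intro: C_k_const C_k_mult)

lemma frechet_derivative_real:
  fixes f :: "real \<Rightarrow> real"
  assumes "(f has_derivative f') (at x)"
  shows "f' h = h * f' 1"
  using linear_scale[OF has_derivative_linear[OF assms], of h 1] by simp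

text \<open>By the chain rule a partial derivative is the constant \<open>b \<bullet> a\<close>
  times the derivative of f at the same affine argument; with f generalised, the induction
  closes.\<close>

lemma C_k_compose_inner:
  fixes f :: "real \<Rightarrow> real" and a :: "'a::euclidean_space"
  shows "C_k k f \<Longrightarrow> C_k k (\<lambda>x. f (x \<bullet> a + d))"
proof (induction k arbitrary: f)
  case (Suc k)
  let ?D = "\<lambda>t. frechet_derivative f (at t)"
  show ?case
  proof (rule C_k_SucI[where f' = "\<lambda>x b. ?D (x \<bullet> a + d) (b \<bullet> a)"])
    fix x
    show "((\<lambda>x. f (x \<bullet> a + d)) has_derivative (\<lambda>b. ?D (x \<bullet> a + d) (b \<bullet> a))) (at x)"
      by (rule has_derivative_compose[where g = f and f = "\<lambda>x. x \<bullet> a + d"])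
         (auto intro!: derivative_eq_intros C_k_Suc_has_derivative[OF Suc.prems])
  next
    fix b :: 'a
    have eq: "?D t (b \<bullet> a) = (b \<bullet> a) * ?D t 1" for t
      by (rule frechet_derivative_real[OF C_k_Suc_has_derivative[OF Suc.prems]])
    show "C_k k (\<lambda>x. ?D (x \<bullet> a + d) (b \<bullet> a))"
      unfolding eq using Suc.prems by (intro C_k_mult C_k_const Suc.IH) auto
  qed
next
  case 0
  then show ?case
    by (auto intro!: continuous_intros continuous_on_compose2[of UNIV f])
qed

section \<open>Bump functions\<close>

text \<open>Induction on the coefficients of P. The free exponent k absorbs the factor s that each
  further coefficient brings along.\<close>

lemma poly_exp_tendsto_0:
  fixes P :: "real poly"
  assumes "0 < e"
  shows "((\<lambda>s. s ^ k * poly P s * exp (- (e * s))) \<longlongrightarrow> 0) at_top"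
proof (induction P arbitrary: k)
  case (pCons a P)
  have "((\<lambda>s. (e * s) ^ k / exp (e * s)) \<longlongrightarrow> 0) at_top"
    by (rule filterlim_compose[OF tendsto_power_div_exp_0])
       (use assms in \<open>auto intro: filterlim_tendsto_pos_mult_at_top[OF tendsto_const] filterlim_ident\<close>)
  from tendsto_mult[OF tendsto_const[of "a / e ^ k"] this]
  have "((\<lambda>s. a * s ^ k * exp (- (e * s))) \<longlongrightarrow> 0) at_top"
    using assms by (simp add: power_mult_distrib exp_minus field_simps)
  from tendsto_add[OF this pCons.IH[of "Suc k"]] show ?case
    by (simp add: algebra_simps)
qed simp

text \<open>For \<open>P = 1\<close> this is the classical smooth function
  \<open>exp (- (e / t))\<close>, extended by 0. The polynomial in \<open>1 / t\<close> makes the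
  family closed under differentiation; the parameter e is later sent to 0, where the function tends
  to the indicator of the positive half-line.\<close>

definition flat :: "real poly \<Rightarrow> real \<Rightarrow> real \<Rightarrow> real" where
  "flat P e t = (if 0 < t then poly P (1 / t) * exp (- (e / t)) else 0)"

text \<open>The inner derivatives contribute the factor \<open>1 / t^2\<close>, which is
  \<open>[:0, 0, 1:]\<close> evaluated at \<open>1 / t\<close>. At 0 the right difference quotient
  is \<open>s * poly P s * exp (- (e * s))\<close> with \<open>s = 1 / h\<close>, so
  \<open>poly_exp_tendsto_0\<close> applies.\<close>

lemma flat_has_derivative:
  assumes "0 < e"
  shows "(flat P e has_real_derivative flat ([:0, 0, 1:] * (smult e P - pderiv P)) e t) (at t)"
proof -
  consider "t < 0" | "t = 0" | "0 < t" by linarith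
  then show ?thesis
  proof cases
    case 1
    have "((\<lambda>t. 0) has_real_derivative 0) (at t)" by simp
    then have "(flat P e has_real_derivative 0) (at t)"
      by (rule DERIV_cong_ev[THEN iffD1, rotated -1, OF _ refl _ refl])
         (use 1 in \<open>auto simp: flat_def intro!: eventually_mono[OF eventually_nhds_in_open[of "{..<0}"]]\<close>)
    then show ?thesis using 1 by (simp add: flat_def)
  next
    case 3
    have "((\<lambda>t. poly P (1 / t) * exp (- (e / t))) has_real_derivative
        flat ([:0, 0, 1:] * (smult e P - pderiv P)) e t) (at t)"
      using 3 by (auto intro!: derivative_eq_intros poly_DERIV[THEN DERIV_chain2]
          simp: flat_def power2_eq_square field_simps)
    then show ?thesis
      by (rule DERIV_cong_ev[THEN iffD1, rotated -1, OF _ refl _ refl])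
         (use 3 in \<open>auto simp: flat_def intro!: eventually_mono[OF eventually_nhds_in_open[of "{0<..}"]]\<close>)
  next
    case 2
    have "((\<lambda>h. (1 / h) ^ 1 * poly P (1 / h) * exp (- (e * (1 / h)))) \<longlongrightarrow> 0) (at_right 0)"
      by (rule filterlim_compose[OF poly_exp_tendsto_0[OF assms]])
         (use filterlim_inverse_at_top_right in \<open>simp add: inverse_eq_divide\<close>)
    then have "((\<lambda>h. flat P e h / h) \<longlongrightarrow> 0) (at_right 0)"
      by (rule Lim_transform_eventually)
         (auto simp: flat_def eventually_at_filter intro!: always_eventually)
    moreover have "((\<lambda>h. flat P e h / h) \<longlongrightarrow> 0) (at_left 0)"
      by (rule Lim_transform_eventually[OF tendsto_const])
         (auto simp: flat_def eventually_at_filter intro!: always_eventually)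
    ultimately have "((\<lambda>h. flat P e h / h) \<longlongrightarrow> 0) (at 0)"
      by (rule filterlim_split_at[rotated])
    then show ?thesis using 2 by (simp add: DERIV_def flat_def)
  qed
qed

lemma C_k_flat:
  assumes "0 < e"
  shows "C_k k (flat P e)"
proof (induction k arbitrary: P)
  case 0
  show ?case using DERIV_isCont[OF flat_has_derivative[OF assms]]
    by (simp add: continuous_at_imp_continuous_on)
next
  case (Suc k)
  show ?case
    by (rule C_k_SucI[OF flat_has_derivative[OF assms, THEN has_field_derivative_imp_has_derivative]])
       (simp add: Suc)
qed

text \<open>One flat factor for each face of the box from a to c, in the distance to that face. Both
  factors are flat functions of affine forms, as \<open>C_k_compose_inner\<close> expects.\<close>

definition bump :: "'a::euclidean_space \<Rightarrow> 'a \<Rightarrow> real \<Rightarrow> 'a \<Rightarrow> real" where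
  "bump a c e x = (\<Prod>b\<in>Basis. flat 1 e (x \<bullet> b + - (a \<bullet> b)) * flat 1 e (x \<bullet> (- b) + c \<bullet> b))"

lemma C_k_bump: "0 < e \<Longrightarrow> C_k k (bump a c e)"
  unfolding bump_def by (intro C_k_prod C_k_mult C_k_compose_inner C_k_flat)

lemma bump_eq_0: "x \<notin> box a c \<Longrightarrow> bump a c e x = 0"
  unfolding bump_def by (rule prod_zero) (auto simp: flat_def box_def)

lemma flat_bounds: "0 < e \<Longrightarrow> 0 \<le> flat 1 e t \<and> flat 1 e t \<le> 1"
  by (auto simp: flat_def)

lemma bump_bounds: "0 < e \<Longrightarrow> 0 \<le> bump a c e x \<and> bump a c e x \<le> 1"
  unfolding bump_def by (auto intro!: prod_nonneg prod_le_1 mult_nonneg_nonneg mult_le_one simp: flat_bounds)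

lemma bump_pos: "x \<in> box a c \<Longrightarrow> 0 < bump a c e x"
  unfolding bump_def by (rule prod_pos) (auto simp: flat_def box_def algebra_simps)

text \<open>As e tends to 0 every factor tends to 1 inside the box, while the support stays in the
  closed box. This approximation takes the place of mollification.\<close>

lemma bump_tendsto_indicator:
  "(\<lambda>n. bump a c (1 / Suc n) x) \<longlonglongrightarrow> indicator (box a c) x"
proof (cases "x \<in> box a c")
  case True
  have *: "(\<lambda>n. flat 1 (1 / Suc n) t) \<longlonglongrightarrow> 1" if "0 < t" for t :: real
  proof -
    have "(\<lambda>n. - (1 / real (Suc n) / t)) \<longlonglongrightarrow> - (0 / t)"
      by (intro tendsto_intros LIMSEQ_Suc[OF lim_1_over_n]) (use that in auto)
    then have "(\<lambda>n. exp (- (1 / real (Suc n) / t))) \<longlonglongrightarrow> exp 0"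
      by (intro tendsto_exp) simp
    then show ?thesis using that by (simp add: flat_def)
  qed
  have "(\<lambda>n. bump a c (1 / Suc n) x) \<longlonglongrightarrow> (\<Prod>b\<in>(Basis::'a set). 1 * 1)"
    unfolding bump_def
    by (intro tendsto_prod tendsto_mult *) (use True in \<open>auto simp: box_def\<close>)
  then show ?thesis using True by simp
qed (simp add: bump_eq_0)

lemma test_function_bump:
  assumes "0 < e" "cbox a c \<subseteq> \<Omega>"
  shows "bump a c e \<in> test_functions \<Omega>"
proof -
  have "closure {x. bump a c e x \<noteq> 0} \<subseteq> cbox a c"
    using bump_eq_0[of _ a c e] box_subset_cbox[of a c] by (intro closure_minimal) auto
  moreover from this have "compact (closure {x. bump a c e x \<noteq> 0})"
    by (meson bounded_cbox bounded_subset closed_closure compact_eq_bounded_closed)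
  ultimately show ?thesis
    using assms by (auto simp: test_functions_def C_k_bump)
qed

section \<open>Integration by parts and the fundamental lemma\<close>

lemma lborel_integral_translate:
  fixes f :: "'a::euclidean_space \<Rightarrow> real"
  assumes "f \<in> borel_measurable borel"
  shows "(\<integral>x. f (c + x) \<partial>lborel) = (\<integral>x. f x \<partial>lborel)"
  using integral_distr[of "(+) c" lborel borel f] assms by (simp add: lborel_distr_plus)

lemma lborel_integrable_translate:
  fixes f :: "'a::euclidean_space \<Rightarrow> real"
  assumes "integrable lborel f"
  shows "integrable lborel (\<lambda>x. f (c + x))"
  using assms integrable_distr_eq[of "(+) c" lborel borel f] by (simp add: lborel_distr_plus)

lemma bounded_subset_cball0:
  fixes S :: "'a::real_normed_vector set"
  assumes "bounded S"
  shows "\<exists>R. S \<subseteq> cball 0 R"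
  using assms by (auto simp: bounded_iff subset_iff)

lemma integrable_indicator_cball: "integrable lborel (\<lambda>x. M * indicator (cball a R) x :: real)"
  by (intro integrable_mult_right integrable_real_indicator) (auto intro: emeasure_lborel_cball_finite[unfolded infinity_ennreal_def])

lemma integrable_continuous_compact_support:
  fixes f :: "'a::euclidean_space \<Rightarrow> real"
  assumes "continuous_on UNIV f" "compact K" "\<And>x. x \<notin> K \<Longrightarrow> f x = 0"
  shows "integrable lborel f"
proof -
  have "set_integrable lborel K f"
    using borel_integrable_compact[OF assms(2), of f] continuous_on_subset[OF assms(1), of K]
    by (simp add: set_integrable_def)
  moreover have *: "indicator K x *\<^sub>R f x = f x" for x
    using assms(3) by (cases "x \<in> K") auto
  ultimately show ?thesis unfolding set_integrable_def * by simp
qed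

text \<open>The integral of a difference quotient vanishes because Lebesgue measure is translation
  invariant. The mean value theorem bounds the quotients uniformly, so dominated convergence carries
  the value 0 over to the derivative.\<close>

lemma integral_partial_deriv_eq_0:
  fixes \<psi> :: "'a::euclidean_space \<Rightarrow> real"
  assumes \<psi>: "C_k (Suc 0) \<psi>" and K: "compact K" "\<And>x. x \<notin> K \<Longrightarrow> \<psi> x = 0" and b: "b \<in> Basis"
  shows "(\<integral>x. frechet_derivative \<psi> (at x) b \<partial>lborel) = 0"
proof -
  define D where "D x = frechet_derivative \<psi> (at x) b" for x
  have cD: "continuous_on UNIV D"
    using \<psi> b by (auto simp: D_def[abs_def])
  have c\<psi>[measurable]: "\<psi> \<in> borel_measurable borel"
    using C_k_imp_continuous[OF \<psi>] by (rule borel_measurable_continuous_onI)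
  have hd: "((\<lambda>s. \<psi> (x + s *\<^sub>R b)) has_real_derivative D (x + s *\<^sub>R b)) (at s)" for x s
  proof -
    note d = C_k_Suc_has_derivative[OF \<psi>]
    have "((\<lambda>s. \<psi> (x + s *\<^sub>R b)) has_derivative (\<lambda>h. frechet_derivative \<psi> (at (x + s *\<^sub>R b)) (h *\<^sub>R b))) (at s)"
      by (rule has_derivative_compose[where g = \<psi> and f = "\<lambda>s. x + s *\<^sub>R b"])
         (auto intro!: derivative_eq_intros d)
    then show ?thesis
      by (rule has_derivative_imp_has_field_derivative)
         (simp add: D_def linear_scale[OF has_derivative_linear[OF d]])
  qed
  obtain R where R: "K \<subseteq> cball 0 R"
    using compact_imp_bounded[OF K(1)] bounded_subset_cball0 by blast
  \<comment> \<open>The steps have length at most 1, so the quotients vanish beyond radius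
    \<open>R + 1\<close>, and the intermediate points of the mean value theorem stay within radius
    \<open>R + 2\<close>.\<close>
  have "compact (D ` cball 0 (R + 2))"
    by (intro compact_continuous_image continuous_on_subset[OF cD]) auto
  then obtain M where M: "\<bar>D x\<bar> \<le> M" if "x \<in> cball 0 (R + 2)" for x
    using compact_imp_bounded bounded_iff by (metis imageI real_norm_def)
  define s where "s n x = (\<psi> (x + (1 / Suc n) *\<^sub>R b) - \<psi> x) * Suc n" for n x
  have lim: "(\<lambda>n. s n x) \<longlonglongrightarrow> D x" for x
  proof -
    have "((\<lambda>h. (\<psi> (x + h *\<^sub>R b) - \<psi> x) / h) \<longlongrightarrow> D x) (at 0)"
      using hd[of x 0] by (simp add: DERIV_def)
    moreover have "filterlim (\<lambda>n. 1 / real (Suc n)) (at 0) sequentially"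
      unfolding filterlim_at using LIMSEQ_Suc[OF lim_1_over_n] by auto
    ultimately have "(\<lambda>n. (\<psi> (x + (1 / Suc n) *\<^sub>R b) - \<psi> x) / (1 / Suc n)) \<longlonglongrightarrow> D x"
      by (rule filterlim_compose)
    then show ?thesis by (simp add: s_def)
  qed
  have bound: "norm (s n x) \<le> M * indicator (cball 0 (R + 1)) x" for n x
  proof (cases "x \<in> cball 0 (R + 1)")
    case False
    have "norm ((1 / real (Suc n)) *\<^sub>R b) \<le> 1" using b by simp
    with False have "norm (x + (1 / Suc n) *\<^sub>R b) > R"
      using norm_diff_ineq[of x "(1 / Suc n) *\<^sub>R b"] by (simp only: mem_cball_0)
    then have "x \<notin> K" "x + (1 / Suc n) *\<^sub>R b \<notin> K" using R False by auto
    then show ?thesis using K(2) False by (simp add: s_def)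
  next
    case True
    have "\<exists>z>0. z < 1 / Suc n \<and> \<psi> (x + (1 / Suc n) *\<^sub>R b) - \<psi> (x + 0 *\<^sub>R b)
        = (1 / Suc n - 0) * D (x + z *\<^sub>R b)"
      by (rule MVT2) (auto intro: hd)
    then obtain z where z: "0 < z" "z < 1 / Suc n" "\<psi> (x + (1 / Suc n) *\<^sub>R b) - \<psi> x = (1 / Suc n) * D (x + z *\<^sub>R b)"
      by auto
    then have "s n x = D (x + z *\<^sub>R b)" by (simp add: s_def)
    have "1 / real (Suc n) \<le> 1" by simp
    then have "z \<le> 1" using z(2) by linarith
    then have "norm (x + z *\<^sub>R b) \<le> R + 2"
      using norm_triangle_ineq[of x "z *\<^sub>R b"] True b z by simp
    with M[of "x + z *\<^sub>R b"] True \<open>s n x = D (x + z *\<^sub>R b)\<close> show ?thesis by simp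
  qed
  have int: "integrable lborel \<psi>"
    by (rule integrable_continuous_compact_support[OF C_k_imp_continuous[OF \<psi>] K(1,2)])
  have "(\<integral>x. s n x \<partial>lborel) = 0" for n
  proof -
    have "(\<integral>x. \<psi> (x + (1 / Suc n) *\<^sub>R b) - \<psi> x \<partial>lborel) = 0"
      using lborel_integrable_translate[OF int, of "(1 / Suc n) *\<^sub>R b"] int
        lborel_integral_translate[of \<psi> "(1 / Suc n) *\<^sub>R b"] by (simp add: add.commute)
    then show ?thesis unfolding s_def by simp
  qed
  moreover have "(\<lambda>n. \<integral>x. s n x \<partial>lborel) \<longlonglongrightarrow> (\<integral>x. D x \<partial>lborel)"
  proof (rule integral_dominated_convergence)
    show "integrable lborel (\<lambda>x. M * indicator (cball 0 (R + 1)) x :: real)"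
      by (rule integrable_indicator_cball)
    show "D \<in> borel_measurable lborel" using borel_measurable_continuous_onI[OF cD] by simp
    show "s n \<in> borel_measurable lborel" for n unfolding s_def by measurable
  qed (use lim bound in auto)
  ultimately have "(\<lambda>n. 0) \<longlonglongrightarrow> (\<integral>x. D x \<partial>lborel)" by simp
  then show ?thesis by (simp add: D_def LIMSEQ_const_iff)
qed

lemma test_functionsD:
  assumes "\<phi> \<in> test_functions \<Omega>"
  shows "C_k k \<phi>" "compact (closure {x. \<phi> x \<noteq> 0})" "closure {x. \<phi> x \<noteq> 0} \<subseteq> \<Omega>"
    "x \<notin> closure {x. \<phi> x \<noteq> 0} \<Longrightarrow> \<phi> x = 0"
  using assms closure_subset[of "{x. \<phi> x \<noteq> 0}"] by (auto simp: test_functions_def)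

lemma test_functionsI:
  assumes "\<And>k. C_k k \<phi>" "compact K" "K \<subseteq> \<Omega>" "\<And>x. x \<notin> K \<Longrightarrow> \<phi> x = 0"
  shows "\<phi> \<in> test_functions \<Omega>"
proof -
  have "closure {x. \<phi> x \<noteq> 0} \<subseteq> K"
    using assms(2,4) by (intro closure_minimal compact_imp_closed) auto
  moreover from this have "compact (closure {x. \<phi> x \<noteq> 0})"
    using compact_Int_closed[OF assms(2) closed_closure, of "{x. \<phi> x \<noteq> 0}"] by (simp add: Int_absorb1)
  ultimately show ?thesis using assms(1,3) by (auto simp: test_functions_def)
qed

lemma partial_deriv_eq_0_outside:
  fixes \<phi> :: "'a::euclidean_space \<Rightarrow> real"
  assumes "C_k (Suc 0) \<phi>" "x \<notin> closure {x. \<phi> x \<noteq> 0}"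
  shows "frechet_derivative \<phi> (at x) b = 0"
proof -
  have "eventually (\<lambda>y. y \<notin> closure {x. \<phi> x \<noteq> 0}) (nhds x)"
    using assms(2) by (auto intro: eventually_nhds_in_open[of "- closure {x. \<phi> x \<noteq> 0}", simplified])
  then have "eventually (\<lambda>y. 0 = \<phi> y) (at x within UNIV)"
    using closure_subset[of "{x. \<phi> x \<noteq> 0}"] by (auto simp: eventually_at_filter elim!: eventually_mono)
  then have "(\<phi> has_derivative (\<lambda>_. 0)) (at x)"
    by (rule has_derivative_transform_eventually[OF has_derivative_const])
       (use assms(2) closure_subset[of "{x. \<phi> x \<noteq> 0}"] in auto)
  then have "frechet_derivative \<phi> (at x) = (\<lambda>_. 0)" by (rule frechet_derivative_at[symmetric])
  then show ?thesis by simp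
qed

lemma partial_deriv_mult:
  fixes \<phi> \<psi> :: "'a::euclidean_space \<Rightarrow> real"
  assumes "C_k (Suc 0) \<phi>" "C_k (Suc 0) \<psi>"
  shows "frechet_derivative (\<lambda>x. \<phi> x * \<psi> x) (at x) b
    = \<phi> x * frechet_derivative \<psi> (at x) b + frechet_derivative \<phi> (at x) b * \<psi> x"
  by (subst frechet_derivative_at[OF has_derivative_mult[OF C_k_Suc_has_derivative[OF assms(1)]
        C_k_Suc_has_derivative[OF assms(2)]], symmetric]) simp

text \<open>The bumps are bounded by 1 and converge to the indicator of the box, so testing with
  them amounts in the limit to integrating over the box.\<close>

lemma fundamental_lemma_box:
  fixes g :: "'a::euclidean_space \<Rightarrow> real"
  assumes int: "set_integrable lborel (cbox a c) g" and sub: "cbox a c \<subseteq> \<Omega>"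
    and test: "\<And>\<phi>. \<phi> \<in> test_functions \<Omega> \<Longrightarrow> (LINT x:\<Omega>|lborel. g x * \<phi> x) = 0"
  shows "(LINT x:box a c|lborel. g x) = 0"
proof -
  define h where "h x = indicator (cbox a c) x * g x" for x
  have h: "integrable lborel h" using int by (simp add: set_integrable_def h_def[abs_def])
  have bm: "bump a c (1 / Suc n) \<in> borel_measurable borel" for n
    by (rule borel_measurable_continuous_onI[OF C_k_imp_continuous[OF C_k_bump]]) simp
  have "(\<lambda>n. \<integral>x. h x * bump a c (1 / Suc n) x \<partial>lborel) \<longlonglongrightarrow> (\<integral>x. h x * indicator (box a c) x \<partial>lborel)"
  proof (rule integral_dominated_convergence)
    show "integrable lborel (\<lambda>x. norm (h x))" using h by simp
    show "AE x in lborel. (\<lambda>n. h x * bump a c (1 / Suc n) x) \<longlonglongrightarrow> h x * indicator (box a c) x"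
      by (intro AE_I2 tendsto_mult tendsto_const bump_tendsto_indicator)
    show "AE x in lborel. norm (h x * bump a c (1 / Suc n) x) \<le> norm (h x)" for n
      using bump_bounds[of "1 / Suc n" a c] by (auto simp: abs_mult intro!: mult_left_le)
  qed (use h bm in \<open>auto intro!: borel_measurable_times borel_measurable_indicator\<close>)
  moreover have "(\<integral>x. h x * bump a c (1 / Suc n) x \<partial>lborel) = 0" for n
  proof -
    have "h x * bump a c (1 / Suc n) x = indicator \<Omega> x *\<^sub>R (g x * bump a c (1 / Suc n) x)" for x
      using sub box_subset_cbox[of a c] by (cases "x \<in> box a c") (auto simp: bump_eq_0 h_def indicator_def)
    then show ?thesis
      using test[OF test_function_bump[OF _ sub, of "1 / Suc n"]]
      unfolding set_lebesgue_integral_def by (simp only:) simp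
  qed
  ultimately have "(\<integral>x. h x * indicator (box a c) x \<partial>lborel) = 0" by (simp add: LIMSEQ_const_iff)
  also have "(\<lambda>x. h x * indicator (box a c) x) = (\<lambda>x. indicator (box a c) x *\<^sub>R g x)"
    using box_subset_cbox[of a c] by (auto simp: h_def indicator_def fun_eq_iff)
  finally show ?thesis by (simp add: set_lebesgue_integral_def)
qed

text \<open>Boxes are stable under intersection and generate the Borel sets, so vanishing integrals
  extend to all Borel sets. The hypothesis \<open>total\<close> serves the complement step, since
  the whole space is not a box.\<close>

lemma integral_boxes_zero_AE:
  fixes h :: "'a::euclidean_space \<Rightarrow> real"
  assumes h: "integrable lborel h" and boxes: "\<And>a b. (LINT x:box a b|lborel. h x) = 0"
    and total: "(\<integral>x. h x \<partial>lborel) = 0"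
  shows "AE x in lborel. h x = 0"
proof (rule sigma_finite_measure.density_zero[OF sigma_finite_lborel h])
  fix A :: "'a set" assume "A \<in> sets lborel"
  then have A: "A \<in> sigma_sets UNIV (range (\<lambda>(a, b). box a b))"
    by (simp add: borel_eq_box)
  have "Int_stable (range (\<lambda>(a, b). box a b :: 'a set))"
    by (auto simp: Int_stable_def box_Int_box)
  moreover have "range (\<lambda>(a, b). box a b :: 'a set) \<subseteq> Pow UNIV" by simp
  ultimately show "(LINT x:A|lborel. h x) = 0"
    using A
  proof (induction rule: sigma_sets_induct_disjoint)
    case (basic A) then show ?case using boxes by auto
  next
    case (compl A)
    then have A: "A \<in> sets lborel" by (simp add: borel_eq_box)
    have "(LINT x:UNIV - A|lborel. h x) = (\<integral>x. h x - indicator A x *\<^sub>R h x \<partial>lborel)"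
      unfolding set_lebesgue_integral_def by (intro Bochner_Integration.integral_cong) (auto simp: indicator_def)
    also have "\<dots> = (\<integral>x. h x \<partial>lborel) - (LINT x:A|lborel. h x)"
      unfolding set_lebesgue_integral_def
      by (intro Bochner_Integration.integral_diff h integrable_mult_indicator A)
    finally show ?case using compl total by simp
  next
    case (union A)
    then have A: "A i \<in> sets lborel" for i by (auto simp: borel_eq_box)
    have "(LINT x:(\<Union>i. A i)|lborel. h x) = (\<Sum>i. LINT x:A i|lborel. h x)"
      using A union(1) h
      by (intro lebesgue_integral_countable_add)
         (auto simp: disjoint_family_on_def set_integrable_def
           intro!: integrable_mult_indicator simp del: real_scaleR_def)
    then show ?case using union by simp
  qed (auto simp: set_lebesgue_integral_def)
qed

text \<open>The function is cut off to a closed box inside the domain; any box then meets it in a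
  box to which \<open>fundamental_lemma_box\<close> applies. Countably many closed boxes cover an
  open set, which makes the conclusion global.\<close>

lemma fundamental_lemma:
  fixes g :: "'a::euclidean_space \<Rightarrow> real"
  assumes "open \<Omega>" and int: "\<And>a c. cbox a c \<subseteq> \<Omega> \<Longrightarrow> set_integrable lborel (cbox a c) g"
    and test: "\<And>\<phi>. \<phi> \<in> test_functions \<Omega> \<Longrightarrow> (LINT x:\<Omega>|lborel. g x * \<phi> x) = 0"
  shows "AE x\<in>\<Omega> in lborel. g x = 0"
proof -
  have *: "AE x\<in>cbox a c in lborel. g x = 0" if sub: "cbox a c \<subseteq> \<Omega>" for a c
  proof -
    define h where "h x = indicator (cbox a c) x *\<^sub>R g x" for x
    have h: "integrable lborel h" using int[OF sub] by (simp add: set_integrable_def h_def[abs_def])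
    \<comment> \<open>Integrability is assumed on closed boxes, while vanishing integrals are known
      on open ones; the faces in between are null.\<close>
    have null: "AE x in lborel. x \<notin> cbox a c - box a c"
      by (rule AE_not_in) (rule null_sets_cbox_Diff_box)
    have box: "(LINT x:box p q|lborel. g x) = 0" if "box p q \<subseteq> box a c" for p q
    proof (cases "box p q = {}")
      case False
      then have "cbox p q \<subseteq> cbox a c"
        using closure_mono[OF that] by (cases "box a c = {}") auto
      then show ?thesis
        using sub int by (intro fundamental_lemma_box[OF _ _ test]) auto
    qed (simp add: set_lebesgue_integral_def)
    have "AE x in lborel. h x = 0"
    proof (rule integral_boxes_zero_AE[OF h])
      fix p q :: 'a
      obtain r s where rs: "box p q \<inter> box a c = box r s" using box_Int_box[of p q a c] by blast
      have "(LINT x:box p q|lborel. h x) = (LINT x:box r s|lborel. h x)"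
        unfolding set_lebesgue_integral_def rs[symmetric]
        by (rule integral_cong_AE, use h in measurable)
           (use null in eventually_elim, auto simp: h_def indicator_def)
      also have "\<dots> = (LINT x:box r s|lborel. g x)"
        unfolding set_lebesgue_integral_def rs[symmetric] using box_subset_cbox[of a c]
        by (intro Bochner_Integration.integral_cong) (auto simp: h_def indicator_def)
      finally have "(LINT x:box p q|lborel. h x) = (LINT x:box r s|lborel. g x)" .
      then show "(LINT x:box p q|lborel. h x) = 0" using box rs by (metis inf_le2)
      have "(\<integral>x. h x \<partial>lborel) = (LINT x:box a c|lborel. h x)"
        unfolding set_lebesgue_integral_def
        by (rule integral_cong_AE, use h in measurable)
           (use null in eventually_elim, auto simp: h_def indicator_def)
      also have "\<dots> = (LINT x:box a c|lborel. g x)"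
        unfolding set_lebesgue_integral_def using box_subset_cbox[of a c]
        by (intro Bochner_Integration.integral_cong) (auto simp: h_def indicator_def)
      finally have "(\<integral>x. h x \<partial>lborel) = (LINT x:box a c|lborel. g x)" .
      then show "(\<integral>x. h x \<partial>lborel) = 0" using box by simp
    qed
    then show ?thesis by (auto simp: h_def)
  qed
  obtain \<D> where D: "countable \<D>" "\<D> \<subseteq> Pow \<Omega>" "\<And>X. X \<in> \<D> \<Longrightarrow> \<exists>a b. X = cbox a b" "\<Union>\<D> = \<Omega>"
    using open_countable_Union_open_cbox[OF assms(1)] by metis
  have "AE x in lborel. \<forall>X\<in>\<D>. x \<in> X \<longrightarrow> g x = 0"
    using * D(2,3) by (subst AE_ball_countable[OF D(1)]) blast
  then show ?thesis using D(4) by (auto elim!: AE_mp)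
qed

section \<open>Semi-inner products and \<open>L\<^sup>2\<close>\<close>

text \<open>Definiteness fails for representatives of classes modulo null sets, so only a positive
  semidefinite form is postulated. The locale is shared by the L2 form, the Dirichlet form and their
  sum, and by the finite-dimensional space as well as the infinite-dimensional ones.\<close>

locale semi_inner =
  fixes V :: "('a \<Rightarrow> real) set" and q :: "('a \<Rightarrow> real) \<Rightarrow> ('a \<Rightarrow> real) \<Rightarrow> real"
  assumes zero_mem: "(\<lambda>x. 0) \<in> V"
    and lin_mem: "\<And>a b v w. v \<in> V \<Longrightarrow> w \<in> V \<Longrightarrow> (\<lambda>x. a * v x + b * w x) \<in> V"
    and sym: "\<And>v w. v \<in> V \<Longrightarrow> w \<in> V \<Longrightarrow> q v w = q w v"
    and lin: "\<And>a b v w z. v \<in> V \<Longrightarrow> w \<in> V \<Longrightarrow> z \<in> V \<Longrightarrow> q (\<lambda>x. a * v x + b * w x) z = a * q v z + b * q w z"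
    and nonneg: "\<And>v. v \<in> V \<Longrightarrow> 0 \<le> q v v"
begin

lemma lin_right:
  assumes "v \<in> V" "w \<in> V" "z \<in> V"
  shows "q z (\<lambda>x. a * v x + b * w x) = a * q z v + b * q z w"
  using assms by (simp add: sym[of z] lin lin_mem)

lemma diff_mem: "v \<in> V \<Longrightarrow> w \<in> V \<Longrightarrow> (\<lambda>x. v x - w x) \<in> V"
  using lin_mem[of v w 1 "-1"] by simp

lemma add_mem: "v \<in> V \<Longrightarrow> w \<in> V \<Longrightarrow> (\<lambda>x. v x + w x) \<in> V"
  using lin_mem[of v w 1 1] by simp

lemma scale_mem: "v \<in> V \<Longrightarrow> (\<lambda>x. a * v x) \<in> V"
  using lin_mem[of v v a 0] by simp

lemma diff_left: "v \<in> V \<Longrightarrow> w \<in> V \<Longrightarrow> z \<in> V \<Longrightarrow> q (\<lambda>x. v x - w x) z = q v z - q w z"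
  using lin[of v w z 1 "-1"] by simp

lemma diff_right: "v \<in> V \<Longrightarrow> w \<in> V \<Longrightarrow> z \<in> V \<Longrightarrow> q z (\<lambda>x. v x - w x) = q z v - q z w"
  using lin_right[of v w z 1 "-1"] by simp

lemma scale_left: "v \<in> V \<Longrightarrow> z \<in> V \<Longrightarrow> q (\<lambda>x. a * v x) z = a * q v z"
  using lin[of v v z a 0] by simp

lemma scale_right: "v \<in> V \<Longrightarrow> z \<in> V \<Longrightarrow> q z (\<lambda>x. a * v x) = a * q z v"
  using lin_right[of v v z a 0] by simp

lemma zero_left: "z \<in> V \<Longrightarrow> q (\<lambda>x. 0) z = 0"
  using lin[of z z z 0 0] by simp

lemma sum_mem: "(\<And>i. i \<in> I \<Longrightarrow> b i \<in> V) \<Longrightarrow> (\<lambda>x. \<Sum>i\<in>I. c i * b i x) \<in> V"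
proof (induction I rule: infinite_finite_induct)
  case (insert i I)
  then show ?case using lin_mem[of "b i" "\<lambda>x. \<Sum>i\<in>I. c i * b i x" "c i" 1] by simp
qed (simp_all add: zero_mem)

lemma sum_left:
  "(\<And>i. i \<in> I \<Longrightarrow> b i \<in> V) \<Longrightarrow> z \<in> V \<Longrightarrow> q (\<lambda>x. \<Sum>i\<in>I. c i * b i x) z = (\<Sum>i\<in>I. c i * q (b i) z)"
proof (induction I rule: infinite_finite_induct)
  case (insert i I)
  then show ?case
    using lin[of "b i" "\<lambda>x. \<Sum>i\<in>I. c i * b i x" z "c i" 1] sum_mem[of I b c] by simp
qed (simp_all add: zero_left)

lemma sum_right:
  assumes "\<And>i. i \<in> I \<Longrightarrow> b i \<in> V" "z \<in> V"
  shows "q z (\<lambda>x. \<Sum>i\<in>I. c i * b i x) = (\<Sum>i\<in>I. c i * q z (b i))"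
  using assms by (simp add: sym[of z] sum_left sum_mem cong: sum.cong)

lemma norm_diff_sq:
  assumes "v \<in> V" "w \<in> V"
  shows "q (\<lambda>x. v x - w x) (\<lambda>x. v x - w x) = q v v - 2 * q v w + q w w"
  using assms by (simp add: diff_left diff_right diff_mem sym[of w v])

lemma Cauchy_Schwarz:
  assumes v: "v \<in> V" and w: "w \<in> V"
  shows "(q v w)\<^sup>2 \<le> q v v * q w w"
proof -
  have *: "0 \<le> a\<^sup>2 * q v v + 2 * a * b * q v w + b\<^sup>2 * q w w" for a b
    using nonneg[OF lin_mem[OF v w, of a b]] v w lin_mem[OF v w, of a b]
    by (simp add: lin lin_right sym[of w v] algebra_simps power2_eq_square)
  show ?thesis
  proof (cases "q w w = 0")
    case True
    have "q v w = 0"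
    proof (rule ccontr)
      assume "q v w \<noteq> 0"
      \<comment> \<open>When \<open>q w w = 0\<close> the quadratic expression is affine in b; this
        b makes it equal to -1.\<close>
      then show False
        using *[of 1 "- (q v v + 1) / (2 * q v w)"] True by (auto simp: field_simps)
    qed
    then show ?thesis using True by simp
  next
    case False
    then have pos: "0 < q w w" using nonneg[OF w] by simp
    have "0 \<le> q w w * (q w w * q v v - (q v w)\<^sup>2)"
      using *[of "q w w" "- q v w"] by (simp add: power2_eq_square algebra_simps)
    then show ?thesis using pos by (simp add: zero_le_mult_iff mult.commute)
  qed
qed

lemma abs_le: "v \<in> V \<Longrightarrow> w \<in> V \<Longrightarrow> \<bar>q v w\<bar> \<le> sqrt (q v v) * sqrt (q w w)"
  using real_sqrt_le_mono[OF Cauchy_Schwarz] by (fastforce simp: real_sqrt_mult)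

lemma triangle:
  assumes v: "v \<in> V" and w: "w \<in> V"
  shows "sqrt (q (\<lambda>x. v x + w x) (\<lambda>x. v x + w x)) \<le> sqrt (q v v) + sqrt (q w w)"
proof (rule real_le_lsqrt)
  have "q (\<lambda>x. v x + w x) (\<lambda>x. v x + w x) = q v v + 2 * q v w + q w w"
    using lin[of v w _ 1 1] lin_right[of v w _ 1 1] v w add_mem[OF v w] by (simp add: sym[of w v])
  also have "\<dots> \<le> q v v + 2 * (sqrt (q v v) * sqrt (q w w)) + q w w"
    using abs_le[OF v w] by simp
  also have "\<dots> = (sqrt (q v v) + sqrt (q w w))\<^sup>2"
    using nonneg[OF v] nonneg[OF w] by (simp add: power2_sum)
  finally show "q (\<lambda>x. v x + w x) (\<lambda>x. v x + w x) \<le> (sqrt (q v v) + sqrt (q w w))\<^sup>2" .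
qed (use nonneg v w in simp)

lemma null_left: "v \<in> V \<Longrightarrow> w \<in> V \<Longrightarrow> q v v = 0 \<Longrightarrow> q v w = 0"
  using Cauchy_Schwarz[of v w] by simp

end

lemma semi_inner_subset:
  assumes "semi_inner V q" "W \<subseteq> V" "(\<lambda>x. 0) \<in> W"
    "\<And>a b v w. v \<in> W \<Longrightarrow> w \<in> W \<Longrightarrow> (\<lambda>x. a * v x + b * w x) \<in> W"
  shows "semi_inner W q"
  using assms unfolding semi_inner_def by (meson subsetD)

text \<open>Integrals over a restricted measure, unlike set integrals, combine directly with product
  measures and the Fubini theorem.\<close>

abbreviation lebesgue_in :: "'a::euclidean_space set \<Rightarrow> 'a measure" where
  "lebesgue_in \<Omega> \<equiv> restrict_space lborel \<Omega>"

lemma L2_iff: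
  assumes "\<Omega> \<in> sets borel"
  shows "v \<in> L2 \<Omega> \<longleftrightarrow> v \<in> borel_measurable (lebesgue_in \<Omega>) \<and> integrable (lebesgue_in \<Omega>) (\<lambda>x. (norm (v x))\<^sup>2)"
  using assms
  by (simp add: L2_def set_borel_measurable_def set_integrable_def integrable_restrict_space
      borel_measurable_restrict_space_iff del: real_scaleR_def)

lemma set_lebesgue_integral_restrict:
  fixes f :: "'a::euclidean_space \<Rightarrow> 'b::{banach, second_countable_topology}"
  assumes "\<Omega> \<in> sets borel"
  shows "(LINT x:\<Omega>|lborel. f x) = (\<integral>x. f x \<partial>lebesgue_in \<Omega>)"
  using assms by (simp add: set_lebesgue_integral_def integral_restrict_space)

lemma set_integrable_restrict:
  fixes f :: "'a::euclidean_space \<Rightarrow> 'b::{banach, second_countable_topology}"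
  assumes "\<Omega> \<in> sets borel"
  shows "set_integrable lborel \<Omega> f \<longleftrightarrow> integrable (lebesgue_in \<Omega>) f"
  using assms by (simp add: set_integrable_def integrable_restrict_space)

lemma AE_restrict:
  assumes "\<Omega> \<in> sets borel"
  shows "(AE x\<in>\<Omega> in lborel. P x) \<longleftrightarrow> (AE x in lebesgue_in \<Omega>. P x)"
  using assms by (simp add: AE_restrict_space_iff)

lemma inner_L2_eq: "\<Omega> \<in> sets borel \<Longrightarrow> inner_L2 \<Omega> v w = (\<integral>x. v x \<bullet> w x \<partial>lebesgue_in \<Omega>)"
  unfolding inner_L2_def by (rule set_lebesgue_integral_restrict)

lemma norm_L2_eq: "norm_L2 \<Omega> v = sqrt (inner_L2 \<Omega> v v)"
  by (simp add: norm_L2_def inner_L2_def power2_norm_eq_inner)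

lemma inner_L2_nonneg: "0 \<le> inner_L2 \<Omega> v v"
  unfolding inner_L2_def set_lebesgue_integral_def by (rule integral_nonneg_AE) (simp add: indicator_def)

lemma norm_L2_sq: "(norm_L2 \<Omega> v)\<^sup>2 = inner_L2 \<Omega> v v"
  by (simp add: norm_L2_eq inner_L2_nonneg)

lemma norm_L2_nonneg: "0 \<le> norm_L2 \<Omega> v"
  by (simp add: norm_L2_eq inner_L2_nonneg)

lemma inner_L2_commute: "inner_L2 \<Omega> v w = inner_L2 \<Omega> w v"
  by (simp add: inner_L2_def inner_commute)

lemma integrable_inner:
  fixes v w :: "'a \<Rightarrow> 'b::euclidean_space"
  assumes [measurable]: "v \<in> borel_measurable M" "w \<in> borel_measurable M"
    and "integrable M (\<lambda>x. (norm (v x))\<^sup>2)" "integrable M (\<lambda>x. (norm (w x))\<^sup>2)"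
  shows "integrable M (\<lambda>x. v x \<bullet> w x)"
proof (rule Bochner_Integration.integrable_bound)
  show "integrable M (\<lambda>x. (norm (v x))\<^sup>2 + (norm (w x))\<^sup>2)" using assms by simp
  have "\<bar>v x \<bullet> w x\<bar> \<le> \<bar>(norm (v x))\<^sup>2 + (norm (w x))\<^sup>2\<bar>" for x
    using Cauchy_Schwarz_ineq2[of "v x" "w x"] sum_squares_bound[of "norm (v x)" "norm (w x)"]
      zero_le_mult_iff[of "norm (v x)" "norm (w x)"] by simp
  then show "AE x in M. norm (v x \<bullet> w x) \<le> norm ((norm (v x))\<^sup>2 + (norm (w x))\<^sup>2)" by simp
qed measurable

lemma integrable_sq_lin:
  fixes v w :: "'a \<Rightarrow> 'b::euclidean_space"
  assumes [measurable]: "v \<in> borel_measurable M" "w \<in> borel_measurable M"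
    and "integrable M (\<lambda>x. (norm (v x))\<^sup>2)" "integrable M (\<lambda>x. (norm (w x))\<^sup>2)"
  shows "integrable M (\<lambda>x. (norm (a *\<^sub>R v x + b *\<^sub>R w x))\<^sup>2)"
proof -
  have "(norm (a *\<^sub>R v x + b *\<^sub>R w x))\<^sup>2
      = a\<^sup>2 * (norm (v x))\<^sup>2 + 2 * a * b * (v x \<bullet> w x) + b\<^sup>2 * (norm (w x))\<^sup>2" for x
    unfolding power2_norm_eq_inner inner_add_left inner_add_right inner_scaleR_left inner_scaleR_right
    by (simp add: inner_commute[of "w x" "v x"] power2_eq_square algebra_simps)
  then show ?thesis
    using integrable_inner[OF assms] assms by simp
qed

lemma L2_lin:
  fixes v w :: "'a::euclidean_space \<Rightarrow> 'b::euclidean_space"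
  assumes "\<Omega> \<in> sets borel" "v \<in> L2 \<Omega>" "w \<in> L2 \<Omega>"
  shows "(\<lambda>x. a *\<^sub>R v x + b *\<^sub>R w x) \<in> L2 \<Omega>"
  using assms
  by (auto simp: L2_iff integrable_sq_lin intro!: borel_measurable_add borel_measurable_scaleR)

lemma integrable_inner_L2:
  fixes v w :: "'a::euclidean_space \<Rightarrow> 'b::euclidean_space"
  assumes "\<Omega> \<in> sets borel" "v \<in> L2 \<Omega>" "w \<in> L2 \<Omega>"
  shows "integrable (lebesgue_in \<Omega>) (\<lambda>x. v x \<bullet> w x)"
  using assms by (simp add: L2_iff integrable_inner)

lemma inner_L2_lin:
  fixes v w :: "'a::euclidean_space \<Rightarrow> 'b::euclidean_space"
  assumes "\<Omega> \<in> sets borel" "v \<in> L2 \<Omega>" "w \<in> L2 \<Omega>" "z \<in> L2 \<Omega>"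
  shows "inner_L2 \<Omega> (\<lambda>x. a *\<^sub>R v x + b *\<^sub>R w x) z = a * inner_L2 \<Omega> v z + b * inner_L2 \<Omega> w z"
  using assms by (simp add: inner_L2_eq inner_add_left integrable_inner_L2)

lemma inner_L2_cong_AE:
  fixes v w v' w' :: "'a::euclidean_space \<Rightarrow> 'b::euclidean_space"
  assumes "\<Omega> \<in> sets borel" "AE x\<in>\<Omega> in lborel. v x = v' x" "AE x\<in>\<Omega> in lborel. w x = w' x"
    "v \<in> L2 \<Omega>" "v' \<in> L2 \<Omega>" "w \<in> L2 \<Omega>" "w' \<in> L2 \<Omega>"
  shows "inner_L2 \<Omega> v w = inner_L2 \<Omega> v' w'"
  using assms by (auto simp: inner_L2_eq AE_restrict L2_iff intro!: integral_cong_AE)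

lemma L2_zero: "\<Omega> \<in> sets borel \<Longrightarrow> (\<lambda>x. 0) \<in> L2 \<Omega>"
  by (simp add: L2_iff)

lemma const_L2:
  assumes "\<Omega> \<in> sets borel" "bounded \<Omega>"
  shows "(\<lambda>x. 1 :: real) \<in> L2 \<Omega>"
  using assms
  by (auto simp: L2_def set_borel_measurable_def set_integrable_def
      intro!: integrable_real_indicator emeasure_bounded_finite)

lemma inner_L2_eq_0_AE:
  fixes v :: "'a::euclidean_space \<Rightarrow> 'b::euclidean_space"
  assumes "\<Omega> \<in> sets borel" "v \<in> L2 \<Omega>" "inner_L2 \<Omega> v v = 0"
  shows "AE x\<in>\<Omega> in lborel. v x = 0"
  using assms integral_nonneg_eq_0_iff_AE[OF integrable_inner_L2[OF assms(1,2,2)]]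
  by (simp add: inner_L2_eq AE_restrict)

lemma semi_inner_L2: "\<Omega> \<in> sets borel \<Longrightarrow> semi_inner (L2 \<Omega>) (inner_L2 \<Omega>)"
  using L2_lin[of \<Omega>, where 'b = real] inner_L2_lin[of \<Omega>, where 'b = real]
  by unfold_locales (auto simp: L2_zero inner_L2_nonneg intro: inner_L2_commute)

section \<open>Weak gradients\<close>

lemma continuous_compact_support_L2:
  fixes f :: "'a::euclidean_space \<Rightarrow> 'b::euclidean_space"
  assumes "\<Omega> \<in> sets borel" "continuous_on UNIV f" "compact K" "\<And>x. x \<notin> K \<Longrightarrow> f x = 0"
  shows "f \<in> L2 \<Omega>"
proof -
  have "integrable lborel (\<lambda>x. (norm (f x))\<^sup>2)"
    by (rule integrable_continuous_compact_support[OF _ assms(3)])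
       (use assms in \<open>auto intro!: continuous_intros\<close>)
  then have "set_integrable lborel \<Omega> (\<lambda>x. (norm (f x))\<^sup>2)"
    using assms(1) unfolding set_integrable_def by (intro integrable_mult_indicator) auto
  then show ?thesis
    using assms(1) borel_measurable_continuous_onI[OF assms(2)]
    by (simp add: L2_def set_borel_measurable_def)
qed

lemma C_k_partial_deriv: "C_k (Suc k) \<phi> \<Longrightarrow> b \<in> Basis \<Longrightarrow> C_k k (\<lambda>x. frechet_derivative \<phi> (at x) b)"
  by simp

lemma test_function_L2:
  assumes "\<Omega> \<in> sets borel" "\<phi> \<in> test_functions \<Omega>"
  shows "\<phi> \<in> L2 \<Omega>"
  using continuous_compact_support_L2[OF assms(1) C_k_imp_continuous[OF test_functionsD(1)[OF assms(2)]]
    test_functionsD(2)[OF assms(2)] test_functionsD(4)[OF assms(2)]] .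

lemma test_function_partial_L2:
  assumes "\<Omega> \<in> sets borel" "\<phi> \<in> test_functions \<Omega>" "b \<in> Basis"
  shows "(\<lambda>x. frechet_derivative \<phi> (at x) b) \<in> L2 \<Omega>"
  by (rule continuous_compact_support_L2[OF assms(1) C_k_imp_continuous[OF C_k_partial_deriv[OF test_functionsD(1)[OF assms(2)] assms(3)]]
    test_functionsD(2)[OF assms(2)] partial_deriv_eq_0_outside[OF test_functionsD(1)[OF assms(2)]]])

definition cgrad :: "('a::euclidean_space \<Rightarrow> real) \<Rightarrow> 'a \<Rightarrow> 'a" where
  "cgrad \<phi> x = (\<Sum>b\<in>Basis. frechet_derivative \<phi> (at x) b *\<^sub>R b)"

lemma cgrad_inner: "b \<in> Basis \<Longrightarrow> cgrad \<phi> x \<bullet> b = frechet_derivative \<phi> (at x) b"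
  by (simp add: cgrad_def)

lemma cgrad_L2:
  assumes "\<Omega> \<in> sets borel" "\<phi> \<in> test_functions \<Omega>"
  shows "cgrad \<phi> \<in> L2 \<Omega>"
proof (rule continuous_compact_support_L2[OF assms(1) _ test_functionsD(2)[OF assms(2)]])
  show "continuous_on UNIV (cgrad \<phi>)"
    unfolding cgrad_def[abs_def]
    by (intro continuous_intros C_k_imp_continuous[OF C_k_partial_deriv[OF test_functionsD(1)[OF assms(2)]]])
qed (simp add: cgrad_def partial_deriv_eq_0_outside[OF test_functionsD(1)[OF assms(2)]])

lemma test_function_integral_UNIV:
  assumes "\<phi> \<in> test_functions \<Omega>"
  shows "(LINT x:\<Omega>|lborel. v x * \<phi> x) = (\<integral>x. v x * \<phi> x \<partial>lborel)"
    and "(LINT x:\<Omega>|lborel. v x * frechet_derivative \<phi> (at x) b) = (\<integral>x. v x * frechet_derivative \<phi> (at x) b \<partial>lborel)"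
proof -
  have "indicator \<Omega> x *\<^sub>R (v x * \<phi> x) = v x * \<phi> x"
    "indicator \<Omega> x *\<^sub>R (v x * frechet_derivative \<phi> (at x) b) = v x * frechet_derivative \<phi> (at x) b" for x
  proof (atomize (full), cases "x \<in> \<Omega>")
    case False
    then have "x \<notin> closure {x. \<phi> x \<noteq> 0}" using test_functionsD(3)[OF assms] by blast
    then show "indicator \<Omega> x *\<^sub>R (v x * \<phi> x) = v x * \<phi> x \<and>
        indicator \<Omega> x *\<^sub>R (v x * frechet_derivative \<phi> (at x) b) = v x * frechet_derivative \<phi> (at x) b"
      by (simp add: test_functionsD(4)[OF assms, of x]
          partial_deriv_eq_0_outside[OF test_functionsD(1)[OF assms], of x] del: C_k.simps)
  qed simp
  then show "(LINT x:\<Omega>|lborel. v x * \<phi> x) = (\<integral>x. v x * \<phi> x \<partial>lborel)"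
    "(LINT x:\<Omega>|lborel. v x * frechet_derivative \<phi> (at x) b) = (\<integral>x. v x * frechet_derivative \<phi> (at x) b \<partial>lborel)"
    by (simp_all only: set_lebesgue_integral_def)
qed

text \<open>The product of two test functions has compact support, so each of its partial
  derivatives integrates to 0; the product rule turns this into the weak identity.\<close>

lemma test_function_has_weak_grad:
  assumes \<Omega>: "\<Omega> \<in> sets borel" and \<phi>: "\<phi> \<in> test_functions \<Omega>"
  shows "has_weak_grad \<Omega> \<phi> (cgrad \<phi>)"
  unfolding has_weak_grad_def
proof (intro conjI ballI test_function_L2 cgrad_L2 assms)
  fix \<psi> and b :: 'a assume \<psi>: "\<psi> \<in> test_functions \<Omega>" and b: "b \<in> Basis"
  note C = test_functionsD(1)[OF \<phi>, of "Suc 0"] test_functionsD(1)[OF \<psi>, of "Suc 0"]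
  define K where "K = closure {x. \<psi> x \<noteq> 0}"
  have cK: "compact K" unfolding K_def by (rule test_functionsD(2)[OF \<psi>])
  have K: "\<psi> x = 0" "frechet_derivative \<psi> (at x) b = 0" if "x \<notin> K" for x
    using that test_functionsD(4)[OF \<psi>] partial_deriv_eq_0_outside[OF C(2)] unfolding K_def by blast+
  note cont = C_k_imp_continuous[OF C(1)] C_k_imp_continuous[OF C(2)]
    C_k_imp_continuous[OF C_k_partial_deriv[OF C(1) b]] C_k_imp_continuous[OF C_k_partial_deriv[OF C(2) b]]
  have "(\<integral>x. \<phi> x * frechet_derivative \<psi> (at x) b + frechet_derivative \<phi> (at x) b * \<psi> x \<partial>lborel) = 0"
    using integral_partial_deriv_eq_0[OF C_k_mult[OF C] cK _ b] K
    by (simp add: partial_deriv_mult[OF C])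
  moreover have "integrable lborel (\<lambda>x. \<phi> x * frechet_derivative \<psi> (at x) b)"
    "integrable lborel (\<lambda>x. frechet_derivative \<phi> (at x) b * \<psi> x)"
    by (rule integrable_continuous_compact_support[OF _ cK];
        use K cont in \<open>auto intro!: continuous_intros simp del: C_k.simps\<close>)+
  ultimately show "(LINT x:\<Omega>|lborel. \<phi> x * frechet_derivative \<psi> (at x) b) = - (LINT x:\<Omega>|lborel. (cgrad \<phi> x \<bullet> b) * \<psi> x)"
    by (simp add: test_function_integral_UNIV[OF \<psi>] cgrad_inner[OF b])
qed

lemma has_weak_gradD:
  assumes "has_weak_grad \<Omega> v G"
  shows "v \<in> L2 \<Omega>" "G \<in> L2 \<Omega>"
    and "\<phi> \<in> test_functions \<Omega> \<Longrightarrow> b \<in> Basis \<Longrightarrow>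
      inner_L2 \<Omega> v (\<lambda>x. frechet_derivative \<phi> (at x) b) = - inner_L2 \<Omega> (\<lambda>x. G x \<bullet> b) \<phi>"
  using assms by (auto simp: has_weak_grad_def inner_L2_def)

lemma L2_component:
  fixes G :: "'a::euclidean_space \<Rightarrow> 'b::euclidean_space"
  assumes "\<Omega> \<in> sets borel" "G \<in> L2 \<Omega>" "norm b \<le> 1"
  shows "(\<lambda>x. G x \<bullet> b) \<in> L2 \<Omega>"
proof -
  have [measurable]: "G \<in> borel_measurable (lebesgue_in \<Omega>)" using assms by (simp add: L2_iff)
  have "(G x \<bullet> b)\<^sup>2 \<le> (norm (G x))\<^sup>2" for x
    using Cauchy_Schwarz_ineq2[of "G x" b] mult_left_le[OF assms(3), of "norm (G x)"]
    by (intro abs_le_square_iff[THEN iffD1]) auto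
  then have ae: "AE x in lebesgue_in \<Omega>. norm ((G x \<bullet> b)\<^sup>2) \<le> norm ((norm (G x))\<^sup>2)"
    by (intro AE_I2) simp
  have int: "integrable (lebesgue_in \<Omega>) (\<lambda>x. (norm (G x))\<^sup>2)"
    using assms(1,2) by (simp add: L2_iff)
  have "(\<lambda>x. (G x \<bullet> b)\<^sup>2) \<in> borel_measurable (lebesgue_in \<Omega>)"
    by measurable
  from Bochner_Integration.integrable_bound[OF int this ae]
  have "integrable (lebesgue_in \<Omega>) (\<lambda>x. (G x \<bullet> b)\<^sup>2)" .
  then show ?thesis using assms(1) by (simp add: L2_iff)
qed

lemma has_weak_grad_lin:
  assumes \<Omega>: "\<Omega> \<in> sets borel" and v: "has_weak_grad \<Omega> v G" and w: "has_weak_grad \<Omega> w H"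
  shows "has_weak_grad \<Omega> (\<lambda>x. a * v x + b * w x) (\<lambda>x. a *\<^sub>R G x + b *\<^sub>R H x)"
proof -
  note V = has_weak_gradD[OF v] and W = has_weak_gradD[OF w]
  have "(\<lambda>x. a * v x + b * w x) \<in> L2 \<Omega>" "(\<lambda>x. a *\<^sub>R G x + b *\<^sub>R H x) \<in> L2 \<Omega>"
    using L2_lin[OF \<Omega> V(1) W(1)] L2_lin[OF \<Omega> V(2) W(2)] by simp_all
  moreover have "inner_L2 \<Omega> (\<lambda>x. a * v x + b * w x) (\<lambda>x. frechet_derivative \<phi> (at x) c)
      = - inner_L2 \<Omega> (\<lambda>x. (a *\<^sub>R G x + b *\<^sub>R H x) \<bullet> c) \<phi>"
    if \<phi>: "\<phi> \<in> test_functions \<Omega>" and c: "c \<in> Basis" for \<phi> c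
  proof -
    note L = test_function_L2[OF \<Omega> \<phi>] test_function_partial_L2[OF \<Omega> \<phi> c]
    have GH: "(\<lambda>x. G x \<bullet> c) \<in> L2 \<Omega>" "(\<lambda>x. H x \<bullet> c) \<in> L2 \<Omega>"
      using c by (auto intro!: L2_component[OF \<Omega>] V(2) W(2))
    show ?thesis
      using inner_L2_lin[OF \<Omega> V(1) W(1) L(2), of a b] inner_L2_lin[OF \<Omega> GH L(1), of a b]
        V(3)[OF \<phi> c] W(3)[OF \<phi> c] by (simp add: inner_add_left)
  qed
  ultimately show ?thesis by (simp add: has_weak_grad_def inner_L2_def)
qed

text \<open>The indicator of a bounded box is itself square integrable, so this is integrability of
  a product of two L2 functions.\<close>

lemma L2_set_integrable_cbox:
  fixes v :: "'a::euclidean_space \<Rightarrow> real"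
  assumes "\<Omega> \<in> sets borel" "v \<in> L2 \<Omega>" "cbox a c \<subseteq> \<Omega>"
  shows "set_integrable lborel (cbox a c) v"
proof -
  have "(\<lambda>x. indicator (cbox a c) x :: real) \<in> L2 \<Omega>"
    using assms(1)
    by (auto simp: L2_def set_borel_measurable_def set_integrable_def indicator_inter_arith[symmetric] power2_eq_square
        intro!: integrable_real_indicator emeasure_lborel_cbox_finite[THEN le_less_trans[rotated]] emeasure_mono)
  from integrable_inner_L2[OF assms(1,2) this]
  have "integrable lborel (\<lambda>x. indicator \<Omega> x *\<^sub>R (v x * indicator (cbox a c) x))"
    using assms(1) by (simp add: integrable_restrict_space)
  moreover have "indicator \<Omega> x *\<^sub>R (v x * indicator (cbox a c) x) = indicator (cbox a c) x *\<^sub>R v x" for x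
    using assms(3) by (auto simp: indicator_def)
  ultimately show ?thesis by (simp only: set_integrable_def)
qed

lemma fundamental_lemma_L2:
  fixes v :: "'a::euclidean_space \<Rightarrow> real"
  assumes "open \<Omega>" "v \<in> L2 \<Omega>" "\<And>\<phi>. \<phi> \<in> test_functions \<Omega> \<Longrightarrow> inner_L2 \<Omega> v \<phi> = 0"
  shows "AE x\<in>\<Omega> in lborel. v x = 0"
  using assms by (intro fundamental_lemma L2_set_integrable_cbox) (auto simp: inner_L2_def)

text \<open>Componentwise application of the fundamental lemma. Since \<open>wgrad\<close> is only a
  choice, this uniqueness is what allows it to be replaced by any weak gradient at hand.\<close>

lemma has_weak_grad_cong_AE:
  assumes \<Omega>: "open \<Omega>" and v: "has_weak_grad \<Omega> v G" and w: "has_weak_grad \<Omega> w H"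
    and eq: "AE x\<in>\<Omega> in lborel. v x = w x"
  shows "AE x\<in>\<Omega> in lborel. G x = H x"
proof -
  have B: "\<Omega> \<in> sets borel" using \<Omega> by simp
  note V = has_weak_gradD[OF v] and W = has_weak_gradD[OF w]
  have "AE x\<in>\<Omega> in lborel. G x \<bullet> b - H x \<bullet> b = 0" if b: "b \<in> Basis" for b
  proof (rule fundamental_lemma_L2[OF \<Omega>])
    have GH: "(\<lambda>x. G x \<bullet> b) \<in> L2 \<Omega>" "(\<lambda>x. H x \<bullet> b) \<in> L2 \<Omega>"
      using b by (auto intro!: L2_component[OF B] V(2) W(2))
    interpret L: semi_inner "L2 \<Omega>" "inner_L2 \<Omega>" by (rule semi_inner_L2[OF B])
    show "(\<lambda>x. G x \<bullet> b - H x \<bullet> b) \<in> L2 \<Omega>" using GH by (rule L.diff_mem)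
    fix \<phi> assume \<phi>: "\<phi> \<in> test_functions \<Omega>"
    have "inner_L2 \<Omega> v (\<lambda>x. frechet_derivative \<phi> (at x) b) = inner_L2 \<Omega> w (\<lambda>x. frechet_derivative \<phi> (at x) b)"
      using eq by (intro inner_L2_cong_AE[OF B] V(1) W(1) test_function_partial_L2[OF B \<phi> b]) auto
    then show "inner_L2 \<Omega> (\<lambda>x. G x \<bullet> b - H x \<bullet> b) \<phi> = 0"
      using V(3)[OF \<phi> b] W(3)[OF \<phi> b] L.diff_left[OF GH test_function_L2[OF B \<phi>]] by simp
  qed
  then have "AE x in lborel. \<forall>b\<in>Basis. x \<in> \<Omega> \<longrightarrow> G x \<bullet> b = H x \<bullet> b"
    by (subst AE_ball_countable) (auto simp: countable_finite)
  then show ?thesis by eventually_elim (auto intro: euclidean_eqI)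
qed

lemma wgrad_has_weak_grad: "v \<in> H1 \<Omega> \<Longrightarrow> has_weak_grad \<Omega> v (wgrad \<Omega> v)"
  using someI_ex[of "has_weak_grad \<Omega> v"] unfolding H1_def wgrad_def by simp

lemma wgrad_L2: "v \<in> H1 \<Omega> \<Longrightarrow> wgrad \<Omega> v \<in> L2 \<Omega>"
  using has_weak_gradD(2)[OF wgrad_has_weak_grad] .

lemma H1_L2: "v \<in> H1 \<Omega> \<Longrightarrow> v \<in> L2 \<Omega>"
  using has_weak_gradD(1)[OF wgrad_has_weak_grad] .

lemma has_weak_grad_H1: "has_weak_grad \<Omega> v G \<Longrightarrow> v \<in> H1 \<Omega>"
  by (auto simp: H1_def)

lemma wgrad_AE: "open \<Omega> \<Longrightarrow> has_weak_grad \<Omega> v G \<Longrightarrow> AE x\<in>\<Omega> in lborel. wgrad \<Omega> v x = G x"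
  by (rule has_weak_grad_cong_AE[OF _ wgrad_has_weak_grad[OF has_weak_grad_H1]]) auto

definition grad_inner :: "'a::euclidean_space set \<Rightarrow> ('a \<Rightarrow> real) \<Rightarrow> ('a \<Rightarrow> real) \<Rightarrow> real" where
  "grad_inner \<Omega> v w = inner_L2 \<Omega> (wgrad \<Omega> v) (wgrad \<Omega> w)"

lemma grad_inner_eq:
  assumes "open \<Omega>" "has_weak_grad \<Omega> v G" "has_weak_grad \<Omega> w H"
  shows "grad_inner \<Omega> v w = inner_L2 \<Omega> G H"
  unfolding grad_inner_def
  using assms by (intro inner_L2_cong_AE wgrad_AE wgrad_L2 has_weak_grad_H1) (auto dest: has_weak_gradD)

lemma norm_H10_eq: "norm_H10 \<Omega> v = sqrt (grad_inner \<Omega> v v)"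
  by (simp add: norm_H10_def grad_inner_def norm_L2_eq)

lemma H1_lin: "\<Omega> \<in> sets borel \<Longrightarrow> v \<in> H1 \<Omega> \<Longrightarrow> w \<in> H1 \<Omega> \<Longrightarrow> (\<lambda>x. a * v x + b * w x) \<in> H1 \<Omega>"
  using has_weak_grad_H1[OF has_weak_grad_lin[OF _ wgrad_has_weak_grad wgrad_has_weak_grad]] .

lemma test_function_H1: "\<Omega> \<in> sets borel \<Longrightarrow> \<phi> \<in> test_functions \<Omega> \<Longrightarrow> \<phi> \<in> H1 \<Omega>"
  using has_weak_grad_H1[OF test_function_has_weak_grad] .

lemma zero_test_function: "(\<lambda>x. 0) \<in> test_functions \<Omega>"
  by (auto simp: test_functions_def C_k_const)

lemma semi_inner_grad:
  assumes \<Omega>: "open \<Omega>"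
  shows "semi_inner (H1 \<Omega>) (grad_inner \<Omega>)"
proof
  have B: "\<Omega> \<in> sets borel" using \<Omega> by simp
  show "(\<lambda>x. 0) \<in> H1 \<Omega>" by (rule test_function_H1[OF B zero_test_function])
  fix a b and v w z :: "'a \<Rightarrow> real" assume v: "v \<in> H1 \<Omega>" and w: "w \<in> H1 \<Omega>"
  show "(\<lambda>x. a * v x + b * w x) \<in> H1 \<Omega>" using H1_lin[OF B v w] .
  show "grad_inner \<Omega> v w = grad_inner \<Omega> w v" by (simp add: grad_inner_def inner_L2_commute)
  show "0 \<le> grad_inner \<Omega> v v" by (simp add: grad_inner_def inner_L2_nonneg)
  assume z: "z \<in> H1 \<Omega>"
  show "grad_inner \<Omega> (\<lambda>x. a * v x + b * w x) z = a * grad_inner \<Omega> v z + b * grad_inner \<Omega> w z"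
    using grad_inner_eq[OF \<Omega> has_weak_grad_lin[OF B wgrad_has_weak_grad[OF v] wgrad_has_weak_grad[OF w]] wgrad_has_weak_grad[OF z]]
      inner_L2_lin[OF B wgrad_L2[OF v] wgrad_L2[OF w] wgrad_L2[OF z]]
    by (simp add: grad_inner_def)
qed

definition H1_inner :: "'a::euclidean_space set \<Rightarrow> ('a \<Rightarrow> real) \<Rightarrow> ('a \<Rightarrow> real) \<Rightarrow> real" where
  "H1_inner \<Omega> v w = inner_L2 \<Omega> v w + grad_inner \<Omega> v w"

lemma semi_inner_H1:
  assumes "open \<Omega>"
  shows "semi_inner (H1 \<Omega>) (H1_inner \<Omega>)"
proof -
  interpret G: semi_inner "H1 \<Omega>" "grad_inner \<Omega>" by (rule semi_inner_grad[OF assms])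
  interpret L: semi_inner "L2 \<Omega>" "inner_L2 \<Omega>" by (rule semi_inner_L2) (use assms in simp)
  show ?thesis
    by unfold_locales
       (simp_all add: H1_inner_def G.zero_mem G.lin_mem G.lin L.lin H1_L2 algebra_simps inner_L2_nonneg G.nonneg,
        metis G.sym inner_L2_commute)
qed

lemma norm_H1_eq: "norm_H1 \<Omega> v = sqrt (H1_inner \<Omega> v v)"
  by (simp add: norm_H1_def H1_inner_def norm_L2_sq grad_inner_def)

section \<open>Functions with zero boundary values\<close>

lemma H10_H1: "v \<in> H10 \<Omega> \<Longrightarrow> v \<in> H1 \<Omega>"
  by (simp add: H10_def)

lemma H10_L2: "v \<in> H10 \<Omega> \<Longrightarrow> v \<in> L2 \<Omega>"
  by (simp add: H10_H1 H1_L2)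

lemma test_function_H10:
  assumes "open \<Omega>" "\<phi> \<in> test_functions \<Omega>"
  shows "\<phi> \<in> H10 \<Omega>"
proof -
  interpret H: semi_inner "H1 \<Omega>" "H1_inner \<Omega>" by (rule semi_inner_H1[OF assms(1)])
  have "norm_H1 \<Omega> (\<lambda>x. \<phi> x - \<phi> x) = 0"
    using H.zero_left[OF H.zero_mem] by (simp add: norm_H1_eq)
  then show ?thesis
    using assms test_function_H1[of \<Omega> \<phi>] unfolding H10_def
    by (auto intro!: exI[of _ "\<lambda>_. \<phi>"])
qed

lemma test_function_lin:
  assumes "\<phi> \<in> test_functions \<Omega>" "\<psi> \<in> test_functions \<Omega>"
  shows "(\<lambda>x. a * \<phi> x + b * \<psi> x) \<in> test_functions \<Omega>"
proof (rule test_functionsI)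
  let ?K = "closure {x. \<phi> x \<noteq> 0} \<union> closure {x. \<psi> x \<noteq> 0}"
  show "compact ?K" "?K \<subseteq> \<Omega>"
    using test_functionsD(2,3)[OF assms(1)] test_functionsD(2,3)[OF assms(2)] by auto
  show "C_k k (\<lambda>x. a * \<phi> x + b * \<psi> x)" for k
    by (intro C_k_add C_k_mult C_k_const test_functionsD(1)[OF assms(1)] test_functionsD(1)[OF assms(2)])
  fix x assume "x \<notin> ?K"
  then show "a * \<phi> x + b * \<psi> x = 0"
    using test_functionsD(4)[OF assms(1), of x] test_functionsD(4)[OF assms(2), of x] by simp
qed

lemma H10_lin:
  assumes \<Omega>: "open \<Omega>" and v: "v \<in> H10 \<Omega>" and w: "w \<in> H10 \<Omega>"
  shows "(\<lambda>x. a * v x + b * w x) \<in> H10 \<Omega>"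
proof -
  interpret H: semi_inner "H1 \<Omega>" "H1_inner \<Omega>" by (rule semi_inner_H1[OF \<Omega>])
  have B: "\<Omega> \<in> sets borel" using \<Omega> by simp
  obtain \<phi> where \<phi>: "\<And>n. \<phi> n \<in> test_functions \<Omega>" "(\<lambda>n. norm_H1 \<Omega> (\<lambda>x. v x - \<phi> n x)) \<longlonglongrightarrow> 0"
    using v by (auto simp: H10_def)
  obtain \<psi> where \<psi>: "\<And>n. \<psi> n \<in> test_functions \<Omega>" "(\<lambda>n. norm_H1 \<Omega> (\<lambda>x. w x - \<psi> n x)) \<longlonglongrightarrow> 0"
    using w by (auto simp: H10_def)
  define \<theta> where "\<theta> n x = a * \<phi> n x + b * \<psi> n x" for n x
  have bound: "norm_H1 \<Omega> (\<lambda>x. (a * v x + b * w x) - \<theta> n x)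
      \<le> \<bar>a\<bar> * norm_H1 \<Omega> (\<lambda>x. v x - \<phi> n x) + \<bar>b\<bar> * norm_H1 \<Omega> (\<lambda>x. w x - \<psi> n x)" for n
  proof -
    let ?d = "\<lambda>x. v x - \<phi> n x" and ?e = "\<lambda>x. w x - \<psi> n x"
    have d: "?d \<in> H1 \<Omega>" "?e \<in> H1 \<Omega>"
      by (intro H.diff_mem H10_H1[OF v] H10_H1[OF w] test_function_H1[OF B \<phi>(1)] test_function_H1[OF B \<psi>(1)])+
    have n: "norm_H1 \<Omega> (\<lambda>x. c * z x) = \<bar>c\<bar> * norm_H1 \<Omega> z" if "z \<in> H1 \<Omega>" for c z
      using that by (simp add: norm_H1_eq H.scale_left H.scale_right H.scale_mem real_sqrt_mult mult.assoc[symmetric])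
    have "(\<lambda>x. (a * v x + b * w x) - \<theta> n x) = (\<lambda>x. a * ?d x + b * ?e x)"
      by (simp add: \<theta>_def fun_eq_iff algebra_simps)
    then show ?thesis
      using H.triangle[of "\<lambda>x. a * ?d x" "\<lambda>x. b * ?e x"] d n[of ?d a] n[of ?e b]
      by (simp add: norm_H1_eq H.scale_mem)
  qed
  have "(\<lambda>n. norm_H1 \<Omega> (\<lambda>x. (a * v x + b * w x) - \<theta> n x)) \<longlonglongrightarrow> 0"
  proof (rule tendsto_sandwich[OF _ _ tendsto_const])
    show "(\<lambda>n. \<bar>a\<bar> * norm_H1 \<Omega> (\<lambda>x. v x - \<phi> n x) + \<bar>b\<bar> * norm_H1 \<Omega> (\<lambda>x. w x - \<psi> n x)) \<longlonglongrightarrow> 0"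
      using tendsto_add[OF tendsto_mult_right_zero[OF \<phi>(2)] tendsto_mult_right_zero[OF \<psi>(2)]] by simp
  qed (use bound in \<open>auto simp: norm_H1_def\<close>)
  moreover have "\<theta> n \<in> test_functions \<Omega>" for n
    unfolding \<theta>_def using \<phi>(1) \<psi>(1) by (rule test_function_lin)
  ultimately show ?thesis
    using H1_lin[OF B H10_H1[OF v] H10_H1[OF w]] unfolding H10_def by auto
qed

lemma semi_inner_H10_L2: "open \<Omega> \<Longrightarrow> semi_inner (H10 \<Omega>) (inner_L2 \<Omega>)"
  by (rule semi_inner_subset[OF semi_inner_L2])
     (auto intro: H10_lin H10_L2 test_function_H10 zero_test_function)

lemma semi_inner_H10_grad: "open \<Omega> \<Longrightarrow> semi_inner (H10 \<Omega>) (grad_inner \<Omega>)"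
  by (rule semi_inner_subset[OF semi_inner_grad])
     (auto intro: H10_lin H10_H1 test_function_H10 zero_test_function)

text \<open>Only the qualitative form of the Poincare inequality is needed: on a finite-dimensional space
  it yields the inequality. It follows by testing the vanishing weak gradient of \<open>v\<close> with
  \<open>x\<^sub>b \<phi>\<close>, where \<open>\<phi>\<close> approximates \<open>v\<close>.\<close>

lemma H10_grad_null_AE:
  assumes \<Omega>: "open \<Omega>" "bounded \<Omega>" and v: "v \<in> H10 \<Omega>" and null: "grad_inner \<Omega> v v = 0"
  shows "AE x\<in>\<Omega> in lborel. v x = 0"
proof -
  have B: "\<Omega> \<in> sets borel" using \<Omega> by simp
  interpret G: semi_inner "H1 \<Omega>" "grad_inner \<Omega>" by (rule semi_inner_grad[OF \<Omega>(1)])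
  interpret L: semi_inner "L2 \<Omega>" "inner_L2 \<Omega>" by (rule semi_inner_L2[OF B])
  obtain \<phi> where \<phi>: "\<And>n. \<phi> n \<in> test_functions \<Omega>" "(\<lambda>n. norm_H1 \<Omega> (\<lambda>x. v x - \<phi> n x)) \<longlonglongrightarrow> 0"
    using v by (auto simp: H10_def)
  have v1: "v \<in> H1 \<Omega>" "v \<in> L2 \<Omega>" and \<phi>1: "\<phi> n \<in> H1 \<Omega>" "\<phi> n \<in> L2 \<Omega>" for n
    using v \<phi>(1) by (auto intro: H10_H1 H10_L2 test_function_H1[OF B] test_function_L2[OF B])
  have small: "norm_L2 \<Omega> (\<lambda>x. v x - \<phi> n x) \<le> norm_H1 \<Omega> (\<lambda>x. v x - \<phi> n x)"
    "sqrt (grad_inner \<Omega> (\<phi> n) (\<phi> n)) \<le> norm_H1 \<Omega> (\<lambda>x. v x - \<phi> n x)" for n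
  proof -
    \<comment> \<open>As v has zero Dirichlet energy it is orthogonal to everything, so the energy
      of \<phi> itself equals that of \<open>v - \<phi>\<close> and tends to 0.\<close>
    have "grad_inner \<Omega> (\<lambda>x. v x - \<phi> n x) (\<lambda>x. v x - \<phi> n x) = grad_inner \<Omega> (\<phi> n) (\<phi> n)"
      using G.norm_diff_sq[OF v1(1) \<phi>1(1)] G.null_left[OF v1(1) \<phi>1(1) null] null by simp
    then show "norm_L2 \<Omega> (\<lambda>x. v x - \<phi> n x) \<le> norm_H1 \<Omega> (\<lambda>x. v x - \<phi> n x)"
      "sqrt (grad_inner \<Omega> (\<phi> n) (\<phi> n)) \<le> norm_H1 \<Omega> (\<lambda>x. v x - \<phi> n x)"
      using L.nonneg[OF L.diff_mem[OF v1(2) \<phi>1(2)]] G.nonneg[OF \<phi>1(1)]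
      by (auto simp: norm_L2_eq norm_H1_eq H1_inner_def)
  qed
  obtain b :: 'a where b: "b \<in> Basis" using nonempty_Basis by blast
  obtain R where R: "\<Omega> \<subseteq> cball 0 R" using bounded_subset_cball0[OF \<Omega>(2)] by blast
  have inner_bound: "\<bar>inner_L2 \<Omega> v (\<phi> n)\<bar> \<le> norm_L2 \<Omega> v * (\<bar>R\<bar> * norm_H1 \<Omega> (\<lambda>x. v x - \<phi> n x))" for n
  proof -
    define D where "D x = frechet_derivative (\<phi> n) (at x) b" for x
    define \<psi> where "\<psi> x = (x \<bullet> b) * \<phi> n x" for x
    have C: "C_k k (\<lambda>x. x \<bullet> b)" for k using C_k_inner[of k b 0] by simp
    have \<psi>: "\<psi> \<in> test_functions \<Omega>"
    proof (rule test_functionsI[OF _ test_functionsD(2,3)[OF \<phi>(1)[of n]]])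
      show "C_k k \<psi>" for k
        unfolding \<psi>_def by (intro C_k_mult C test_functionsD(1)[OF \<phi>(1)])
      fix x assume "x \<notin> closure {x. \<phi> n x \<noteq> 0}"
      then have "\<phi> n x = 0" by (rule test_functionsD(4)[OF \<phi>(1)])
      then show "\<psi> x = 0" by (simp add: \<psi>_def)
    qed
    have d\<psi>: "frechet_derivative \<psi> (at x) b = (x \<bullet> b) * D x + \<phi> n x" for x
    proof -
      have "((\<lambda>x. x \<bullet> b) has_derivative (\<lambda>h. h \<bullet> b)) (at x)" by (auto intro!: derivative_eq_intros)
      from frechet_derivative_at[OF this, symmetric]
      have "frechet_derivative (\<lambda>x. x \<bullet> b) (at x) b = 1" using b by simp
      then show ?thesis
        unfolding \<psi>_def D_def using partial_deriv_mult[OF C test_functionsD(1)[OF \<phi>(1)[of n]], of x b] by simp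
    qed
    have DL: "D \<in> L2 \<Omega>" unfolding D_def by (rule test_function_partial_L2[OF B \<phi>(1) b])
    have xDL: "(\<lambda>x. (x \<bullet> b) * D x) \<in> L2 \<Omega>"
      using L.diff_mem[OF test_function_partial_L2[OF B \<psi> b] \<phi>1(2)[of n]] by (simp add: d\<psi>)
    have "AE x\<in>\<Omega> in lborel. wgrad \<Omega> v x = 0"
      using inner_L2_eq_0_AE[OF B wgrad_L2[OF v1(1)]] null by (simp add: grad_inner_def)
    then have "inner_L2 \<Omega> (\<lambda>x. wgrad \<Omega> v x \<bullet> b) \<psi> = inner_L2 \<Omega> (\<lambda>x. 0) \<psi>"
      using b by (intro inner_L2_cong_AE[OF B] L2_component[OF B] wgrad_L2 v1 L2_zero B test_function_L2[OF B \<psi>]) auto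
    also have "\<dots> = 0" by (simp add: inner_L2_def)
    \<comment> \<open>The derivative of the coordinate reproduces \<phi>, so
      \<open>(v, \<phi>)\<close> equals up to sign a pairing of v with a derivative of \<phi>, which
      is small by the choice of \<phi>.\<close>
    finally have "inner_L2 \<Omega> v (\<lambda>x. (x \<bullet> b) * D x + \<phi> n x) = 0"
      using has_weak_gradD(3)[OF wgrad_has_weak_grad[OF v1(1)] \<psi> b] by (simp add: d\<psi>)
    then have eq: "inner_L2 \<Omega> v (\<phi> n) = - inner_L2 \<Omega> v (\<lambda>x. (x \<bullet> b) * D x)"
      using L.lin_right[OF xDL \<phi>1(2)[of n] v1(2), of 1 1] by simp
    have DG: "inner_L2 \<Omega> D D \<le> grad_inner \<Omega> (\<phi> n) (\<phi> n)"
    proof -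
      have c: "cgrad (\<phi> n) \<in> L2 \<Omega>" by (rule cgrad_L2[OF B \<phi>(1)])
      have "inner_L2 \<Omega> D D \<le> inner_L2 \<Omega> (cgrad (\<phi> n)) (cgrad (\<phi> n))"
        unfolding inner_L2_eq[OF B]
      proof (rule integral_mono[OF integrable_inner_L2[OF B DL DL] integrable_inner_L2[OF B c c]])
        fix x
        have "\<bar>D x\<bar> \<le> norm (cgrad (\<phi> n) x)"
          using Basis_le_norm[OF b, of "cgrad (\<phi> n) x"] by (simp add: cgrad_inner[OF b] D_def)
        then show "D x \<bullet> D x \<le> cgrad (\<phi> n) x \<bullet> cgrad (\<phi> n) x"
          by (metis abs_le_square_iff abs_norm_cancel power2_norm_eq_inner real_norm_def)
      qed
      then show ?thesis
        by (simp add: grad_inner_eq[OF \<Omega>(1) test_function_has_weak_grad[OF B \<phi>(1)] test_function_has_weak_grad[OF B \<phi>(1)]])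
    qed
    \<comment> \<open>Here boundedness of the domain enters: the weight \<open>x \<bullet> b\<close>
      is at most R in absolute value.\<close>
    have "inner_L2 \<Omega> (\<lambda>x. (x \<bullet> b) * D x) (\<lambda>x. (x \<bullet> b) * D x) \<le> R\<^sup>2 * inner_L2 \<Omega> D D"
      unfolding inner_L2_eq[OF B] integral_mult_right_zero[symmetric]
    proof (rule integral_mono[OF integrable_inner_L2[OF B xDL xDL]])
      show "integrable (lebesgue_in \<Omega>) (\<lambda>x. R\<^sup>2 * (D x \<bullet> D x))"
        by (intro integrable_mult_right integrable_inner_L2[OF B DL DL])
      fix x assume "x \<in> space (lebesgue_in \<Omega>)"
      then have "x \<in> \<Omega>" by (simp add: space_restrict_space)
      then have "\<bar>x \<bullet> b\<bar> \<le> R" using R Basis_le_norm[OF b, of x] by (auto simp: subset_iff intro: order_trans)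
      then have "(x \<bullet> b)\<^sup>2 \<le> R\<^sup>2" by (simp add: abs_le_square_iff[symmetric])
      then have "(x \<bullet> b)\<^sup>2 * (D x)\<^sup>2 \<le> R\<^sup>2 * (D x)\<^sup>2" by (intro mult_right_mono) auto
      then show "((x \<bullet> b) * D x) \<bullet> ((x \<bullet> b) * D x) \<le> R\<^sup>2 * (D x \<bullet> D x)"
        by (simp add: power2_eq_square mult_ac)
    qed
    also have "\<dots> \<le> R\<^sup>2 * grad_inner \<Omega> (\<phi> n) (\<phi> n)" using DG by (rule mult_left_mono) simp
    finally have "sqrt (inner_L2 \<Omega> (\<lambda>x. (x \<bullet> b) * D x) (\<lambda>x. (x \<bullet> b) * D x)) \<le> \<bar>R\<bar> * sqrt (grad_inner \<Omega> (\<phi> n) (\<phi> n))"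
      using real_sqrt_le_mono by (fastforce simp: real_sqrt_mult)
    also have "\<dots> \<le> \<bar>R\<bar> * norm_H1 \<Omega> (\<lambda>x. v x - \<phi> n x)" using small(2) by (rule mult_left_mono) simp
    finally have "sqrt (inner_L2 \<Omega> (\<lambda>x. (x \<bullet> b) * D x) (\<lambda>x. (x \<bullet> b) * D x)) \<le> \<bar>R\<bar> * norm_H1 \<Omega> (\<lambda>x. v x - \<phi> n x)" .
    then show ?thesis
      using L.abs_le[OF v1(2) xDL] mult_left_mono[OF _ norm_L2_nonneg[of \<Omega> v]]
      unfolding eq norm_L2_eq[of \<Omega> v] by (smt (verit))
  qed
  have bound: "inner_L2 \<Omega> v v \<le> norm_L2 \<Omega> v * ((\<bar>R\<bar> + 1) * norm_H1 \<Omega> (\<lambda>x. v x - \<phi> n x))" for n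
  proof -
    have "inner_L2 \<Omega> v v = inner_L2 \<Omega> v (\<lambda>x. v x - \<phi> n x) + inner_L2 \<Omega> v (\<phi> n)"
      using L.diff_right[OF v1(2) \<phi>1(2) v1(2), of n] by simp
    also have "\<dots> \<le> norm_L2 \<Omega> v * norm_L2 \<Omega> (\<lambda>x. v x - \<phi> n x) + norm_L2 \<Omega> v * (\<bar>R\<bar> * norm_H1 \<Omega> (\<lambda>x. v x - \<phi> n x))"
      using L.abs_le[OF v1(2) L.diff_mem[OF v1(2) \<phi>1(2), of n]] inner_bound[of n] by (auto simp: norm_L2_eq)
    also have "\<dots> \<le> norm_L2 \<Omega> v * norm_H1 \<Omega> (\<lambda>x. v x - \<phi> n x) + norm_L2 \<Omega> v * (\<bar>R\<bar> * norm_H1 \<Omega> (\<lambda>x. v x - \<phi> n x))"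
      using small(1)[of n] by (intro add_right_mono mult_left_mono norm_L2_nonneg)
    finally show ?thesis by (simp add: algebra_simps)
  qed
  have "(\<lambda>n. norm_L2 \<Omega> v * ((\<bar>R\<bar> + 1) * norm_H1 \<Omega> (\<lambda>x. v x - \<phi> n x))) \<longlonglongrightarrow> 0"
    by (intro tendsto_mult_right_zero \<phi>(2))
  then have "inner_L2 \<Omega> v v \<le> 0" using bound by (intro LIMSEQ_le_const) auto
  then show ?thesis using inner_L2_eq_0_AE[OF B v1(2)] inner_L2_nonneg[of \<Omega> v] by simp
qed

lemma H10_grad_cong_AE:
  assumes "open \<Omega>" "v \<in> H10 \<Omega>" "w \<in> H10 \<Omega>" "AE x\<in>\<Omega> in lborel. v x = w x"
  shows "AE x\<in>\<Omega> in lborel. wgrad \<Omega> v x = wgrad \<Omega> w x"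
  using assms by (intro has_weak_grad_cong_AE[of _ v _ w] wgrad_has_weak_grad H10_H1)

section \<open>Absolutely continuous functions of time\<close>

text \<open>Absolute continuity in integral form. The density is a separate argument because it will
  be a pairing with a weak time derivative, which is given in advance and matters only almost
  everywhere.\<close>

definition ac_on :: "real \<Rightarrow> (real \<Rightarrow> real) \<Rightarrow> (real \<Rightarrow> real) \<Rightarrow> bool" where
  "ac_on T y q \<longleftrightarrow> set_integrable lborel {0<..<T} q \<and> continuous_on {0..T} y \<and>
     (\<forall>t\<in>{0..T}. y t = y 0 + (LINT s:{0<..<t}|lborel. q s))"

lemma ac_onD:
  assumes "ac_on T y q"
  shows "set_integrable lborel {0<..<T} q" "continuous_on {0..T} y"
    "t \<in> {0..T} \<Longrightarrow> y t = y 0 + (LINT s:{0<..<t}|lborel. q s)"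
  using assms unfolding ac_on_def by blast+

lemma ac_on_lin:
  assumes y: "ac_on T y p" and z: "ac_on T z q"
  shows "ac_on T (\<lambda>t. a * y t + b * z t) (\<lambda>t. a * p t + b * q t)"
proof -
  have sub: "set_integrable lborel {0<..<t} p" "set_integrable lborel {0<..<t} q" if "t \<in> {0..T}" for t
    using that by (auto intro!: set_integrable_subset[OF ac_onD(1)[OF y]] set_integrable_subset[OF ac_onD(1)[OF z]])
  show ?thesis
    unfolding ac_on_def
  proof (intro conjI ballI)
    show "set_integrable lborel {0<..<T} (\<lambda>t. a * p t + b * q t)"
      using ac_onD(1)[OF y] ac_onD(1)[OF z] by simp
    show "continuous_on {0..T} (\<lambda>t. a * y t + b * z t)"
      by (intro continuous_intros ac_onD(2)[OF y] ac_onD(2)[OF z])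
    fix t assume t: "t \<in> {0..T}"
    show "a * y t + b * z t = a * y 0 + b * z 0 + (LINT s:{0<..<t}|lborel. a * p s + b * q s)"
      using ac_onD(3)[OF y t] ac_onD(3)[OF z t] sub[OF t] by (simp add: algebra_simps)
  qed
qed

lemma ac_on_cong:
  assumes ac: "ac_on T y q" and T: "0 \<le> T" and eq: "\<And>t. t \<in> {0..T} \<Longrightarrow> z t = y t"
  shows "ac_on T z q"
  unfolding ac_on_def
proof (intro conjI ballI)
  show "set_integrable lborel {0<..<T} q" by (rule ac_onD(1)[OF ac])
  show "continuous_on {0..T} z" by (rule continuous_on_eq[OF ac_onD(2)[OF ac]]) (rule eq[symmetric])
  fix t assume t: "t \<in> {0..T}"
  show "z t = z 0 + (LINT s:{0<..<t}|lborel. q s)"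
    unfolding eq[OF t] using eq[of 0] T ac_onD(3)[OF ac t] by simp
qed

lemma
  fixes f :: "'i \<Rightarrow> 'a \<Rightarrow> real"
  assumes "\<And>i. i \<in> I \<Longrightarrow> set_integrable M A (f i)"
  shows set_integrable_sum: "set_integrable M A (\<lambda>x. \<Sum>i\<in>I. f i x)"
    and set_integral_sum_eq: "(LINT x:A|M. \<Sum>i\<in>I. f i x) = (\<Sum>i\<in>I. LINT x:A|M. f i x)"
proof -
  have "integrable M (\<lambda>x. \<Sum>i\<in>I. indicator A x *\<^sub>R f i x)"
    "(\<integral>x. (\<Sum>i\<in>I. indicator A x *\<^sub>R f i x) \<partial>M) = (\<Sum>i\<in>I. LINT x:A|M. f i x)"
    using assms unfolding set_integrable_def set_lebesgue_integral_def
    by (auto intro!: Bochner_Integration.integrable_sum Bochner_Integration.integral_sum)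
  then show "set_integrable M A (\<lambda>x. \<Sum>i\<in>I. f i x)"
    "(LINT x:A|M. \<Sum>i\<in>I. f i x) = (\<Sum>i\<in>I. LINT x:A|M. f i x)"
    by (simp_all add: set_integrable_def set_lebesgue_integral_def sum_distrib_left)
qed

lemma set_integral_mono_AE:
  fixes f g :: "_ \<Rightarrow> real"
  assumes "set_integrable M A f" "set_integrable M A g" "AE x\<in>A in M. f x \<le> g x"
  shows "(LINT x:A|M. f x) \<le> (LINT x:A|M. g x)"
  using assms unfolding set_lebesgue_integral_def set_integrable_def
  by (intro integral_mono_AE) (auto elim!: eventually_mono simp: indicator_def)

lemma integrable_tensor:
  fixes p :: "'a \<Rightarrow> real" and q :: "'b \<Rightarrow> real"
  assumes "sigma_finite_measure M" "sigma_finite_measure N" and p: "integrable M p" and q: "integrable N q"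
  shows "integrable (M \<Otimes>\<^sub>M N) (\<lambda>(s, t). p s * q t)"
proof -
  interpret pair_sigma_finite M N by (intro pair_sigma_finite.intro assms)
  have [measurable]: "p \<in> borel_measurable M" "q \<in> borel_measurable N" using p q by auto
  show ?thesis
    using p q by (intro Fubini_integrable) (auto simp: abs_mult)
qed

lemma sigma_finite_lebesgue_in: "\<Omega> \<in> sets borel \<Longrightarrow> sigma_finite_measure (lebesgue_in \<Omega>)"
  by (intro sigma_finite_measure_restrict_space sigma_finite_lborel) simp

text \<open>Dominated convergence along a sequence of end points: the indicators converge everywhere
  except possibly at the limit end point, a null set.\<close>

lemma indefinite_integral_continuous_on:
  assumes q: "set_integrable lborel {0<..<T} (q :: real \<Rightarrow> real)"
  shows "continuous_on {0..T} (\<lambda>t. LINT s:{0<..<t}|lborel. q s)"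
  unfolding continuous_on_sequentially comp_def
proof (intro allI ballI impI)
  fix t and r :: "nat \<Rightarrow> real" assume t: "t \<in> {0..T}" and r: "(\<forall>n. r n \<in> {0..T}) \<and> r \<longlonglongrightarrow> t"
  define Q where "Q s = indicator {0<..<T} s *\<^sub>R q s" for s
  have Q: "integrable lborel Q" using q by (simp add: set_integrable_def Q_def[abs_def])
  have eq: "(LINT s:{0<..<t}|lborel. q s) = (\<integral>s. indicator {0<..<t} s *\<^sub>R Q s \<partial>lborel)" if "t \<in> {0..T}" for t
    unfolding set_lebesgue_integral_def using that
    by (intro Bochner_Integration.integral_cong) (auto simp: Q_def indicator_def)
  have "(\<lambda>n. \<integral>s. indicator {0<..<r n} s *\<^sub>R Q s \<partial>lborel) \<longlonglongrightarrow> (\<integral>s. indicator {0<..<t} s *\<^sub>R Q s \<partial>lborel)"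
  proof (rule integral_dominated_convergence)
    show "integrable lborel (\<lambda>s. norm (Q s))" using Q by simp
    show "AE s in lborel. (\<lambda>n. indicator {0<..<r n} s *\<^sub>R Q s) \<longlonglongrightarrow> indicator {0<..<t} s *\<^sub>R Q s"
      using AE_lborel_singleton[of t]
    proof eventually_elim
      case (elim s)
      have "eventually (\<lambda>n. (indicator {0<..<r n} s :: real) = indicator {0<..<t} s) sequentially"
      proof (cases "s < t")
        case True
        then have "eventually (\<lambda>n. s < r n) sequentially" using r by (auto intro: order_tendstoD)
        then show ?thesis using True by (auto elim!: eventually_mono simp: indicator_def)
      next
        case False
        then have "t < s" using elim by simp
        then have "eventually (\<lambda>n. r n < s) sequentially" using r by (auto intro: order_tendstoD)
        then show ?thesis using False by (auto elim!: eventually_mono simp: indicator_def)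
      qed
      then have "eventually (\<lambda>n. indicator {0<..<t} s *\<^sub>R Q s = indicator {0<..<r n} s *\<^sub>R Q s) sequentially"
        by eventually_elim simp
      then show ?case by (rule Lim_transform_eventually[OF tendsto_const])
    qed
    show "(\<lambda>s. indicator {0<..<t} s *\<^sub>R Q s) \<in> borel_measurable lborel"
      "\<And>n. (\<lambda>s. indicator {0<..<r n} s *\<^sub>R Q s) \<in> borel_measurable lborel"
      using Q by measurable
    show "\<And>n. AE s in lborel. norm (indicator {0<..<r n} s *\<^sub>R Q s) \<le> norm (Q s)"
      by (auto simp: indicator_def)
  qed
  then show "(\<lambda>n. LINT s:{0<..<r n}|lborel. q s) \<longlonglongrightarrow> (LINT s:{0<..<t}|lborel. q s)"
    using r t by (simp only: eq)
qed

lemma ac_on_indefinite_integral: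
  assumes "set_integrable lborel {0<..<T} q"
  shows "ac_on T (\<lambda>t. LINT s:{0<..<t}|lborel. q s) q"
  using indefinite_integral_continuous_on[OF assms] assms
  by (auto simp: ac_on_def set_lebesgue_integral_def)

lemma set_integrable_continuous_mult:
  fixes y q :: "real \<Rightarrow> real"
  assumes y: "continuous_on {0..T} y" and q: "set_integrable lborel {0<..<T} q"
  shows "set_integrable lborel {0<..<T} (\<lambda>t. y t * q t)"
proof -
  obtain M where M: "\<forall>t\<in>{0..T}. norm (y t) \<le> M"
    using compact_imp_bounded[OF compact_continuous_image[OF y]] by (auto simp: bounded_iff)
  have m: "set_borel_measurable lborel {0<..<T} y"
    unfolding set_borel_measurable_def
    using borel_measurable_continuous_on_indicator[OF _ continuous_on_subset[OF y], of "{0<..<T}"]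
    by (simp add: subset_eq)
  have "(\<lambda>t. indicator {0<..<T} t *\<^sub>R y t * (indicator {0<..<T} t *\<^sub>R q t)) \<in> borel_measurable lborel"
    using m q unfolding set_borel_measurable_def set_integrable_def by (intro borel_measurable_times) auto
  moreover have "(\<lambda>t. indicator {0<..<T} t *\<^sub>R y t * (indicator {0<..<T} t *\<^sub>R q t)) = (\<lambda>t. indicator {0<..<T} t *\<^sub>R (y t * q t))"
    by (auto simp: indicator_def)
  ultimately have meas: "set_borel_measurable lborel {0<..<T} (\<lambda>t. y t * q t)"
    by (simp add: set_borel_measurable_def)
  have "set_integrable lborel {0<..<T} (\<lambda>t. M * q t)" using q by simp
  then show ?thesis
  proof (rule set_integrable_bound[OF _ meas])
    show "AE t in lborel. t \<in> {0<..<T} \<longrightarrow> norm (y t * q t) \<le> norm (M * q t)"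
    proof (intro AE_I2 impI)
      fix t assume "t \<in> {0<..<T}"
      then have "\<bar>y t\<bar> \<le> \<bar>M\<bar>" using M by (auto dest!: bspec[of _ _ t])
      then show "norm (y t * q t) \<le> norm (M * q t)" by (simp add: abs_mult mult_right_mono)
    qed
  qed
qed

text \<open>The double integral of \<open>p(s) q(t)\<close> over \<open>(0,T) \<times> (0,T)\<close> is split along the diagonal.\<close>

lemma ac_on_parts:
  assumes T: "0 \<le> T" and y: "ac_on T y p" and z: "ac_on T z q"
  shows "(LINT t:{0<..<T}|lborel. y t * q t) + (LINT t:{0<..<T}|lborel. p t * z t) = y T * z T - y 0 * z 0"
proof -
  let ?J = "{0<..<T}" and ?M = "lebesgue_in {0<..<T}"
  have J: "?J \<in> sets borel" by simp
  interpret S: sigma_finite_measure ?M by (rule sigma_finite_lebesgue_in[OF J])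
  interpret P: pair_sigma_finite ?M ?M ..
  have p: "integrable ?M p" and q: "integrable ?M q"
    using ac_onD(1)[OF y] ac_onD(1)[OF z] by (simp_all add: set_integrable_restrict)
  have [measurable]: "p \<in> borel_measurable ?M" "q \<in> borel_measurable ?M" using p q by auto
  have [measurable]: "(\<lambda>s. s) \<in> borel_measurable ?M" by (simp add: measurable_restrict_space1)
  have pq: "integrable (?M \<Otimes>\<^sub>M ?M) (\<lambda>(s, t). p s * q t)"
    by (rule integrable_tensor[OF S.sigma_finite_measure_axioms S.sigma_finite_measure_axioms p q])
  have [measurable]: "Measurable.pred (?M \<Otimes>\<^sub>M ?M) (\<lambda>x. fst x < snd x)"
    by measurable
  have A: "integrable (?M \<Otimes>\<^sub>M ?M) (\<lambda>(s, t). (if s < t then p s * q t else 0))"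
    by (rule Bochner_Integration.integrable_bound[OF pq]) (auto simp: split_beta')
  have B: "integrable (?M \<Otimes>\<^sub>M ?M) (\<lambda>(s, t). (if s < t then 0 else p s * q t))"
    by (rule Bochner_Integration.integrable_bound[OF pq]) (auto simp: split_beta')
  have inner1: "(\<integral>s. (if s < t then p s * q t else 0) \<partial>?M) = (y t - y 0) * q t" if t: "t \<in> ?J" for t
  proof -
    have "(\<integral>s. (if s < t then p s * q t else 0) \<partial>?M) = (\<integral>s. indicator {0<..<t} s *\<^sub>R p s * q t \<partial>lborel)"
      using t by (subst integral_restrict_space)
        (simp, intro Bochner_Integration.integral_cong, auto simp: indicator_def)
    also have "\<dots> = (LINT s:{0<..<t}|lborel. p s) * q t"
      unfolding set_lebesgue_integral_def by (rule integral_mult_left_zero)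
    finally show ?thesis using ac_onD(3)[OF y, of t] t by simp
  qed
  have inner2: "(\<integral>t. (if s < t then 0 else p s * q t) \<partial>?M) = p s * (z s - z 0)" if s: "s \<in> ?J" for s
  proof -
    have "(\<integral>t. (if s < t then 0 else p s * q t) \<partial>?M) = (\<integral>t. indicator {0<..<T} t *\<^sub>R (if s < t then 0 else p s * q t) \<partial>lborel)"
      by (subst integral_restrict_space) auto
    also have "\<dots> = (\<integral>t. p s * (indicator {0<..<s} t *\<^sub>R q t) \<partial>lborel)"
    proof (rule integral_cong_AE)
      have q': "(\<lambda>t. indicator {0<..<T} t *\<^sub>R q t) \<in> borel_measurable lborel"
        using ac_onD(1)[OF z] by (auto simp: set_integrable_def)
      then have "(\<lambda>t. p s * (indicator {..s} t * (indicator {0<..<T} t *\<^sub>R q t))) \<in> borel_measurable lborel"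
        by measurable
      also have "(\<lambda>t. p s * (indicator {..s} t * (indicator {0<..<T} t *\<^sub>R q t)))
          = (\<lambda>t. indicator {0<..<T} t *\<^sub>R (if s < t then 0 else p s * q t))"
        by (auto simp: indicator_def)
      finally show "(\<lambda>t. indicator {0<..<T} t *\<^sub>R (if s < t then 0 else p s * q t)) \<in> borel_measurable lborel" .
      from q' have "(\<lambda>t. p s * (indicator {0<..<s} t * (indicator {0<..<T} t *\<^sub>R q t))) \<in> borel_measurable lborel"
        by measurable
      also have "(\<lambda>t. p s * (indicator {0<..<s} t * (indicator {0<..<T} t *\<^sub>R q t)))
          = (\<lambda>t. p s * (indicator {0<..<s} t *\<^sub>R q t))"
        using s by (auto simp: indicator_def)
      finally show "(\<lambda>t. p s * (indicator {0<..<s} t *\<^sub>R q t)) \<in> borel_measurable lborel" .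
      show "AE t in lborel. indicator {0<..<T} t *\<^sub>R (if s < t then 0 else p s * q t) = p s * (indicator {0<..<s} t *\<^sub>R q t)"
        using AE_lborel_singleton[of s] by eventually_elim (use s in \<open>auto simp: indicator_def\<close>)
    qed
    also have "\<dots> = p s * (LINT t:{0<..<s}|lborel. q t)" by (simp add: set_lebesgue_integral_def)
    finally show ?thesis using ac_onD(3)[OF z, of s] s by simp
  qed
  have I1: "(\<integral>t. (y t - y 0) * q t \<partial>?M) = (\<integral>x. (case x of (s, t) \<Rightarrow> (if s < t then p s * q t else 0)) \<partial>(?M \<Otimes>\<^sub>M ?M))"
    unfolding P.integral_snd[OF A, symmetric]
    by (intro Bochner_Integration.integral_cong) (simp_all add: inner1 space_restrict_space)
  have I2: "(\<integral>s. p s * (z s - z 0) \<partial>?M) = (\<integral>x. (case x of (s, t) \<Rightarrow> (if s < t then 0 else p s * q t)) \<partial>(?M \<Otimes>\<^sub>M ?M))"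
    unfolding P.integral_fst[OF B, symmetric]
    by (intro Bochner_Integration.integral_cong) (simp_all add: inner2 space_restrict_space)
  \<comment> \<open>The two triangles make up the square, over which the integral factors into the
    product of the total increments of y and z; expanding that product yields the boundary
    terms.\<close>
  have "(\<integral>t. (y t - y 0) * q t \<partial>?M) + (\<integral>s. p s * (z s - z 0) \<partial>?M) = (\<integral>x. (case x of (s, t) \<Rightarrow> p s * q t) \<partial>(?M \<Otimes>\<^sub>M ?M))"
    unfolding I1 I2 Bochner_Integration.integral_add[OF A B, symmetric]
    by (intro Bochner_Integration.integral_cong) auto
  also have "\<dots> = (\<integral>s. p s \<partial>?M) * (\<integral>t. q t \<partial>?M)"
    unfolding P.integral_fst[OF pq, symmetric] by simp
  also have "\<dots> = (y T - y 0) * (z T - z 0)"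
    using ac_onD(3)[OF y, of T] ac_onD(3)[OF z, of T] T by (simp add: set_lebesgue_integral_restrict)
  finally have *: "(\<integral>t. (y t - y 0) * q t \<partial>?M) + (\<integral>s. p s * (z s - z 0) \<partial>?M) = (y T - y 0) * (z T - z 0)" .
  have yq: "integrable ?M (\<lambda>t. y t * q t)" and pz: "integrable ?M (\<lambda>t. p t * z t)"
    using set_integrable_continuous_mult[OF ac_onD(2)[OF y] ac_onD(1)[OF z]]
      set_integrable_continuous_mult[OF ac_onD(2)[OF z] ac_onD(1)[OF y]]
    by (simp_all add: set_integrable_restrict mult.commute)
  have "(\<integral>t. (y t - y 0) * q t \<partial>?M) = (\<integral>t. y t * q t \<partial>?M) - y 0 * (z T - z 0)"
    using yq q ac_onD(3)[OF z, of T] T by (simp add: left_diff_distrib set_lebesgue_integral_restrict)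
  moreover have "(\<integral>s. p s * (z s - z 0) \<partial>?M) = (\<integral>t. p t * z t \<partial>?M) - (y T - y 0) * z 0"
    using pz p ac_onD(3)[OF y, of T] T by (simp add: right_diff_distrib set_lebesgue_integral_restrict)
  ultimately show ?thesis
    using * by (simp add: set_lebesgue_integral_restrict algebra_simps)
qed

lemma ac_on_restrict:
  assumes "ac_on T y q" "t \<le> T"
  shows "ac_on t y q"
  unfolding ac_on_def
proof (intro conjI ballI)
  show "set_integrable lborel {0<..<t} q"
    by (rule set_integrable_subset[OF ac_onD(1)[OF assms(1)]]) (use assms(2) in auto)
  show "continuous_on {0..t} y"
    by (rule continuous_on_subset[OF ac_onD(2)[OF assms(1)]]) (use assms(2) in auto)
  fix s assume "s \<in> {0..t}"
  then show "y s = y 0 + (LINT r:{0<..<s}|lborel. q r)"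
    using assms(2) by (intro ac_onD(3)[OF assms(1)]) auto
qed

text \<open>Integration by parts on each interval from 0 to t is exactly the integral representation
  of the product.\<close>

lemma ac_on_mult:
  assumes T: "0 \<le> T" and y: "ac_on T y p" and z: "ac_on T z q"
  shows "ac_on T (\<lambda>t. y t * z t) (\<lambda>t. y t * q t + p t * z t)"
proof -
  have i: "set_integrable lborel {0<..<t} (\<lambda>t. y t * q t)" "set_integrable lborel {0<..<t} (\<lambda>t. p t * z t)"
    if "t \<in> {0..T}" for t
    using set_integrable_continuous_mult[OF ac_onD(2)[OF ac_on_restrict[OF y]] ac_onD(1)[OF ac_on_restrict[OF z]], of t]
      set_integrable_continuous_mult[OF ac_onD(2)[OF ac_on_restrict[OF z]] ac_onD(1)[OF ac_on_restrict[OF y]], of t] that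
    by (auto simp: mult.commute)
  show ?thesis
    unfolding ac_on_def
  proof (intro conjI ballI)
    show "set_integrable lborel {0<..<T} (\<lambda>t. y t * q t + p t * z t)" using i[of T] T by simp
    show "continuous_on {0..T} (\<lambda>t. y t * z t)"
      by (intro continuous_intros ac_onD(2)[OF y] ac_onD(2)[OF z])
    fix t assume t: "t \<in> {0..T}"
    then show "y t * z t = y 0 * z 0 + (LINT s:{0<..<t}|lborel. y s * q s + p s * z s)"
      using ac_on_parts[OF _ ac_on_restrict[OF y, of t] ac_on_restrict[OF z, of t]] i[OF t] by simp
  qed
qed

lemma ac_on_const: "ac_on T (\<lambda>t. 0) (\<lambda>t. 0)"
  by (simp add: ac_on_def set_integrable_def)

lemma ac_on_sum:
  "(\<And>i. i \<in> I \<Longrightarrow> ac_on T (y i) (q i)) \<Longrightarrow> ac_on T (\<lambda>t. \<Sum>i\<in>I. y i t) (\<lambda>t. \<Sum>i\<in>I. q i t)"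
proof (induction I rule: infinite_finite_induct)
  case (insert i I)
  then show ?case using ac_on_lin[of T "y i" "q i" "\<lambda>t. \<Sum>i\<in>I. y i t" "\<lambda>t. \<Sum>i\<in>I. q i t" 1 1] by simp
qed (simp_all add: ac_on_const)

section \<open>Test functions of time and weak derivatives of scalar functions\<close>

lemma deriv_eq_frechet:
  assumes "C_k (Suc k) (\<phi> :: real \<Rightarrow> real)"
  shows "deriv \<phi> t = frechet_derivative \<phi> (at t) 1" "(\<phi> has_real_derivative deriv \<phi> t) (at t)"
proof -
  note d = C_k_Suc_has_derivative[OF assms, of t]
  have "(\<phi> has_real_derivative frechet_derivative \<phi> (at t) 1) (at t)"
    by (rule has_derivative_imp_has_field_derivative[OF d])
       (metis frechet_derivative_real[OF d])
  then show "deriv \<phi> t = frechet_derivative \<phi> (at t) 1" "(\<phi> has_real_derivative deriv \<phi> t) (at t)"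
    by (auto simp: DERIV_imp_deriv)
qed

lemma C_k_deriv:
  assumes "C_k (Suc k) (\<phi> :: real \<Rightarrow> real)"
  shows "C_k k (deriv \<phi>)"
proof -
  have "deriv \<phi> = (\<lambda>t. frechet_derivative \<phi> (at t) 1)" using deriv_eq_frechet(1)[OF assms] by auto
  then show ?thesis using C_k_partial_deriv[OF assms, of 1] by simp
qed

lemma LINT_Ioo_eq_Icc:
  fixes q :: "real \<Rightarrow> real"
  assumes "continuous_on UNIV q"
  shows "(LINT s:{a<..<b}|lborel. q s) = (LINT s:{a..b}|lborel. q s)"
  unfolding set_lebesgue_integral_def
proof (rule integral_cong_AE)
  have [measurable]: "q \<in> borel_measurable borel" by (rule borel_measurable_continuous_onI[OF assms])
  show "(\<lambda>s. indicator {a<..<b} s *\<^sub>R q s) \<in> borel_measurable lborel"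
    "(\<lambda>s. indicator {a..b} s *\<^sub>R q s) \<in> borel_measurable lborel" by measurable
  show "AE s in lborel. indicator {a<..<b} s *\<^sub>R q s = indicator {a..b} s *\<^sub>R q s"
    using AE_lborel_singleton[of a] AE_lborel_singleton[of b] by eventually_elim (auto simp: indicator_def)
qed

lemma LINT_deriv:
  fixes \<phi> :: "real \<Rightarrow> real"
  assumes "a \<le> b" "\<And>t. (\<phi> has_real_derivative \<phi>' t) (at t)" "continuous_on UNIV \<phi>'"
  shows "(LINT s:{a<..<b}|lborel. \<phi>' s) = \<phi> b - \<phi> a"
  unfolding LINT_Ioo_eq_Icc[OF assms(3)]
  using integral_FTC_Icc_real[OF assms(1), of \<phi> \<phi>'] assms(2,3)
  by (simp add: set_lebesgue_integral_def mult.commute continuous_on_eq_continuous_at)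

lemma set_integrable_continuous:
  fixes q :: "real \<Rightarrow> real"
  assumes "continuous_on UNIV q"
  shows "set_integrable lborel {a<..<b} q"
  using borel_integrable_atLeastAtMost'[OF continuous_on_subset[OF assms subset_UNIV], of a b]
  by (rule set_integrable_subset) auto

text \<open>Makes a test function of time an admissible partner in
  \<open>ac_on_parts\<close>.\<close>

lemma ac_on_C1:
  assumes "C_k (Suc 0) \<phi>"
  shows "ac_on T \<phi> (deriv \<phi>)"
proof -
  have c: "continuous_on UNIV (deriv \<phi>)" using C_k_deriv[OF assms] by simp
  show ?thesis
    unfolding ac_on_def
    using set_integrable_continuous[OF c] continuous_on_subset[OF C_k_imp_continuous[OF assms], of "{0..T}"]
      LINT_deriv[OF _ deriv_eq_frechet(2)[OF assms] c]
    by auto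
qed

text \<open>The set where the value differs from c is open by continuity and null by assumption,
  hence empty; the end points follow by passing to the closure.\<close>

lemma continuous_AE_const:
  fixes r :: "real \<Rightarrow> real"
  assumes "0 < T" "continuous_on {0..T} r" "AE t\<in>{0<..<T} in lborel. r t = c" "t \<in> {0..T}"
  shows "r t = c"
proof -
  define U where "U = {t \<in> {0<..<T}. r t - c \<in> - {0}}"
  have "open U"
  proof -
    have "continuous_on {0<..<T} (\<lambda>t. r t - c)"
      by (intro continuous_intros continuous_on_subset[OF assms(2)]) auto
    from continuous_open_preimage[OF this, of "- {0}"]
    show ?thesis by (simp add: U_def vimage_def Int_def open_Compl)
  qed
  moreover have "U \<in> null_sets lborel"
  proof -
    have "AE t in lborel. t \<notin> U" using assms(3) by eventually_elim (auto simp: U_def)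
    then show ?thesis using \<open>open U\<close> by (subst AE_iff_null_sets) auto
  qed
  ultimately have "U = {}"
    using open_not_negligible[of U] by (auto simp: negligible_iff_null_sets null_sets_completionI)
  then have "r s = c" if "s \<in> {0<..<T}" for s using that by (auto simp: U_def)
  then show ?thesis
    using continuous_constant_on_closure[of "{0<..<T}" r c t] assms(1,2,4) by simp
qed

text \<open>The antiderivative vanishing at 0 is constant off the support of \<zeta>; mean zero is
  what makes that constant 0 on the right of the support as well.\<close>

lemma test_function_antiderivative:
  fixes \<zeta> :: "real \<Rightarrow> real"
  assumes \<zeta>: "\<zeta> \<in> test_functions {0<..<T}" and zero: "(LINT s:{0<..<T}|lborel. \<zeta> s) = 0"
  obtains \<phi> where "\<phi> \<in> test_functions {0<..<T}" "deriv \<phi> = \<zeta>"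
proof -
  have c: "continuous_on UNIV \<zeta>" using C_k_imp_continuous[OF test_functionsD(1)[OF \<zeta>]] .
  obtain F where F: "\<And>t. (F has_real_derivative \<zeta> t) (at t)"
    using einterval_antiderivative[of "-\<infinity>" "\<infinity>" \<zeta>] c
    by (auto simp: continuous_on_eq_continuous_at has_real_derivative_iff_has_vector_derivative)
  define K where "K = closure {s. \<zeta> s \<noteq> 0}"
  have K: "compact K" "K \<subseteq> {0<..<T}" "\<And>s. s \<notin> K \<Longrightarrow> \<zeta> s = 0"
    using test_functionsD(2-4)[OF \<zeta>] unfolding K_def by blast+
  define \<phi> where "\<phi> t = F t - F 0" for t
  have d: "(\<phi> has_real_derivative \<zeta> t) (at t)" for t
    unfolding \<phi>_def by (auto intro!: derivative_eq_intros F)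
  have int0: "\<phi> b - \<phi> a = (LINT s:{a<..<b}|lborel. \<zeta> s)" if "a \<le> b" for a b
    using LINT_deriv[OF that d c] by simp
  have const: "\<phi> b = \<phi> a" if "a \<le> b" "{a<..<b} \<inter> K = {}" for a b
  proof -
    have "(LINT s:{a<..<b}|lborel. \<zeta> s) = (LINT s:{a<..<b}|lborel. 0)"
      using that(2) K(3) by (intro set_lebesgue_integral_cong) (simp, blast)
    then show ?thesis using int0[OF that(1)] by simp
  qed
  have ends: "\<phi> t = 0" if "t \<le> 0 \<or> T \<le> t" for t
  proof (cases "t \<le> 0")
    case True
    then show ?thesis using const[of t 0] K(2) by (force simp: \<phi>_def)
  next
    case False
    show ?thesis
    proof (cases "0 \<le> T")
      case True
      have "\<phi> T = 0" using int0[OF True] zero by (simp add: \<phi>_def)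
      then show ?thesis using const[of T t] K(2) False that by force
    next
      case False
      then have "K = {}" using K(2) by auto
      then show ?thesis using const[of 0 t] \<open>\<not> t \<le> 0\<close> by (simp add: \<phi>_def)
    qed
  qed
  obtain a b where ab: "K \<subseteq> {a..b}" "0 < a" "b < T" if "K \<noteq> {}"
  proof (cases "K = {}")
    case False
    obtain a where "a \<in> K" "\<forall>s\<in>K. a \<le> s" using compact_attains_inf[OF K(1) False] by blast
    moreover obtain b where "b \<in> K" "\<forall>s\<in>K. s \<le> b" using compact_attains_sup[OF K(1) False] by blast
    ultimately show ?thesis using that[of a b] K(2) by (auto simp: subset_iff)
  qed (use that in auto)
  \<comment> \<open>The antiderivative need not vanish in gaps of K, so its support is enclosed in
    an interval containing K; an empty K has no end points and is treated apart.\<close>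
  define L where "L = (if K = {} then {} else {a..b})"
  have L: "compact L" "L \<subseteq> {0<..<T}"
  proof (atomize (full), cases "K = {}")
    case False
    then show "compact L \<and> L \<subseteq> {0<..<T}" using ab(2)[OF False] ab(3)[OF False] by (simp add: L_def subset_eq)
  qed (simp add: L_def)
  have "\<phi> \<in> test_functions {0<..<T}"
  proof (rule test_functionsI[OF _ L])
    show "C_k k \<phi>" for k
    proof (cases k)
      case 0
      then show ?thesis using d by (auto intro: DERIV_isCont continuous_at_imp_continuous_on)
    next
      case (Suc j)
      show ?thesis unfolding Suc
        by (rule C_k_SucI[OF d[THEN has_field_derivative_imp_has_derivative]])
           (use test_functionsD(1)[OF \<zeta>, of j] in simp)
    qed
    fix t assume t: "t \<notin> L"
    show "\<phi> t = 0"
    proof (cases "t \<le> 0 \<or> T \<le> t")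
      case False
      then consider "K = {}" | "K \<noteq> {}" "t < a" | "K \<noteq> {}" "b < t"
        using t by (cases "K = {}"; cases "t < a"; auto simp: L_def)
      then show ?thesis
      proof cases
        case 1 then show ?thesis using const[of 0 t] False by (simp add: \<phi>_def)
      next
        case 2 then show ?thesis using const[of 0 t] False ab by (force simp: \<phi>_def)
      next
        case 3 then show ?thesis using const[of t T] ends[of T] False ab by force
      qed
    qed (rule ends)
  qed
  moreover have "deriv \<phi> = \<zeta>" using d by (intro ext DERIV_imp_deriv)
  ultimately show ?thesis by (rule that)
qed

text \<open>Supplies the unit of mass by which an arbitrary test function is corrected to mean
  zero.\<close>

lemma test_function_integral_nonzero:
  assumes "(0::real) < T"
  obtains \<eta> where "\<eta> \<in> test_functions {0<..<T}" "(LINT s:{0<..<T}|lborel. \<eta> s) = (1::real)"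
proof -
  define \<eta> where "\<eta> = bump (T/3) (2*T/3) 1"
  have \<eta>: "\<eta> \<in> test_functions {0<..<T}"
    unfolding \<eta>_def using assms by (intro test_function_bump) auto
  note c = C_k_imp_continuous[OF test_functionsD(1)[OF \<eta>]]
  have nn: "0 \<le> \<eta> s" for s unfolding \<eta>_def using bump_bounds[of 1] by auto
  have si: "set_integrable lborel {0<..<T} \<eta>" by (rule set_integrable_continuous[OF c])
  have "(LINT s:{0<..<T}|lborel. \<eta> s) \<noteq> 0"
  proof
    assume "(LINT s:{0<..<T}|lborel. \<eta> s) = 0"
    then have "AE s\<in>{0<..<T} in lborel. \<eta> s = 0"
      using si nn integral_nonneg_eq_0_iff_AE[of lborel "\<lambda>s. indicator {0<..<T} s *\<^sub>R \<eta> s"]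
      by (auto simp: set_lebesgue_integral_def set_integrable_def elim!: eventually_mono)
    then have "\<eta> (T/2) = 0"
      using continuous_AE_const[OF assms continuous_on_subset[OF c subset_UNIV], of 0 "T/2"] assms by simp
    moreover have "0 < \<eta> (T/2)" unfolding \<eta>_def using assms by (intro bump_pos) auto
    ultimately show False by simp
  qed
  moreover have "(\<lambda>s. (1 / (LINT s:{0<..<T}|lborel. \<eta> s)) * \<eta> s + 0 * \<eta> s) \<in> test_functions {0<..<T}"
    by (rule test_function_lin[OF \<eta> \<eta>])
  ultimately show ?thesis using that by fastforce
qed

text \<open>Every test function of mean zero is the derivative of a test function. Subtracting from
  \<psi> its mean times \<eta> therefore turns the hypothesis into orthogonality of
  \<open>r - c\<close> to all \<psi>, where c is the mean of r weighted by \<eta>.\<close>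

lemma du_Bois_Reymond:
  assumes T: "0 < T" and r: "continuous_on {0..T} (r :: real \<Rightarrow> real)"
    and test: "\<And>\<phi>. \<phi> \<in> test_functions {0<..<T} \<Longrightarrow> (LINT t:{0<..<T}|lborel. r t * deriv \<phi> t) = 0"
    and t: "t \<in> {0..T}"
  shows "r t = r 0"
proof -
  let ?J = "{0<..<T}"
  obtain \<eta> where \<eta>: "\<eta> \<in> test_functions ?J" "(LINT s:?J|lborel. \<eta> s) = (1::real)"
    using test_function_integral_nonzero[OF T] .
  define c where "c = (LINT s:?J|lborel. r s * \<eta> s)"
  have int: "set_integrable lborel ?J (\<lambda>s. r s * \<phi> s)" "set_integrable lborel ?J \<phi>"
    if "\<phi> \<in> test_functions ?J" for \<phi>
    using set_integrable_continuous[OF C_k_imp_continuous[OF test_functionsD(1)[OF that]]]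
    by (auto intro!: set_integrable_continuous_mult[OF r])
  have "AE s\<in>?J in lborel. r s - c = 0"
  proof (rule fundamental_lemma)
    fix \<psi> assume \<psi>: "\<psi> \<in> test_functions ?J"
    define I where "I = (LINT s:?J|lborel. \<psi> s)"
    define \<zeta> where "\<zeta> s = 1 * \<psi> s + (- I) * \<eta> s" for s
    have \<zeta>: "\<zeta> \<in> test_functions ?J" unfolding \<zeta>_def by (rule test_function_lin[OF \<psi> \<eta>(1)])
    have "(LINT s:?J|lborel. \<zeta> s) = 0"
      unfolding \<zeta>_def using int(2)[OF \<psi>] int(2)[OF \<eta>(1)] \<eta>(2) by (simp add: I_def)
    then obtain \<phi> where \<phi>: "\<phi> \<in> test_functions ?J" "deriv \<phi> = \<zeta>"
      using test_function_antiderivative[OF \<zeta>] by blast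
    have "0 = (LINT s:?J|lborel. r s * \<psi> s - I * (r s * \<eta> s))"
      using test[OF \<phi>(1)] by (simp add: \<phi>(2) \<zeta>_def algebra_simps)
    also have "\<dots> = (LINT s:?J|lborel. r s * \<psi> s) - I * c"
      using int(1)[OF \<psi>] int(1)[OF \<eta>(1)] by (simp add: c_def)
    also have "\<dots> = (LINT s:?J|lborel. (r s - c) * \<psi> s)"
      using int[OF \<psi>] by (simp add: I_def left_diff_distrib)
    finally show "(LINT s:?J|lborel. (r s - c) * \<psi> s) = 0" by simp
  next
    fix a b assume "cbox a b \<subseteq> ?J"
    then have "continuous_on {a..b} (\<lambda>s. r s - c)"
      by (auto intro!: continuous_intros continuous_on_subset[OF r])
    then show "set_integrable lborel (cbox a b) (\<lambda>s. r s - c)"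
      using borel_integrable_atLeastAtMost' by simp
  qed simp
  then have "AE s\<in>?J in lborel. r s = c" by simp
  from continuous_AE_const[OF T r this] t T show ?thesis by simp
qed

text \<open>The difference of y and the indefinite integral of q has vanishing weak derivative, so
  it is constant.\<close>

lemma ac_on_weak_deriv:
  assumes T: "0 < T" and y: "continuous_on {0..T} y" and q: "set_integrable lborel {0<..<T} q"
    and weak: "\<And>\<phi>. \<phi> \<in> test_functions {0<..<T} \<Longrightarrow>
      (LINT t:{0<..<T}|lborel. y t * deriv \<phi> t) = - (LINT t:{0<..<T}|lborel. q t * \<phi> t)"
  shows "ac_on T y q"
proof -
  define Q where "Q t = (LINT s:{0<..<t}|lborel. q s)" for t
  have Q: "ac_on T Q q" unfolding Q_def by (rule ac_on_indefinite_integral[OF q])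
  have Q0: "Q 0 = 0" by (simp add: Q_def set_lebesgue_integral_def)
  have eq: "y t - Q t = y 0 - Q 0" if "t \<in> {0..T}" for t
  proof (rule du_Bois_Reymond[OF T _ _ that])
    show "continuous_on {0..T} (\<lambda>t. y t - Q t)" by (intro continuous_intros y ac_onD(2)[OF Q])
    fix \<phi> assume \<phi>: "\<phi> \<in> test_functions {0<..<T}"
    note ac = ac_on_C1[OF test_functionsD(1)[OF \<phi>], of T]
    have "\<phi> 0 = 0" "\<phi> T = 0"
      by (rule test_functionsD(4)[OF \<phi>]; use test_functionsD(3)[OF \<phi>] in force)+
    then have "(LINT t:{0<..<T}|lborel. Q t * deriv \<phi> t) = - (LINT t:{0<..<T}|lborel. q t * \<phi> t)"
      using ac_on_parts[OF _ Q ac] T by simp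
    then show "(LINT t:{0<..<T}|lborel. (y t - Q t) * deriv \<phi> t) = 0"
      using weak[OF \<phi>] set_integrable_continuous_mult[OF y ac_onD(1)[OF ac]]
        set_integrable_continuous_mult[OF ac_onD(2)[OF Q] ac_onD(1)[OF ac]]
      by (simp add: left_diff_distrib)
  qed
  have "y t = y 0 + Q t" if "t \<in> {0..T}" for t
    using eq[OF that] Q0 by linarith
  then show ?thesis
    using q y unfolding ac_on_def Q_def by blast
qed

section \<open>Functions of space and time\<close>

lemma sets_pair_restrict_space:
  assumes A: "A \<in> sets M" and B: "B \<in> sets N"
  shows "sets (restrict_space M A \<Otimes>\<^sub>M restrict_space N B) = sets (restrict_space (M \<Otimes>\<^sub>M N) (A \<times> B))"
proof (intro set_eqI iffI)
  fix C assume "C \<in> sets (restrict_space M A \<Otimes>\<^sub>M restrict_space N B)"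
  then show "C \<in> sets (restrict_space (M \<Otimes>\<^sub>M N) (A \<times> B))"
    unfolding sets_pair_measure
  proof (induction rule: sigma_sets.induct)
    case (Basic C)
    then show ?case using A B
      by (auto simp: sets_restrict_space_iff sets.Int_space_eq2)
  next
    case (Compl C)
    have "space (restrict_space M A) \<times> space (restrict_space N B) = space (restrict_space (M \<Otimes>\<^sub>M N) (A \<times> B))"
      using A B by (auto simp: space_restrict_space space_pair_measure dest: sets.sets_into_space)
    then show ?case using Compl by auto
  qed auto
next
  fix C assume "C \<in> sets (restrict_space (M \<Otimes>\<^sub>M N) (A \<times> B))"
  then have C: "C \<in> sets (M \<Otimes>\<^sub>M N)" "C \<subseteq> A \<times> B" using A B by (auto simp: sets_restrict_space_iff)
  have "(\<lambda>x. (fst x, snd x)) \<in> measurable (restrict_space M A \<Otimes>\<^sub>M restrict_space N B) (M \<Otimes>\<^sub>M N)"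
    by (intro measurable_Pair measurable_compose[OF measurable_fst] measurable_compose[OF measurable_snd]
        measurable_restrict_space1) auto
  from measurable_sets[OF this C(1)]
  have "(\<lambda>x. (fst x, snd x)) -` C \<inter> space (restrict_space M A \<Otimes>\<^sub>M restrict_space N B)
      \<in> sets (restrict_space M A \<Otimes>\<^sub>M restrict_space N B)" .
  moreover have "(\<lambda>x. (fst x, snd x)) -` C \<inter> space (restrict_space M A \<Otimes>\<^sub>M restrict_space N B) = C"
    using C A B sets.sets_into_space[OF A] sets.sets_into_space[OF B]
    by (auto simp: space_restrict_space space_pair_measure)
  ultimately show "C \<in> sets (restrict_space M A \<Otimes>\<^sub>M restrict_space N B)" by simp
qed

text \<open>Membership in \<open>L2J_L2\<close> is defined on the product set, whereas norms and
  equations are read slice by slice in time; this identity lets the Fubini theorem connect the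
  two.\<close>

lemma lebesgue_in_prod:
  fixes A :: "'c::euclidean_space set" and B :: "'a::euclidean_space set"
  assumes A: "A \<in> sets borel" and B: "B \<in> sets borel"
  shows "lebesgue_in A \<Otimes>\<^sub>M lebesgue_in B = lebesgue_in (A \<times> B)"
proof (rule pair_measure_eqI)
  show "sigma_finite_measure (lebesgue_in A)" "sigma_finite_measure (lebesgue_in B)"
    by (intro sigma_finite_lebesgue_in A B)+
  show "sets (lebesgue_in A \<Otimes>\<^sub>M lebesgue_in B) = sets (lebesgue_in (A \<times> B))"
    using sets_pair_restrict_space[of A lborel B lborel] A B by (simp add: lborel_prod)
  fix X Y assume "X \<in> sets (lebesgue_in A)" "Y \<in> sets (lebesgue_in B)"
  then have XY: "X \<in> sets borel" "X \<subseteq> A" "Y \<in> sets borel" "Y \<subseteq> B"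
    using A B by (auto simp: sets_restrict_space_iff)
  have "emeasure lborel (X \<times> Y) = emeasure lborel X * emeasure lborel Y"
    unfolding lborel_prod[symmetric] using XY by (intro lborel.emeasure_pair_measure_Times) auto
  then show "emeasure (lebesgue_in A) X * emeasure (lebesgue_in B) Y = emeasure (lebesgue_in (A \<times> B)) (X \<times> Y)"
    using XY A B by (subst (1 2 3) emeasure_restrict_space) (auto intro: borel_Times)
qed

lemma pair_sigma_finite_lebesgue_in:
  assumes "A \<in> sets borel" "B \<in> sets borel"
  shows "pair_sigma_finite (lebesgue_in A) (lebesgue_in B)"
  by (intro pair_sigma_finite.intro sigma_finite_lebesgue_in assms)

lemma L2_prod_measurable:
  fixes v :: "'c::euclidean_space \<Rightarrow> 'a::euclidean_space \<Rightarrow> 'b::euclidean_space"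
  assumes A: "A \<in> sets borel" and B: "B \<in> sets borel" and v: "(\<lambda>(t, x). v t x) \<in> L2 (A \<times> B)"
  shows "(\<lambda>(t, x). v t x) \<in> borel_measurable (lebesgue_in A \<Otimes>\<^sub>M lebesgue_in B)"
  unfolding lebesgue_in_prod[OF A B]
  by (rule L2_iff[OF borel_Times[OF A B], THEN iffD1, THEN conjunct1, OF v])

lemma L2_prod_integrable:
  fixes v w :: "'c::euclidean_space \<Rightarrow> 'a::euclidean_space \<Rightarrow> 'b::euclidean_space"
  assumes A: "A \<in> sets borel" and B: "B \<in> sets borel"
    and v: "(\<lambda>(t, x). v t x) \<in> L2 (A \<times> B)" and w: "(\<lambda>(t, x). w t x) \<in> L2 (A \<times> B)"
  shows "integrable (lebesgue_in A \<Otimes>\<^sub>M lebesgue_in B) (\<lambda>(t, x). v t x \<bullet> w t x)"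
  using integrable_inner_L2[OF borel_Times[OF A B] v w]
  by (simp add: lebesgue_in_prod[OF A B] split_beta')

lemma L2_prod_AE:
  fixes v :: "'c::euclidean_space \<Rightarrow> 'a::euclidean_space \<Rightarrow> 'b::euclidean_space"
  assumes A: "A \<in> sets borel" and B: "B \<in> sets borel" and v: "(\<lambda>(t, x). v t x) \<in> L2 (A \<times> B)"
  shows "AE t\<in>A in lborel. v t \<in> L2 B"
proof -
  interpret P: pair_sigma_finite "lebesgue_in A" "lebesgue_in B" by (rule pair_sigma_finite_lebesgue_in[OF A B])
  note [measurable] = L2_prod_measurable[OF A B v]
  have "AE t in lebesgue_in A. integrable (lebesgue_in B) (\<lambda>x. v t x \<bullet> v t x)"
    using P.AE_integrable_fst[OF L2_prod_integrable[OF A B v v]] .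
  moreover have "AE t in lebesgue_in A. t \<in> space (lebesgue_in A)" by (rule AE_space)
  ultimately have "AE t in lebesgue_in A. v t \<in> L2 B"
    by eventually_elim (simp add: L2_iff[OF B] power2_norm_eq_inner del: dot_square_norm)
  then show ?thesis by (simp add: AE_restrict[OF A])
qed

lemma L2_prod_inner:
  fixes v w :: "'c::euclidean_space \<Rightarrow> 'a::euclidean_space \<Rightarrow> 'b::euclidean_space"
  assumes A: "A \<in> sets borel" and B: "B \<in> sets borel"
    and v: "(\<lambda>(t, x). v t x) \<in> L2 (A \<times> B)" and w: "(\<lambda>(t, x). w t x) \<in> L2 (A \<times> B)"
  shows "set_integrable lborel A (\<lambda>t. inner_L2 B (v t) (w t))"
    and "(LINT t:A|lborel. inner_L2 B (v t) (w t)) = inner_L2 (A \<times> B) (\<lambda>(t, x). v t x) (\<lambda>(t, x). w t x)"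
proof -
  interpret P: pair_sigma_finite "lebesgue_in A" "lebesgue_in B" by (rule pair_sigma_finite_lebesgue_in[OF A B])
  note int = L2_prod_integrable[OF A B v w]
  show "set_integrable lborel A (\<lambda>t. inner_L2 B (v t) (w t))"
    using P.integrable_fst[OF int] by (simp add: set_integrable_restrict[OF A] inner_L2_eq[OF B])
  show "(LINT t:A|lborel. inner_L2 B (v t) (w t)) = inner_L2 (A \<times> B) (\<lambda>(t, x). v t x) (\<lambda>(t, x). w t x)"
    using P.integral_fst[OF int]
    by (simp add: set_lebesgue_integral_restrict[OF A] inner_L2_eq[OF B] inner_L2_eq[OF borel_Times[OF A B]]
        lebesgue_in_prod[OF A B] split_beta')
qed

lemma L2_tensor:
  assumes A: "A \<in> sets borel" and B: "B \<in> sets borel" and c: "c \<in> L2 A" and w: "w \<in> L2 B"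
  shows "(\<lambda>(t, x). c t * w x :: real) \<in> L2 (A \<times> B)"
proof -
  have [measurable]: "c \<in> borel_measurable (lebesgue_in A)" "w \<in> borel_measurable (lebesgue_in B)"
    using c w by (simp_all add: L2_iff A B)
  have "integrable (lebesgue_in A \<Otimes>\<^sub>M lebesgue_in B) (\<lambda>(t, x). (norm (c t))\<^sup>2 * (norm (w x))\<^sup>2)"
    using c w by (intro integrable_tensor sigma_finite_lebesgue_in A B) (simp_all add: L2_iff A B)
  moreover have "(\<lambda>(t, x). c t * w x) \<in> borel_measurable (lebesgue_in A \<Otimes>\<^sub>M lebesgue_in B)" by measurable
  ultimately show ?thesis
    by (simp add: L2_iff[OF borel_Times[OF A B]] lebesgue_in_prod[OF A B, symmetric] split_beta' power_mult_distrib abs_mult)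
qed

text \<open>For almost every t, Cauchy-Schwarz in space bounds the squared pairing by
  \<open>(v t, v t) (w, w)\<close>, which is integrable in time.\<close>

lemma L2_pairing:
  assumes A: "A \<in> sets borel" and B: "B \<in> sets borel"
    and v: "(\<lambda>(t, x). v t x :: real) \<in> L2 (A \<times> B)" and w: "w \<in> L2 B"
  shows "(\<lambda>t. inner_L2 B (v t) w) \<in> L2 A"
proof -
  interpret P: pair_sigma_finite "lebesgue_in A" "lebesgue_in B" by (rule pair_sigma_finite_lebesgue_in[OF A B])
  interpret L: semi_inner "L2 B" "inner_L2 B" by (rule semi_inner_L2[OF B])
  note [measurable] = L2_prod_measurable[OF A B v]
  have [measurable]: "w \<in> borel_measurable (lebesgue_in B)" using w by (simp add: L2_iff B)
  have meas: "(\<lambda>t. inner_L2 B (v t) w) \<in> borel_measurable (lebesgue_in A)"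
    unfolding inner_L2_eq[OF B] by measurable
  have "integrable (lebesgue_in A) (\<lambda>t. inner_L2 B (v t) (v t) * inner_L2 B w w)"
    using L2_prod_inner(1)[OF A B v v] by (simp add: set_integrable_restrict[OF A])
  moreover have "AE t in lebesgue_in A. norm ((inner_L2 B (v t) w)\<^sup>2) \<le> norm (inner_L2 B (v t) (v t) * inner_L2 B w w)"
    using L2_prod_AE[OF A B v] unfolding AE_restrict[OF A]
    by eventually_elim (use w L.Cauchy_Schwarz L.nonneg in \<open>simp add: inner_L2_nonneg\<close>)
  ultimately have "integrable (lebesgue_in A) (\<lambda>t. (inner_L2 B (v t) w)\<^sup>2)"
    using meas by (intro Bochner_Integration.integrable_bound[OF _ borel_measurable_power])
  then show ?thesis using meas by (simp add: L2_iff[OF A])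
qed

lemma norm_L2J_L2_eq: "norm_L2J_L2 \<Omega> T f = sqrt (LINT t:{0<..<T}|lborel. inner_L2 \<Omega> (f t) (f t))"
  by (simp add: norm_L2J_L2_def norm_L2_sq)

text \<open>Two triangle inequalities, one in space at each time and one in L2 of the interval for
  the spatial norms.\<close>

lemma norm_L2J_L2_triangle:
  fixes w e \<delta> :: "real \<Rightarrow> 'a::euclidean_space \<Rightarrow> real"
  assumes \<Omega>: "\<Omega> \<in> sets borel"
    and e: "\<And>t. t \<in> {0<..<T} \<Longrightarrow> e t \<in> L2 \<Omega>" and \<delta>: "\<And>t. t \<in> {0<..<T} \<Longrightarrow> \<delta> t \<in> L2 \<Omega>"
    and w: "\<And>t x. t \<in> {0<..<T} \<Longrightarrow> w t x = e t x + \<delta> t x"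
    and ie: "set_integrable lborel {0<..<T} (\<lambda>t. inner_L2 \<Omega> (e t) (e t))"
    and i\<delta>: "set_integrable lborel {0<..<T} (\<lambda>t. inner_L2 \<Omega> (\<delta> t) (\<delta> t))"
  shows "norm_L2J_L2 \<Omega> T w \<le> norm_L2J_L2 \<Omega> T e + norm_L2J_L2 \<Omega> T \<delta>"
proof -
  let ?J = "{0<..<T}"
  have J: "?J \<in> sets borel" by simp
  interpret L: semi_inner "L2 \<Omega>" "inner_L2 \<Omega>" by (rule semi_inner_L2[OF \<Omega>])
  interpret LJ: semi_inner "L2 ?J" "inner_L2 ?J" by (rule semi_inner_L2[OF J])
  have norm_mem: "(\<lambda>t. norm_L2 \<Omega> (v t)) \<in> L2 ?J"
    if "set_integrable lborel ?J (\<lambda>t. inner_L2 \<Omega> (v t) (v t))" for v :: "real \<Rightarrow> 'a \<Rightarrow> real"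
  proof -
    have i: "integrable (lebesgue_in ?J) (\<lambda>t. inner_L2 \<Omega> (v t) (v t))"
      using that by (simp add: set_integrable_restrict)
    note [measurable] = borel_measurable_integrable[OF i]
    have "(\<lambda>t. sqrt (inner_L2 \<Omega> (v t) (v t))) \<in> borel_measurable (lebesgue_in ?J)" by measurable
    then show ?thesis using i by (simp add: L2_iff norm_L2_eq inner_L2_nonneg)
  qed
  note \<alpha> = norm_mem[OF ie] and \<beta> = norm_mem[OF i\<delta>]
  let ?s = "\<lambda>t. norm_L2 \<Omega> (e t) + norm_L2 \<Omega> (\<delta> t)"
  have i: "set_integrable lborel ?J (\<lambda>t. ?s t * ?s t)"
    using integrable_inner_L2[OF J LJ.add_mem[OF \<alpha> \<beta>] LJ.add_mem[OF \<alpha> \<beta>]] by (simp add: set_integrable_restrict)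
  have le: "inner_L2 \<Omega> (w t) (w t) \<le> ?s t * ?s t" if t: "t \<in> ?J" for t
  proof -
    have wt: "w t = (\<lambda>x. e t x + \<delta> t x)" using w[OF t] by auto
    have "norm_L2 \<Omega> (w t) \<le> ?s t"
      unfolding wt norm_L2_eq by (rule L.triangle[OF e[OF t] \<delta>[OF t]])
    then have "(norm_L2 \<Omega> (w t))\<^sup>2 \<le> (?s t)\<^sup>2" by (intro power_mono norm_L2_nonneg)
    then show ?thesis by (simp only: norm_L2_sq power2_eq_square[of "?s t"])
  qed
  have "(LINT t:?J|lborel. inner_L2 \<Omega> (w t) (w t)) \<le> (LINT t:?J|lborel. ?s t * ?s t)"
  \<comment> \<open>Integrability of the left integrand is not among the assumptions; where it
    fails, the integral is 0 by convention and the inequality still holds.\<close>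
  proof (cases "set_integrable lborel ?J (\<lambda>t. inner_L2 \<Omega> (w t) (w t))")
    case True
    then show ?thesis using le by (intro set_integral_mono_AE i) auto
  next
    case False
    then have "(LINT t:?J|lborel. inner_L2 \<Omega> (w t) (w t)) = 0"
      by (simp add: set_lebesgue_integral_def set_integrable_def not_integrable_integral_eq)
    moreover have "0 \<le> (LINT t:?J|lborel. ?s t * ?s t)"
      unfolding set_lebesgue_integral_def by (rule integral_nonneg_AE) (simp add: indicator_def)
    ultimately show ?thesis by simp
  qed
  also have "(LINT t:?J|lborel. ?s t * ?s t) = inner_L2 ?J ?s ?s" by (simp add: inner_L2_def)
  finally have "norm_L2J_L2 \<Omega> T w \<le> sqrt (inner_L2 ?J ?s ?s)"
    unfolding norm_L2J_L2_eq by (rule real_sqrt_le_mono)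
  also have "\<dots> \<le> sqrt (inner_L2 ?J (\<lambda>t. norm_L2 \<Omega> (e t)) (\<lambda>t. norm_L2 \<Omega> (e t)))
      + sqrt (inner_L2 ?J (\<lambda>t. norm_L2 \<Omega> (\<delta> t)) (\<lambda>t. norm_L2 \<Omega> (\<delta> t)))"
    by (rule LJ.triangle[OF \<alpha> \<beta>])
  also have "\<dots> = norm_L2J_L2 \<Omega> T e + norm_L2J_L2 \<Omega> T \<delta>"
    by (simp add: norm_L2J_L2_def inner_L2_def power2_eq_square)
  finally show ?thesis .
qed

lemma L2_Ioo_set_integrable:
  assumes "q \<in> L2 {0<..<T::real}"
  shows "set_integrable lborel {0<..<T} (q :: real \<Rightarrow> real)"
proof -
  have "(\<lambda>t. 1 :: real) \<in> L2 {0<..<T}" by (rule const_L2) auto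
  from integrable_inner_L2[OF _ assms this] show ?thesis by (simp add: set_integrable_restrict)
qed

lemma L2_norm_continuous_inner:
  assumes B: "B \<in> sets borel" and u: "\<And>t. t \<in> S \<Longrightarrow> u t \<in> L2 B" and w: "w \<in> L2 B"
    and cont: "\<And>s. s \<in> S \<Longrightarrow> ((\<lambda>t. norm_L2 B (\<lambda>x. u t x - u s x :: real)) \<longlongrightarrow> 0) (at s within S)"
  shows "continuous_on S (\<lambda>t. inner_L2 B (u t) w)"
  unfolding continuous_on
proof
  fix s assume s: "s \<in> S"
  interpret L: semi_inner "L2 B" "inner_L2 B" by (rule semi_inner_L2[OF B])
  have bound: "eventually (\<lambda>t. norm (inner_L2 B (u t) w - inner_L2 B (u s) w) \<le> norm_L2 B (\<lambda>x. u t x - u s x) * norm_L2 B w) (at s within S)"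
    unfolding eventually_at_filter
    using L.abs_le[OF L.diff_mem[OF u u] w] L.diff_left[OF u u w] s
    by (intro always_eventually) (auto simp: norm_L2_eq)
  have "((\<lambda>t. norm_L2 B (\<lambda>x. u t x - u s x) * norm_L2 B w) \<longlongrightarrow> 0) (at s within S)"
    by (intro tendsto_mult_left_zero cont s)
  from Lim_null_comparison[OF bound this]
  show "((\<lambda>t. inner_L2 B (u t) w) \<longlongrightarrow> inner_L2 B (u s) w) (at s within S)"
    by (rule LIM_zero_cancel)
qed

text \<open>The weak identity holds pointwise in x for each test function of time. Multiplying by
  \<open>w x\<close>, integrating over the domain and exchanging integrals shows that
  \<open>(u t, w)\<close> has the weak derivative \<open>(g t, w)\<close>; continuity in time then
  upgrades this to absolute continuity of the given representative.\<close>

lemma time_deriv_pairing_ac: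
  fixes u g :: "real \<Rightarrow> 'a::euclidean_space \<Rightarrow> real"
  assumes \<Omega>: "\<Omega> \<in> sets borel" and T: "0 < T" and d: "has_time_deriv \<Omega> T u g"
    and u: "\<And>t. t \<in> {0..T} \<Longrightarrow> u t \<in> L2 \<Omega>"
    and cont: "\<And>s. s \<in> {0..T} \<Longrightarrow> ((\<lambda>t. norm_L2 \<Omega> (\<lambda>x. u t x - u s x)) \<longlongrightarrow> 0) (at s within {0..T})"
    and w: "w \<in> L2 \<Omega>"
  shows "ac_on T (\<lambda>t. inner_L2 \<Omega> (u t) w) (\<lambda>t. inner_L2 \<Omega> (g t) w)"
proof (rule ac_on_weak_deriv[OF T])
  let ?J = "{0<..<T}"
  have J: "?J \<in> sets borel" by simp
  interpret P: pair_sigma_finite "lebesgue_in ?J" "lebesgue_in \<Omega>" by (rule pair_sigma_finite_lebesgue_in[OF J \<Omega>])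
  have uL: "(\<lambda>(t, x). u t x) \<in> L2 (?J \<times> \<Omega>)" and gL: "(\<lambda>(t, x). g t x) \<in> L2 (?J \<times> \<Omega>)"
    using d by (auto simp: has_time_deriv_def L2J_L2_def)
  show "continuous_on {0..T} (\<lambda>t. inner_L2 \<Omega> (u t) w)"
    by (rule L2_norm_continuous_inner[OF \<Omega> u w cont])
  show "set_integrable lborel ?J (\<lambda>t. inner_L2 \<Omega> (g t) w)"
    by (rule L2_Ioo_set_integrable[OF L2_pairing[OF J \<Omega> gL w]])
  fix \<phi> assume \<phi>: "\<phi> \<in> test_functions ?J"
  have \<phi>L: "\<phi> \<in> L2 ?J" by (rule test_function_L2[OF J \<phi>])
  have d\<phi>L: "deriv \<phi> \<in> L2 ?J"
    using test_function_partial_L2[OF J \<phi>, of 1] by (simp add: deriv_eq_frechet(1)[OF test_functionsD(1)[OF \<phi>], abs_def])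
  have int: "integrable (lebesgue_in ?J \<Otimes>\<^sub>M lebesgue_in \<Omega>) (\<lambda>(t, x). v t x * (c t * w x))"
    if "(\<lambda>(t, x). v t x) \<in> L2 (?J \<times> \<Omega>)" "c \<in> L2 ?J" for v c
    using L2_prod_integrable[OF J \<Omega> that(1) L2_tensor[OF J \<Omega> that(2) w]] by simp
  have swap: "(LINT t:?J|lborel. inner_L2 \<Omega> (v t) w * c t) = (\<integral>x. w x * (LINT t:?J|lborel. c t * v t x) \<partial>lebesgue_in \<Omega>)"
    if "(\<lambda>(t, x). v t x) \<in> L2 (?J \<times> \<Omega>)" "c \<in> L2 ?J" for v c
  proof -
    have "(LINT t:?J|lborel. inner_L2 \<Omega> (v t) w * c t) = (\<integral>t. (\<integral>x. v t x * (c t * w x) \<partial>lebesgue_in \<Omega>) \<partial>lebesgue_in ?J)"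
      unfolding set_lebesgue_integral_restrict[OF J] inner_L2_eq[OF \<Omega>] integral_mult_left_zero[symmetric]
      by (intro Bochner_Integration.integral_cong refl) (simp add: mult_ac)
    also have "\<dots> = (\<integral>x. (\<integral>t. v t x * (c t * w x) \<partial>lebesgue_in ?J) \<partial>lebesgue_in \<Omega>)"
      by (rule P.Fubini_integral[OF int[OF that], symmetric])
    also have "\<dots> = (\<integral>x. w x * (LINT t:?J|lborel. c t * v t x) \<partial>lebesgue_in \<Omega>)"
      unfolding set_lebesgue_integral_restrict[OF J] integral_mult_right_zero[symmetric]
      by (intro Bochner_Integration.integral_cong refl) (simp add: mult_ac)
    finally show ?thesis .
  qed
  have "AE x in lebesgue_in \<Omega>. (LINT t:?J|lborel. deriv \<phi> t * u t x) = - (LINT t:?J|lborel. \<phi> t * g t x)"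
    using d \<phi> by (simp add: has_time_deriv_def AE_restrict[OF \<Omega>])
  moreover have "(\<lambda>x. LINT t:?J|lborel. c t * v t x :: real) \<in> borel_measurable (lebesgue_in \<Omega>)"
    if "(\<lambda>(t, x). v t x) \<in> L2 (?J \<times> \<Omega>)" "c \<in> L2 ?J" for v and c :: "real \<Rightarrow> real"
  proof -
    have v: "(\<lambda>(x, t). v t x) \<in> borel_measurable (lebesgue_in \<Omega> \<Otimes>\<^sub>M lebesgue_in ?J)"
      using measurable_pair_swap[OF L2_prod_measurable[OF J \<Omega> that(1)]] by simp
    have "c \<in> borel_measurable (lebesgue_in ?J)" using that(2) by (simp add: L2_iff)
    then have c: "(\<lambda>z. c (snd z)) \<in> borel_measurable (lebesgue_in \<Omega> \<Otimes>\<^sub>M lebesgue_in ?J)"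
      by (rule measurable_compose[OF measurable_snd])
    have "(\<lambda>(x, t). c t * v t x) \<in> borel_measurable (lebesgue_in \<Omega> \<Otimes>\<^sub>M lebesgue_in ?J)"
      using borel_measurable_times[OF c v] by (simp add: split_beta')
    then show ?thesis
      unfolding set_lebesgue_integral_restrict[OF J]
      by (rule P.M1.borel_measurable_lebesgue_integral)
  qed
  moreover have "w \<in> borel_measurable (lebesgue_in \<Omega>)" using w by (simp add: L2_iff \<Omega>)
  ultimately have "(\<integral>x. w x * (LINT t:?J|lborel. deriv \<phi> t * u t x) \<partial>lebesgue_in \<Omega>)
      = (\<integral>x. w x * (- (LINT t:?J|lborel. \<phi> t * g t x)) \<partial>lebesgue_in \<Omega>)"
    using uL gL \<phi>L d\<phi>L
    by (intro integral_cong_AE borel_measurable_times borel_measurable_uminus) (auto elim!: eventually_mono)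
  then show "(LINT t:?J|lborel. inner_L2 \<Omega> (u t) w * deriv \<phi> t) = - (LINT t:?J|lborel. inner_L2 \<Omega> (g t) w * \<phi> t)"
    unfolding swap[OF uL d\<phi>L] swap[OF gL \<phi>L] by simp
qed

section \<open>Continuity of translations in \<open>L\<^sup>2\<close>\<close>

lemma lebesgue_in_UNIV: "lebesgue_in UNIV = lborel"
  by (rule measure_eqI) (auto simp: sets_restrict_space emeasure_restrict_space)

lemma L2_UNIV_iff:
  fixes A :: "'a::euclidean_space \<Rightarrow> real"
  shows "A \<in> L2 UNIV \<longleftrightarrow> A \<in> borel_measurable borel \<and> integrable lborel (\<lambda>x. (A x)\<^sup>2)"
  by (simp add: L2_iff lebesgue_in_UNIV)

lemma L2_translate:
  fixes A :: "'a::euclidean_space \<Rightarrow> real"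
  assumes "A \<in> L2 UNIV"
  shows "(\<lambda>x. A (c + x)) \<in> L2 UNIV"
proof -
  have [measurable]: "A \<in> borel_measurable borel" using assms by (simp add: L2_UNIV_iff)
  have "(\<lambda>x. A (c + x)) \<in> borel_measurable borel" by measurable
  then show ?thesis
    using assms lborel_integrable_translate[of "\<lambda>x. (A x)\<^sup>2" c] by (simp add: L2_UNIV_iff)
qed

lemma L2_approx_bounded:
  fixes A :: "'a::euclidean_space \<Rightarrow> real"
  assumes A: "A \<in> L2 UNIV"
  defines "B k x \<equiv> indicator {x. norm x \<le> real k \<and> \<bar>A x\<bar> \<le> real k} x * A x"
  shows "(\<lambda>k. \<integral>x. (A x - B k x)\<^sup>2 \<partial>lborel) \<longlonglongrightarrow> 0"
proof -
  have [measurable]: "A \<in> borel_measurable borel" using A by (simp add: L2_UNIV_iff)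
  have "(\<lambda>k. \<integral>x. (A x - B k x)\<^sup>2 \<partial>lborel) \<longlonglongrightarrow> (\<integral>x. 0 \<partial>(lborel :: 'a measure))"
  proof (rule integral_dominated_convergence)
    show "integrable lborel (\<lambda>x. (A x)\<^sup>2)" using A by (simp add: L2_UNIV_iff)
    show "AE x in lborel. (\<lambda>k. (A x - B k x)\<^sup>2) \<longlonglongrightarrow> 0"
    proof (rule AE_I2)
      fix x
      obtain n where n: "max (norm x) \<bar>A x\<bar> \<le> real n" using real_arch_simple by blast
      have "eventually (\<lambda>k. (A x - B k x)\<^sup>2 = 0) sequentially"
        using eventually_ge_at_top[of n] by eventually_elim (use n in \<open>auto simp: B_def indicator_def\<close>)
      then show "(\<lambda>k. (A x - B k x)\<^sup>2) \<longlonglongrightarrow> 0" by (rule tendsto_eventually)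
    qed
    show "AE x in lborel. norm ((A x - B k x)\<^sup>2) \<le> (A x)\<^sup>2" for k
      by (auto simp: B_def indicator_def)
  qed (auto simp: B_def)
  then show ?thesis by simp
qed

text \<open>Off a negligible set B is a pointwise limit of continuous functions. Clipping them to
  \<open>[- M, M]\<close> and multiplying by a cutoff that falls from 1 to 0 between the radii R and
  \<open>R + 1\<close> keeps the limit, because B obeys both restrictions, and provides an
  integrable dominant.\<close>

lemma bounded_L2_approx_continuous:
  fixes B :: "'a::euclidean_space \<Rightarrow> real"
  assumes B[measurable]: "B \<in> borel_measurable borel" and M: "\<And>x. \<bar>B x\<bar> \<le> M" and R: "\<And>x. R < norm x \<Longrightarrow> B x = 0"
    and e: "0 < e"
  obtains C where "continuous_on UNIV C" "\<And>x. R + 1 < norm x \<Longrightarrow> C x = 0" "(\<integral>x. (B x - C x)\<^sup>2 \<partial>lborel) < e"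
proof -
  have "B measurable_on UNIV"
    by (rule lebesgue_measurable_imp_measurable_on_real) (auto intro: measurable_completion)
  then obtain N g where N: "negligible N" and g: "\<And>n. continuous_on UNIV (g n)" "\<And>x. x \<notin> N \<Longrightarrow> (\<lambda>n. g n x) \<longlonglongrightarrow> B x"
    by (auto simp: measurable_on_def)
  define C where "C n x = max (- M) (min M (g n x)) * max 0 (min 1 (R + 1 - norm x))" for n :: nat and x
  have M0: "0 \<le> M" using M[of 0] by linarith
  have cont: "continuous_on UNIV (C n)" for n
    unfolding C_def by (intro continuous_intros g)
  have out: "C n x = 0" if "R + 1 < norm x" for n x
    using that by (auto simp: C_def)
  have Cb: "\<bar>C n x\<bar> \<le> M" for n x
  proof -
    have "\<bar>max (- M) (min M (g n x))\<bar> * \<bar>max 0 (min 1 (R + 1 - norm x))\<bar> \<le> M * 1"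
      using M0 by (intro mult_mono) auto
    then show ?thesis by (simp add: C_def abs_mult)
  qed
  have "(\<lambda>n. \<integral>x. (B x - C n x)\<^sup>2 \<partial>lborel) \<longlonglongrightarrow> (\<integral>x. 0 \<partial>(lborel :: 'a measure))"
  proof (rule integral_dominated_convergence)
    show "integrable lborel (\<lambda>x. (2 * M)\<^sup>2 * indicator (cball 0 (R + 1)) x :: real)"
      by (rule integrable_indicator_cball)
    have "AE x in lebesgue. x \<notin> N" using N by (intro AE_not_in) (simp add: negligible_iff_null_sets)
    then have "AE x in lborel. x \<notin> N" by (simp add: AE_completion_iff)
    then show "AE x in lborel. (\<lambda>n. (B x - C n x)\<^sup>2) \<longlonglongrightarrow> 0"
    proof eventually_elim
      case (elim x)
      have "max (- M) (min M (B x)) * max 0 (min 1 (R + 1 - norm x)) = B x"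
        using M[of x] R[of x] by (cases "R < norm x") auto
      moreover have "(\<lambda>n. C n x) \<longlonglongrightarrow> max (- M) (min M (B x)) * max 0 (min 1 (R + 1 - norm x))"
        unfolding C_def by (intro tendsto_intros g(2) elim)
      ultimately have "(\<lambda>n. (B x - C n x)\<^sup>2) \<longlonglongrightarrow> (B x - B x)\<^sup>2" by (intro tendsto_intros) auto
      then show ?case by simp
    qed
    show "AE x in lborel. norm ((B x - C n x)\<^sup>2) \<le> (2 * M)\<^sup>2 * indicator (cball 0 (R + 1)) x" for n
    proof (rule AE_I2)
      fix x
      have "\<bar>B x - C n x\<bar> \<le> \<bar>2 * M\<bar>" using M[of x] Cb[of n x] by linarith
      then have "(B x - C n x)\<^sup>2 \<le> (2 * M)\<^sup>2" by (simp only: abs_le_square_iff)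
      then show "norm ((B x - C n x)\<^sup>2) \<le> (2 * M)\<^sup>2 * indicator (cball 0 (R + 1)) x"
        using out[of x n] R[of x] by (cases "norm x \<le> R + 1") auto
    qed
    show "(\<lambda>x. (B x - C n x)\<^sup>2) \<in> borel_measurable lborel" for n
      using borel_measurable_continuous_onI[OF cont[of n]] by measurable
  qed simp
  then have "eventually (\<lambda>n. (\<integral>x. (B x - C n x)\<^sup>2 \<partial>lborel) < e) sequentially"
    using e by (auto intro: order_tendstoD)
  then obtain n where "(\<integral>x. (B x - C n x)\<^sup>2 \<partial>lborel) < e" by (auto simp: eventually_sequentially)
  then show ?thesis using that[OF cont out] by blast
qed

text \<open>Pointwise convergence by continuity; shifts of length at most 1 keep everything in the
  ball of radius \<open>R + 1\<close>, on which a constant dominates.\<close>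

lemma continuous_translation_tendsto:
  fixes C :: "'a::euclidean_space \<Rightarrow> real"
  assumes C: "continuous_on UNIV C" and R: "\<And>x. R < norm x \<Longrightarrow> C x = 0"
    and z: "z \<longlonglongrightarrow> 0" "\<And>n. norm (z n) \<le> 1"
  shows "(\<lambda>n. \<integral>x. (C (z n + x) - C x)\<^sup>2 \<partial>lborel) \<longlonglongrightarrow> 0"
proof -
  have [measurable]: "C \<in> borel_measurable borel" by (rule borel_measurable_continuous_onI[OF C])
  have "bounded (C ` cball 0 R)"
    by (intro compact_imp_bounded compact_continuous_image continuous_on_subset[OF C]) auto
  then obtain M where M: "\<forall>x\<in>cball 0 R. \<bar>C x\<bar> \<le> M" by (auto simp: bounded_iff)
  have Mb: "\<bar>C x\<bar> \<le> \<bar>M\<bar>" for x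
    using M R[of x] by (cases "norm x \<le> R") (force simp: )+
  have "(\<lambda>n. \<integral>x. (C (z n + x) - C x)\<^sup>2 \<partial>lborel) \<longlonglongrightarrow> (\<integral>x. 0 \<partial>(lborel :: 'a measure))"
  proof (rule integral_dominated_convergence)
    show "integrable lborel (\<lambda>x. (2 * \<bar>M\<bar>)\<^sup>2 * indicator (cball 0 (R + 1)) x :: real)"
      by (rule integrable_indicator_cball)
    show "AE x in lborel. (\<lambda>n. (C (z n + x) - C x)\<^sup>2) \<longlonglongrightarrow> 0"
    proof (rule AE_I2)
      fix x
      have "isCont C x" using C by (simp add: continuous_on_eq_continuous_at)
      moreover have "(\<lambda>n. z n + x) \<longlonglongrightarrow> 0 + x" by (intro tendsto_intros z)
      ultimately have "(\<lambda>n. C (z n + x)) \<longlonglongrightarrow> C x" by (auto intro: isCont_tendsto_compose)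
      then have "(\<lambda>n. (C (z n + x) - C x)\<^sup>2) \<longlonglongrightarrow> (C x - C x)\<^sup>2" by (intro tendsto_intros)
      then show "(\<lambda>n. (C (z n + x) - C x)\<^sup>2) \<longlonglongrightarrow> 0" by simp
    qed
    show "AE x in lborel. norm ((C (z n + x) - C x)\<^sup>2) \<le> (2 * \<bar>M\<bar>)\<^sup>2 * indicator (cball 0 (R + 1)) x" for n
    proof (rule AE_I2)
      fix x
      have "\<bar>C (z n + x) - C x\<bar> \<le> \<bar>2 * \<bar>M\<bar>\<bar>" using Mb[of x] Mb[of "z n + x"] by linarith
      then have "(C (z n + x) - C x)\<^sup>2 \<le> (2 * \<bar>M\<bar>)\<^sup>2" by (simp only: abs_le_square_iff)
      moreover have "C x = 0 \<and> C (z n + x) = 0" if "R + 1 < norm x"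
        using R[of x] R[of "z n + x"] norm_diff_ineq[of x "z n"] z(2)[of n] that by (simp add: add.commute)
      ultimately show "norm ((C (z n + x) - C x)\<^sup>2) \<le> (2 * \<bar>M\<bar>)\<^sup>2 * indicator (cball 0 (R + 1)) x"
        by (cases "norm x \<le> R + 1") auto
    qed
  qed auto
  then show ?thesis by simp
qed

text \<open>Density of continuous compactly supported functions, together with the fact that
  translation is an isometry of L2.\<close>

lemma L2_translation_tendsto:
  fixes A :: "'a::euclidean_space \<Rightarrow> real"
  assumes A: "A \<in> L2 UNIV" and z: "z \<longlonglongrightarrow> 0" "\<And>n. norm (z n) \<le> 1"
  shows "(\<lambda>n. \<integral>x. (A (z n + x) - A x)\<^sup>2 \<partial>lborel) \<longlonglongrightarrow> 0"
proof (rule LIMSEQ_I)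
  fix e :: real assume e: "0 < e"
  have [measurable]: "A \<in> borel_measurable borel" using A by (simp add: L2_UNIV_iff)
  define B where "B k x = indicator {x. norm x \<le> real k \<and> \<bar>A x\<bar> \<le> real k} x * A x" for k :: nat and x
  \<comment> \<open>Two errors below \<open>e / 36\<close>, each doubled when the square of a sum is
    split, add up to at most \<open>e / 9\<close>; the final estimate takes three times the sum of
    three terms, two at most \<open>e / 9\<close> and one strictly below it.\<close>
  have "eventually (\<lambda>k. (\<integral>x. (A x - B k x)\<^sup>2 \<partial>lborel) < e / 36) sequentially"
    using L2_approx_bounded[OF A] e unfolding B_def by (intro order_tendstoD) auto
  then obtain k where k: "(\<integral>x. (A x - B k x)\<^sup>2 \<partial>lborel) < e / 36" by (auto simp: eventually_sequentially)
  have mB[measurable]: "B k \<in> borel_measurable borel" by (simp add: B_def[abs_def])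
  obtain C where C: "continuous_on UNIV C" "\<And>x. real k + 1 < norm x \<Longrightarrow> C x = 0" "(\<integral>x. (B k x - C x)\<^sup>2 \<partial>lborel) < e / 36"
    by (rule bounded_L2_approx_continuous[OF mB, of "real k" "real k" "e / 36"])
       (use e in \<open>auto simp: B_def indicator_def split: if_splits\<close>)
  have [measurable]: "C \<in> borel_measurable borel" by (rule borel_measurable_continuous_onI[OF C(1)])
  have BL: "B k \<in> L2 UNIV"
  proof -
    have "integrable lborel (\<lambda>x. (B k x)\<^sup>2)"
      by (rule Bochner_Integration.integrable_bound[of _ "\<lambda>x. (A x)\<^sup>2"])
         (use A in \<open>auto simp: L2_UNIV_iff B_def indicator_def\<close>)
    then show ?thesis by (simp add: L2_UNIV_iff)
  qed
  have CL: "C \<in> L2 UNIV"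
    by (rule continuous_compact_support_L2[OF _ C(1), of _ "cball 0 (real k + 1)"]) (use C(2) in auto)
  interpret L: semi_inner "L2 UNIV" "inner_L2 (UNIV :: 'a set)" by (rule semi_inner_L2) simp
  have int: "integrable lborel (\<lambda>x. (f x - g x)\<^sup>2)" if "f \<in> L2 UNIV" "g \<in> L2 UNIV" for f g :: "'a \<Rightarrow> real"
    using L.diff_mem[OF that] by (simp add: L2_UNIV_iff)
  note tr = L2_translate
  have AC: "(\<integral>x. (A x - C x)\<^sup>2 \<partial>lborel) \<le> e / 9"
  proof -
    have "(\<integral>x. (A x - C x)\<^sup>2 \<partial>lborel) \<le> (\<integral>x. 2 * (A x - B k x)\<^sup>2 + 2 * (B k x - C x)\<^sup>2 \<partial>lborel)"
    proof (rule integral_mono)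
      fix x
      have "0 \<le> ((A x - B k x) - (B k x - C x))\<^sup>2" by simp
      then show "(A x - C x)\<^sup>2 \<le> 2 * (A x - B k x)\<^sup>2 + 2 * (B k x - C x)\<^sup>2"
        by (simp add: power2_eq_square algebra_simps)
    qed (use int A BL CL in auto)
    also have "\<dots> = 2 * (\<integral>x. (A x - B k x)\<^sup>2 \<partial>lborel) + 2 * (\<integral>x. (B k x - C x)\<^sup>2 \<partial>lborel)"
      using int[OF A BL] int[OF BL CL] by simp
    finally show ?thesis using k C(3) by simp
  qed
  have "eventually (\<lambda>n. (\<integral>x. (C (z n + x) - C x)\<^sup>2 \<partial>lborel) < e / 9) sequentially"
    using continuous_translation_tendsto[OF C(1,2) z] e by (intro order_tendstoD) auto
  then obtain n0 where n0: "\<And>n. n \<ge> n0 \<Longrightarrow> (\<integral>x. (C (z n + x) - C x)\<^sup>2 \<partial>lborel) < e / 9"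
    by (auto simp: eventually_sequentially)
  have "norm ((\<integral>x. (A (z n + x) - A x)\<^sup>2 \<partial>lborel) - 0) < e" if "n \<ge> n0" for n
  proof -
    have "(\<integral>x. (A (z n + x) - A x)\<^sup>2 \<partial>lborel)
        \<le> (\<integral>x. 3 * (A (z n + x) - C (z n + x))\<^sup>2 + 3 * (C (z n + x) - C x)\<^sup>2 + 3 * (A x - C x)\<^sup>2 \<partial>lborel)"
    proof (rule integral_mono)
      fix x
      have three: "(a + b + c)\<^sup>2 \<le> 3 * a\<^sup>2 + 3 * b\<^sup>2 + 3 * c\<^sup>2" for a b c :: real
      proof -
        have "0 \<le> (a - b)\<^sup>2 + (b - c)\<^sup>2 + (a - c)\<^sup>2" by simp
        then show ?thesis by (simp add: power2_eq_square algebra_simps)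
      qed
      show "(A (z n + x) - A x)\<^sup>2 \<le> 3 * (A (z n + x) - C (z n + x))\<^sup>2 + 3 * (C (z n + x) - C x)\<^sup>2 + 3 * (A x - C x)\<^sup>2"
        using three[of "A (z n + x) - C (z n + x)" "C (z n + x) - C x" "C x - A x"] by (simp add: power2_commute[of "C x"])
    qed (use int tr A CL in \<open>auto intro!: Bochner_Integration.integrable_add integrable_mult_right\<close>)
    also have "\<dots> = 3 * (\<integral>x. (A (z n + x) - C (z n + x))\<^sup>2 \<partial>lborel) + 3 * (\<integral>x. (C (z n + x) - C x)\<^sup>2 \<partial>lborel)
        + 3 * (\<integral>x. (A x - C x)\<^sup>2 \<partial>lborel)"
      using int[OF tr[OF A, of "z n"] tr[OF CL, of "z n"]] int[OF tr[OF CL, of "z n"] CL] int[OF A CL] by simp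
    also have "(\<integral>x. (A (z n + x) - C (z n + x))\<^sup>2 \<partial>lborel) = (\<integral>x. (A x - C x)\<^sup>2 \<partial>lborel)"
      using lborel_integral_translate[of "\<lambda>x. (A x - C x)\<^sup>2" "z n"] by simp
    finally show ?thesis using AC n0[OF that] e by simp
  qed
  then show "\<exists>n0. \<forall>n\<ge>n0. norm ((\<integral>x. (A (z n + x) - A x)\<^sup>2 \<partial>lborel) - 0) < e" by blast
qed

text \<open>Cauchy-Schwarz applied to the translation error. In this form the averaging length of
  the backward differences is sent to 0.\<close>

lemma L2_correlation_tendsto:
  fixes A B :: "'a::euclidean_space \<Rightarrow> real"
  assumes A: "A \<in> L2 UNIV" and B: "B \<in> L2 UNIV" and z: "z \<longlonglongrightarrow> 0" "\<And>n. norm (z n) \<le> 1"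
  shows "(\<lambda>n. \<integral>x. A (z n + x) * B x \<partial>lborel) \<longlonglongrightarrow> (\<integral>x. A x * B x \<partial>lborel)"
proof -
  interpret L: semi_inner "L2 UNIV" "inner_L2 (UNIV :: 'a set)" by (rule semi_inner_L2) simp
  have inner: "inner_L2 UNIV f g = (\<integral>x. f x * g x \<partial>lborel)" for f g :: "'a \<Rightarrow> real"
    by (simp add: inner_L2_eq lebesgue_in_UNIV)
  note tr = L2_translate[OF A]
  have bound: "norm (inner_L2 UNIV (\<lambda>x. A (z n + x)) B - inner_L2 UNIV A B)
      \<le> sqrt (\<integral>x. (A (z n + x) - A x)\<^sup>2 \<partial>lborel) * sqrt (inner_L2 UNIV B B)" for n
    using L.abs_le[OF L.diff_mem[OF tr A] B, of "z n"] L.diff_left[OF tr A B, of "z n"]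
    by (simp add: inner power2_eq_square)
  have "(\<lambda>n. sqrt (\<integral>x. (A (z n + x) - A x)\<^sup>2 \<partial>lborel) * sqrt (inner_L2 UNIV B B)) \<longlonglongrightarrow> 0"
    using tendsto_real_sqrt[OF L2_translation_tendsto[OF A z]] by (intro tendsto_mult_left_zero) simp
  from Lim_null_comparison[OF always_eventually[OF allI[OF bound]] this]
  have "(\<lambda>n. inner_L2 UNIV (\<lambda>x. A (z n + x)) B) \<longlonglongrightarrow> inner_L2 UNIV A B"
    by (rule LIM_zero_cancel)
  then show ?thesis by (simp only: inner)
qed

section \<open>The time derivative and the Laplacian\<close>

lemma LINT_reflect:
  fixes q :: "real \<Rightarrow> real"
  shows "(LINT r:{a<..<b}|lborel. q (c - r)) = (LINT s:{c - b<..<c - a}|lborel. q s)"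
proof -
  have "(LINT s:{c - b<..<c - a}|lborel. q s) = (\<integral>r. indicator {c - b<..<c - a} (c + (-1) * r) *\<^sub>R q (c + (-1) * r) \<partial>lborel)"
    unfolding set_lebesgue_integral_def
    by (subst lborel_integral_real_affine[where c = "-1" and t = c]) simp_all
  also have "\<dots> = (LINT r:{a<..<b}|lborel. q (c - r))"
    unfolding set_lebesgue_integral_def
    by (intro Bochner_Integration.integral_cong) (auto simp: indicator_def)
  finally show ?thesis by simp
qed

lemma set_integrable_reflect:
  fixes q :: "real \<Rightarrow> real"
  assumes "set_integrable lborel {c - b<..<c - a} q"
  shows "set_integrable lborel {a<..<b} (\<lambda>r. q (c - r))"
proof -
  have "integrable lborel (\<lambda>r. indicator {c - b<..<c - a} (c + (-1) * r) *\<^sub>R q (c + (-1) * r))"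
    by (rule lborel_integrable_real_affine) (use assms in \<open>auto simp: set_integrable_def\<close>)
  moreover have "(\<lambda>r. indicator {c - b<..<c - a} (c + (-1) * r) *\<^sub>R q (c + (-1) * r)) = (\<lambda>r. indicator {a<..<b} r *\<^sub>R q (c - r))"
    by (auto simp: indicator_def)
  ultimately show ?thesis by (simp add: set_integrable_def)
qed

lemma LINT_split:
  fixes q :: "real \<Rightarrow> real"
  assumes "a \<le> b" "b \<le> c" and q: "set_integrable lborel {a<..<c} q"
  shows "(LINT r:{a<..<c}|lborel. q r) = (LINT r:{a<..<b}|lborel. q r) + (LINT r:{b<..<c}|lborel. q r)"
proof -
  have i: "set_integrable lborel {a<..<b} q" "set_integrable lborel {b<..<c} q"
    using assms(1,2) by (auto intro: set_integrable_subset[OF q])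
  have "(LINT r:{a<..<c}|lborel. q r) = (\<integral>r. indicator {a<..<b} r *\<^sub>R q r + indicator {b<..<c} r *\<^sub>R q r \<partial>lborel)"
    unfolding set_lebesgue_integral_def
  proof (rule integral_cong_AE)
    show "AE r in lborel. indicator {a<..<c} r *\<^sub>R q r = indicator {a<..<b} r *\<^sub>R q r + indicator {b<..<c} r *\<^sub>R q r"
      using AE_lborel_singleton[of b] by eventually_elim (use assms(1,2) in \<open>auto simp: indicator_def\<close>)
  qed (use q i in \<open>auto simp: set_integrable_def\<close>)
  then show ?thesis
    using i by (simp add: set_lebesgue_integral_def set_integrable_def)
qed

lemma ac_on_increment:
  assumes y: "ac_on T y q" and st: "0 \<le> s" "s \<le> t" "t \<le> T"
  shows "(LINT r:{s<..<t}|lborel. q r) = y t - y s"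
proof -
  have "set_integrable lborel {0<..<t} q"
    using st by (intro set_integrable_subset[OF ac_onD(1)[OF y]]) auto
  then show ?thesis
    using LINT_split[OF st(1,2)] ac_onD(3)[OF y, of s] ac_onD(3)[OF y, of t] st by simp
qed

text \<open>The time \<open>t - h\<close> modulo the period. At \<open>t = h\<close> the value is T
  rather than 0, which concerns a single instant.\<close>

definition periodic_shift :: "real \<Rightarrow> real \<Rightarrow> real \<Rightarrow> real" where
  "periodic_shift T h t = (if h < t then t - h else t - h + T)"

text \<open>The increment over a backward step is the integral of the density at the times
  \<open>t - r\<close>. When the step reaches across 0, the remainder is taken from the end of the
  period, and \<open>y 0 = y T\<close> glues the two pieces.\<close>

lemma ac_on_periodic_increment:
  assumes y: "ac_on T y q" and per: "y 0 = y T" and h: "0 < h" "h < T" and t: "t \<in> {0<..<T}"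
  shows "(LINT r:{0<..<h}|lborel. (if r < t then q (t - r) else q (t + T - r))) = y t - y (periodic_shift T h t)"
proof (cases "h < t")
  case True
  have "(LINT r:{0<..<h}|lborel. (if r < t then q (t - r) else q (t + T - r))) = (LINT r:{0<..<h}|lborel. q (t - r))"
    using True by (intro set_lebesgue_integral_cong) auto
  then show ?thesis
    using True h t ac_on_increment[OF y, of "t - h" t] LINT_reflect[of 0 h q t] by (simp add: periodic_shift_def)
next
  case False
  let ?f = "\<lambda>r. if r < t then q (t - r) else q (t + T - r)"
  have i1: "set_integrable lborel {0<..<t} (\<lambda>r. q (t - r))"
    using t by (intro set_integrable_reflect set_integrable_subset[OF ac_onD(1)[OF y]]) auto
  have i2: "set_integrable lborel {t<..<h} (\<lambda>r. q (t + T - r))"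
    using False h t by (intro set_integrable_reflect set_integrable_subset[OF ac_onD(1)[OF y]]) auto
  have "(LINT r:{0<..<h}|lborel. ?f r) = (\<integral>r. indicator {0<..<t} r *\<^sub>R q (t - r) + indicator {t<..<h} r *\<^sub>R q (t + T - r) \<partial>lborel)"
    unfolding set_lebesgue_integral_def
  proof (rule integral_cong_AE)
    have m: "(\<lambda>r. indicator {0<..<t} r *\<^sub>R q (t - r) + indicator {t<..<h} r *\<^sub>R q (t + T - r)) \<in> borel_measurable lborel"
      using i1 i2 by (auto simp: set_integrable_def)
    then show "(\<lambda>r. indicator {0<..<t} r *\<^sub>R q (t - r) + indicator {t<..<h} r *\<^sub>R q (t + T - r)) \<in> borel_measurable lborel" .
    \<comment> \<open>The two integrands agree except possibly at \<open>r = t\<close>, so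
      measurability is transferred by altering a measurable function at one point.\<close>
    have "(\<lambda>r. if r = t then indicator {0<..<h} t *\<^sub>R ?f t
        else indicator {0<..<t} r *\<^sub>R q (t - r) + indicator {t<..<h} r *\<^sub>R q (t + T - r)) \<in> borel_measurable lborel"
      using m by measurable
    also have "(\<lambda>r. if r = t then indicator {0<..<h} t *\<^sub>R ?f t
        else indicator {0<..<t} r *\<^sub>R q (t - r) + indicator {t<..<h} r *\<^sub>R q (t + T - r)) = (\<lambda>r. indicator {0<..<h} r *\<^sub>R ?f r)"
      using False t by (auto simp: indicator_def fun_eq_iff)
    finally show "(\<lambda>r. indicator {0<..<h} r *\<^sub>R ?f r) \<in> borel_measurable lborel" .
    show "AE r in lborel. indicator {0<..<h} r *\<^sub>R ?f r = indicator {0<..<t} r *\<^sub>R q (t - r) + indicator {t<..<h} r *\<^sub>R q (t + T - r)"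
      using AE_lborel_singleton[of t] by eventually_elim (use False t in \<open>auto simp: indicator_def\<close>)
  qed
  also have "\<dots> = (LINT r:{0<..<t}|lborel. q (t - r)) + (LINT r:{t<..<h}|lborel. q (t + T - r))"
    using i1 i2 by (simp add: set_integrable_def set_lebesgue_integral_def)
  also have "\<dots> = (LINT r:{0<..<t}|lborel. q r) + (LINT r:{t + T - h<..<T}|lborel. q r)"
    using LINT_reflect[of 0 t q t] LINT_reflect[of t h q "t + T"] by simp
  also have "\<dots> = (y t - y 0) + (y T - y (t + T - h))"
    using ac_on_increment[OF y, of 0 t] ac_on_increment[OF y, of "t + T - h" T] False h t by simp
  finally show ?thesis using False per by (simp add: periodic_shift_def algebra_simps)
qed

lemma AE_lborel_translate:
  fixes c :: "'a::euclidean_space"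
  assumes "AE x in lborel. P x"
  shows "AE x in lborel. P (c + x)"
proof -
  have "AE x in distr lborel borel ((+) c). P x" unfolding lborel_distr_plus by (rule assms)
  then show ?thesis by (rule AE_distrD[rotated]) simp
qed

text \<open>The exceptional set is pulled back along the two translations that make up the shift;
  \<open>t = h\<close> is discarded because the shift sends it to the end point T.\<close>

lemma AE_periodic_shift:
  assumes P: "AE t\<in>{0<..<T} in lborel. P t" and h: "0 < h" "h < T"
  shows "AE t\<in>{0<..<T} in lborel. periodic_shift T h t \<in> {0<..<T} \<and> P (periodic_shift T h t)"
  using AE_lborel_translate[OF P, of "- h"] AE_lborel_translate[OF P, of "T - h"] AE_lborel_singleton[of h]
  by eventually_elim (use h in \<open>auto simp: periodic_shift_def algebra_simps\<close>)

text \<open>The shift exchanges two subintervals by translations, hence preserves the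
  measure.\<close>

lemma LINT_periodic_shift:
  assumes F: "set_integrable lborel {0<..<T} F" and h: "0 < h" "h < T"
  shows "set_integrable lborel {0<..<T} (\<lambda>t. F (periodic_shift T h t) :: real)"
    and "(LINT t:{0<..<T}|lborel. F (periodic_shift T h t)) = (LINT t:{0<..<T}|lborel. F t)"
proof -
  define F1 where "F1 t = indicator {0<..<T - h} t *\<^sub>R F t" for t
  define F2 where "F2 t = indicator {T - h<..<T} t *\<^sub>R F t" for t
  have "set_integrable lborel {0<..<T - h} F" "set_integrable lborel {T - h<..<T} F"
    using h by (auto intro!: set_integrable_subset[OF F])
  then have i: "integrable lborel F1" "integrable lborel F2"
    by (simp_all add: F1_def[abs_def] F2_def[abs_def] set_integrable_def)
  \<comment> \<open>The last summand accounts for \<open>t = h\<close>, where the shift takes the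
    value T; it integrates to 0.\<close>
  have eq: "indicator {0<..<T} t *\<^sub>R F (periodic_shift T h t) = F1 (- h + t) + F2 ((T - h) + t)
     + indicator {h} t *\<^sub>R F T" for t
    using h by (auto simp: F1_def F2_def periodic_shift_def indicator_def algebra_simps)
  have i': "integrable lborel (\<lambda>t. F1 (- h + t))" "integrable lborel (\<lambda>t. F2 ((T - h) + t))"
    by (rule lborel_integrable_translate i)+
  have i0: "integrable lborel (\<lambda>t. indicator {h} t *\<^sub>R F T)" by simp
  show "set_integrable lborel {0<..<T} (\<lambda>t. F (periodic_shift T h t))"
    unfolding set_integrable_def eq using i' i0 by simp
  have z: "(\<integral>t. indicator {h} t *\<^sub>R F T \<partial>lborel) = 0" by simp
  have "(LINT t:{0<..<T}|lborel. F (periodic_shift T h t)) = (\<integral>t. F1 t \<partial>lborel) + (\<integral>t. F2 t \<partial>lborel)"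
    unfolding set_lebesgue_integral_def eq
    using i' i0 z lborel_integral_translate[of F1 "- h"] lborel_integral_translate[of F2 "T - h"] i by simp
  also have "\<dots> = (LINT t:{0<..<T}|lborel. F t)"
    using LINT_split[OF _ _ F, of "T - h"] h by (simp add: F1_def F2_def set_lebesgue_integral_def)
  finally show "(LINT t:{0<..<T}|lborel. F (periodic_shift T h t)) = (LINT t:{0<..<T}|lborel. F t)" .
qed

section \<open>Translations and reflections in space-time\<close>

lemma L2_extend:
  fixes v :: "'a::euclidean_space \<Rightarrow> real"
  assumes "v \<in> L2 S"
  shows "(\<lambda>z. indicator S z * v z) \<in> L2 UNIV"
proof -
  have "(\<lambda>z. (indicator S z * v z)\<^sup>2) = (\<lambda>z. indicator S z * (v z)\<^sup>2)"
    by (auto simp: indicator_def)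
  then show ?thesis using assms by (simp add: L2_UNIV_iff L2_def set_borel_measurable_def set_integrable_def)
qed

text \<open>The translate has the same norm for each r, so square integrability jointly in the shift
  and the space-time variable follows from finiteness of the interval of shifts. This justifies
  exchanging the average over shifts with the space-time integral.\<close>

lemma L2_translations:
  fixes A :: "real \<times> 'a::euclidean_space \<Rightarrow> real"
  assumes A: "A \<in> L2 UNIV"
  shows "(\<lambda>(r, z). A ((- r, 0) + z)) \<in> L2 ({0<..<h::real} \<times> UNIV)"
proof -
  let ?M = "lebesgue_in {0<..<h}"
  have J: "{0<..<h} \<in> sets borel" by simp
  interpret P: pair_sigma_finite ?M "lborel :: (real \<times> 'a) measure"
    using pair_sigma_finite_lebesgue_in[OF J, of UNIV] by (simp add: lebesgue_in_UNIV)
  have [measurable]: "A \<in> borel_measurable borel" and i: "integrable lborel (\<lambda>z. (A z)\<^sup>2)"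
    using A by (auto simp: L2_UNIV_iff)
  have [measurable]: "(\<lambda>r. r) \<in> borel_measurable ?M" by (simp add: measurable_restrict_space1)
  have shift: "(\<lambda>x. (- fst x, 0) + snd x) \<in> borel_measurable (?M \<Otimes>\<^sub>M (lborel :: (real \<times> 'a) measure))"
    by (intro borel_measurable_add borel_measurable_Pair borel_measurable_uminus measurable_snd'')
       (auto intro: measurable_compose[OF measurable_fst])
  have meas: "(\<lambda>x. A ((- fst x, 0) + snd x)) \<in> borel_measurable (?M \<Otimes>\<^sub>M lborel)"
    by (rule measurable_compose[OF shift]) simp
  have int: "integrable (?M \<Otimes>\<^sub>M lborel) (\<lambda>x. (A ((- fst x, 0) + snd x))\<^sup>2)"
  proof (rule P.Fubini_integrable)
    show "(\<lambda>x. (A ((- fst x, 0) + snd x))\<^sup>2) \<in> borel_measurable (?M \<Otimes>\<^sub>M lborel)"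
      using meas by (rule borel_measurable_power)
    have "(\<integral>z. norm ((A ((- r, 0) + z))\<^sup>2) \<partial>lborel) = (\<integral>z. (A z)\<^sup>2 \<partial>lborel)" for r
      using lborel_integral_translate[of "\<lambda>z. (A z)\<^sup>2" "(- r, 0)"] by simp
    moreover have "integrable ?M (\<lambda>r. c :: real)" for c
      by (simp add: integrable_restrict_space emeasure_bounded_finite)
         (auto intro!: integrable_mult_left integrable_real_indicator emeasure_bounded_finite)
    ultimately show "integrable ?M (\<lambda>r. \<integral>z. norm ((A ((- fst (r, z), 0) + snd (r, z)))\<^sup>2) \<partial>lborel)"
      by simp
    show "AE r in ?M. integrable lborel (\<lambda>z. (A ((- fst (r, z), 0) + snd (r, z)))\<^sup>2)"
      using lborel_integrable_translate[OF i] by simp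
  qed
  have "lebesgue_in ({0<..<h} \<times> (UNIV :: (real \<times> 'a) set)) = ?M \<Otimes>\<^sub>M lborel"
    using lebesgue_in_prod[OF J, of "UNIV :: (real \<times> 'a) set"] by (simp add: lebesgue_in_UNIV)
  then show ?thesis
    using meas int by (simp add: L2_iff split_beta' borel_Times)
qed

text \<open>For every fixed t the reflection in time preserves Lebesgue measure, so the exchange of
  the shift variable with x is available at each single time.\<close>

lemma L2_reflect_time:
  fixes A :: "real \<times> 'a::euclidean_space \<Rightarrow> real"
  assumes A: "A \<in> L2 UNIV" and S: "S \<in> sets borel"
  shows "(\<lambda>(r, x). A (t - r, x)) \<in> L2 (S \<times> UNIV)"
proof -
  let ?T = "\<lambda>(r, x). (t + (-1) * r, x) :: real \<times> 'a"
  have "distr lborel borel (\<lambda>r. t + (-1) * r) = (lborel :: real measure)"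
    using lborel_real_affine[of "-1" t] by (simp add: density_1 one_ennreal_def[symmetric])
  moreover have "distr (lborel :: 'a measure) borel (\<lambda>x. x) = lborel"
    by (rule measure_eqI) (auto simp: emeasure_distr)
  ultimately have D: "distr (lborel \<Otimes>\<^sub>M lborel) (borel \<Otimes>\<^sub>M borel) ?T = (lborel \<Otimes>\<^sub>M lborel :: (real \<times> 'a) measure)"
    using pair_measure_distr[of "\<lambda>r. t + (-1) * r" lborel borel "\<lambda>x. x :: 'a" lborel borel]
    by (simp add: sigma_finite_lborel)
  have [measurable]: "A \<in> borel_measurable borel" and i: "integrable lborel (\<lambda>z. (A z)\<^sup>2)"
    using A by (auto simp: L2_UNIV_iff)
  have mT: "?T \<in> measurable (lborel \<Otimes>\<^sub>M lborel) (borel \<Otimes>\<^sub>M borel)" by measurable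
  have "integrable (distr (lborel \<Otimes>\<^sub>M lborel) (borel \<Otimes>\<^sub>M borel) ?T) (\<lambda>z. (A z)\<^sup>2)"
    unfolding D using i by (simp add: lborel_prod)
  from integrable_distr[OF mT this]
  have int: "integrable lborel (\<lambda>z. (A (?T z))\<^sup>2)" by (simp add: lborel_prod)
  have "A \<in> borel_measurable (borel \<Otimes>\<^sub>M borel)" by (simp add: borel_prod)
  from measurable_compose[OF mT this] have "(\<lambda>z. A (?T z)) \<in> borel_measurable borel"
    by (simp add: lborel_prod)
  moreover have "integrable lborel (\<lambda>z. indicator (S \<times> UNIV) z *\<^sub>R (A (?T z))\<^sup>2)"
    using borel_Times[OF S, of "UNIV :: 'a set"] by (intro integrable_mult_indicator int) auto
  ultimately have "(\<lambda>z. A (?T z)) \<in> L2 (S \<times> UNIV)"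
    using borel_Times[OF S, of "UNIV :: 'a set"]
    by (auto simp: L2_def set_borel_measurable_def set_integrable_def
        intro!: borel_measurable_times borel_measurable_indicator)
  then show ?thesis by (simp add: split_beta')
qed


text \<open>A is the time derivative G of u, continued periodically by one period to negative times,
  and B is the source g continued by 0. Integrating the correlation over shifts r in
  \<open>(0, h)\<close> yields the time integral of \<open>(u t - u (t - h), g t)\<close> with times
  modulo T. Since g represents the gradient of the convex energy
  \<open>\<nu> / 2 * grad_inner \<Omega> v v\<close> at u, the integrand is at least the difference
  of the energies at t and \<open>t - h\<close>, and these differences integrate to 0 over a
  period.\<close>

lemma periodic_backward_difference_integral_nonneg:
  fixes u G g :: "real \<Rightarrow> 'a::euclidean_space \<Rightarrow> real" and A B :: "real \<times> 'a \<Rightarrow> real"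
  assumes \<Omega>: "open \<Omega>" and T: "0 < T" and \<nu>: "0 < \<nu>"
    and GL: "(\<lambda>(t, x). G t x) \<in> L2 ({0<..<T} \<times> \<Omega>)"
    and ac: "\<And>w. w \<in> L2 \<Omega> \<Longrightarrow> ac_on T (\<lambda>t. inner_L2 \<Omega> (u t) w) (\<lambda>t. inner_L2 \<Omega> (G t) w)"
    and per: "\<And>w. w \<in> L2 \<Omega> \<Longrightarrow> inner_L2 \<Omega> (u 0) w = inner_L2 \<Omega> (u T) w"
    and gL: "(\<lambda>(t, x). g t x) \<in> L2 ({0<..<T} \<times> \<Omega>)"
    and H: "AE t\<in>{0<..<T} in lborel. u t \<in> H10 \<Omega>"
    and Gr: "(\<lambda>(t, x). Gr t x) \<in> L2 ({0<..<T} \<times> \<Omega>)" "AE t\<in>{0<..<T} in lborel. has_weak_grad \<Omega> (u t) (Gr t)"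
    and eq: "AE t\<in>{0<..<T} in lborel. \<forall>w\<in>H10 \<Omega>. inner_L2 \<Omega> (g t) w = \<nu> * grad_inner \<Omega> (u t) w"
    and h: "0 < h" "h < T"
  defines "A \<equiv> \<lambda>z. indicator ({0<..<T} \<times> \<Omega>) z * G (fst z) (snd z)
      + indicator ({0<..<T} \<times> \<Omega>) ((T, 0) + z) * G (fst ((T, 0) + z)) (snd ((T, 0) + z))"
    and "B \<equiv> \<lambda>z. indicator ({0<..<T} \<times> \<Omega>) z * g (fst z) (snd z)"
  shows "set_integrable lborel {0<..<h} (\<lambda>r. \<integral>z. A ((- r, 0) + z) * B z \<partial>lborel)"
    and "0 \<le> (LINT r:{0<..<h}|lborel. \<integral>z. A ((- r, 0) + z) * B z \<partial>lborel)"
proof -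
  let ?J = "{0<..<T}" and ?M = "lebesgue_in {0<..<h}"
  have \<Omega>': "\<Omega> \<in> sets borel" and J: "?J \<in> sets borel" and Jh: "{0<..<h} \<in> sets borel" using \<Omega> by auto
  have BL: "B \<in> L2 UNIV" unfolding B_def using L2_extend[OF gL] by (simp add: split_beta')
  have G1: "(\<lambda>z. indicator (?J \<times> \<Omega>) z * G (fst z) (snd z)) \<in> L2 UNIV"
    using L2_extend[OF GL] by (simp add: split_beta')
  interpret LU: semi_inner "L2 UNIV" "inner_L2 (UNIV :: (real \<times> 'a) set)" by (rule semi_inner_L2) simp
  have AL: "A \<in> L2 UNIV" unfolding A_def by (rule LU.add_mem[OF G1 L2_translate[OF G1, of "(T, 0)"]])
  interpret P: pair_sigma_finite ?M "lborel :: (real \<times> 'a) measure"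
    using pair_sigma_finite_lebesgue_in[OF Jh, of UNIV] by (simp add: lebesgue_in_UNIV)
  interpret Px: pair_sigma_finite ?M "lborel :: 'a measure"
    using pair_sigma_finite_lebesgue_in[OF Jh, of UNIV] by (simp add: lebesgue_in_UNIV)
  have one: "(\<lambda>r. 1 :: real) \<in> L2 {0<..<h}" by (rule const_L2) auto
  have int: "integrable (?M \<Otimes>\<^sub>M lborel) (\<lambda>(r, z). A ((- r, 0) + z) * B z)"
    using L2_prod_integrable[OF Jh _ L2_translations[OF AL] L2_tensor[OF Jh _ one BL]]
    by (simp add: lebesgue_in_UNIV)
  define L where "L z = (\<integral>r. A ((- r, 0) + z) * B z \<partial>?M)" for z
  have Lint: "integrable lborel L"
    unfolding L_def using P.integrable_snd[OF int] .
  show "set_integrable lborel {0<..<h} (\<lambda>r. \<integral>z. A ((- r, 0) + z) * B z \<partial>lborel)"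
    unfolding set_integrable_restrict[OF Jh] using P.integrable_fst[OF int] .
  \<comment> \<open>The energy is computed from the jointly measurable gradient \<open>Gr\<close>;
    the pointwise choices \<open>wgrad \<Omega> (u t)\<close> come with no measurability in
    t.\<close>
  define Fm where "Fm t = \<nu> / 2 * inner_L2 \<Omega> (Gr t) (Gr t)" for t
  have Fm: "set_integrable lborel ?J Fm"
    unfolding Fm_def using L2_prod_inner(1)[OF J \<Omega>' Gr(1) Gr(1)] by simp
  let ?\<sigma> = "periodic_shift T h"
  have slice: "AE t\<in>?J in lborel. (\<integral>x. L (t, x) \<partial>lborel) = inner_L2 \<Omega> (u t) (g t) - inner_L2 \<Omega> (u (?\<sigma> t)) (g t)"
    using L2_prod_AE[OF J \<Omega>' gL]
  proof eventually_elim
    case (elim t)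
    show ?case
    proof
      assume t: "t \<in> ?J"
      then have w: "g t \<in> L2 \<Omega>" using elim by simp
      have BtL: "(\<lambda>x. B (t, x)) \<in> L2 UNIV"
        using L2_extend[OF w] t by (simp add: B_def indicator_times)
      have itx: "integrable (?M \<Otimes>\<^sub>M lborel) (\<lambda>(r, x). A (t - r, x) * B (t, x))"
        using L2_prod_integrable[OF Jh _ L2_reflect_time[OF AL Jh, of t] L2_tensor[OF Jh _ one BtL]]
        by (simp add: lebesgue_in_UNIV)
      have "(\<integral>x. L (t, x) \<partial>lborel) = (\<integral>x. (\<integral>r. A (t - r, x) * B (t, x) \<partial>?M) \<partial>lborel)"
        by (simp add: L_def)
      also have "\<dots> = (\<integral>r. (\<integral>x. A (t - r, x) * B (t, x) \<partial>lborel) \<partial>?M)"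
        by (rule Px.Fubini_integral[OF itx])
      also have "\<dots> = (LINT r:{0<..<h}|lborel. \<integral>x. A (t - r, x) * B (t, x) \<partial>lborel)"
        by (rule set_lebesgue_integral_restrict[OF Jh, symmetric])
      also have "\<dots> = (LINT r:{0<..<h}|lborel. (if r < t then inner_L2 \<Omega> (G (t - r)) (g t) else inner_L2 \<Omega> (G (t + T - r)) (g t)))"
        unfolding set_lebesgue_integral_def
      proof (rule integral_cong_AE)
        \<comment> \<open>For \<open>r < h < T\<close> exactly one of the two copies of G in A is
          active; at \<open>r = t\<close> both vanish, because the time interval is open.\<close>
        have slices: "(\<integral>x. A (t - r, x) * B (t, x) \<partial>lborel)
            = (if r < t then inner_L2 \<Omega> (G (t - r)) (g t) else inner_L2 \<Omega> (G (t + T - r)) (g t))"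
          if "r \<in> {0<..<h}" "r \<noteq> t" for r
        proof -
          have "A (t - r, x) * B (t, x) = indicator \<Omega> x *\<^sub>R
              (if r < t then G (t - r) x \<bullet> g t x else G (t + T - r) x \<bullet> g t x)" for x
            using that t h by (auto simp: A_def B_def indicator_def add_diff_eq algebra_simps)
          then show ?thesis by (simp add: inner_L2_def set_lebesgue_integral_def)
        qed
        have m1: "(\<lambda>r. indicator {0<..<h} r *\<^sub>R (\<integral>x. A (t - r, x) * B (t, x) \<partial>lborel)) \<in> borel_measurable lborel"
          using borel_measurable_integrable[OF Px.integrable_fst[OF itx]]
          by (simp add: borel_measurable_restrict_space_iff)
        then show "(\<lambda>r. indicator {0<..<h} r *\<^sub>R (\<integral>x. A (t - r, x) * B (t, x) \<partial>lborel)) \<in> borel_measurable lborel" .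
        let ?q = "\<lambda>r. if r < t then inner_L2 \<Omega> (G (t - r)) (g t) else inner_L2 \<Omega> (G (t + T - r)) (g t)"
        have "(\<lambda>r. if r = t then indicator {0<..<h} t *\<^sub>R ?q t else indicator {0<..<h} r *\<^sub>R (\<integral>x. A (t - r, x) * B (t, x) \<partial>lborel))
            \<in> borel_measurable lborel"
          using m1 by measurable
        also have "(\<lambda>r. if r = t then indicator {0<..<h} t *\<^sub>R ?q t else indicator {0<..<h} r *\<^sub>R (\<integral>x. A (t - r, x) * B (t, x) \<partial>lborel))
            = (\<lambda>r. indicator {0<..<h} r *\<^sub>R ?q r)"
          using slices by (auto simp: indicator_def fun_eq_iff)
        finally show "(\<lambda>r. indicator {0<..<h} r *\<^sub>R ?q r) \<in> borel_measurable lborel" .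
        show "AE r in lborel. indicator {0<..<h} r *\<^sub>R (\<integral>x. A (t - r, x) * B (t, x) \<partial>lborel) = indicator {0<..<h} r *\<^sub>R ?q r"
          using AE_lborel_singleton[of t] by eventually_elim (use slices in \<open>auto simp: indicator_def\<close>)
      qed
      also have "\<dots> = inner_L2 \<Omega> (u t) (g t) - inner_L2 \<Omega> (u (?\<sigma> t)) (g t)"
        by (rule ac_on_periodic_increment[OF ac[OF w] per[OF w] h t])
      finally show "(\<integral>x. L (t, x) \<partial>lborel) = inner_L2 \<Omega> (u t) (g t) - inner_L2 \<Omega> (u (?\<sigma> t)) (g t)" .
    qed
  qed
  interpret G: semi_inner "H1 \<Omega>" "grad_inner \<Omega>" by (rule semi_inner_grad[OF \<Omega>])
  have good: "AE t\<in>?J in lborel. u t \<in> H10 \<Omega> \<and> \<nu> / 2 * grad_inner \<Omega> (u t) (u t) = Fm t"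
    using H Gr(2) by eventually_elim (auto simp: Fm_def grad_inner_eq[OF \<Omega>])
  have "AE t\<in>?J in lborel. Fm t - Fm (?\<sigma> t) \<le> (\<integral>x. L (t, x) \<partial>lborel)"
    using slice good AE_periodic_shift[OF good h] eq
  proof eventually_elim
    case (elim t)
    show ?case
    proof
      assume t: "t \<in> ?J"
      then have Ht: "u t \<in> H10 \<Omega>" "u (?\<sigma> t) \<in> H10 \<Omega>" using elim by auto
      have e: "inner_L2 \<Omega> (g t) w = \<nu> * grad_inner \<Omega> (u t) w" if "w \<in> H10 \<Omega>" for w
        using elim t that by blast
      \<comment> \<open>The gradient inequality for a convex quadratic energy is the nonnegativity
        of the energy of the difference.\<close>
      have "0 \<le> grad_inner \<Omega> (\<lambda>x. u t x - u (?\<sigma> t) x) (\<lambda>x. u t x - u (?\<sigma> t) x)"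
        by (intro G.nonneg G.diff_mem H10_H1 Ht)
      then have "2 * grad_inner \<Omega> (u t) (u (?\<sigma> t)) \<le> grad_inner \<Omega> (u t) (u t) + grad_inner \<Omega> (u (?\<sigma> t)) (u (?\<sigma> t))"
        using G.norm_diff_sq[OF Ht[THEN H10_H1]] by simp
      then have "\<nu> / 2 * (2 * grad_inner \<Omega> (u t) (u (?\<sigma> t)))
          \<le> \<nu> / 2 * (grad_inner \<Omega> (u t) (u t) + grad_inner \<Omega> (u (?\<sigma> t)) (u (?\<sigma> t)))"
        using \<nu> by (intro mult_left_mono) auto
      moreover have "(\<integral>x. L (t, x) \<partial>lborel) = \<nu> * grad_inner \<Omega> (u t) (u t) - \<nu> * grad_inner \<Omega> (u t) (u (?\<sigma> t))"
        using elim t e[OF Ht(1)] e[OF Ht(2)] by (simp add: inner_L2_commute)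
      moreover have "Fm t = \<nu> / 2 * grad_inner \<Omega> (u t) (u t)"
        "Fm (?\<sigma> t) = \<nu> / 2 * grad_inner \<Omega> (u (?\<sigma> t)) (u (?\<sigma> t))" using elim t by auto
      ultimately show "Fm t - Fm (?\<sigma> t) \<le> (\<integral>x. L (t, x) \<partial>lborel)" by (simp add: algebra_simps)
    qed
  qed
  then have le: "AE t in lborel. indicator ?J t *\<^sub>R (Fm t - Fm (?\<sigma> t)) \<le> (\<integral>x. L (t, x) \<partial>lborel)"
    by eventually_elim (auto simp: L_def B_def indicator_def)
  have Lint': "integrable (lborel \<Otimes>\<^sub>M lborel) L" using Lint by (simp add: lborel_prod)
  have "(LINT t:?J|lborel. Fm t - Fm (?\<sigma> t)) = 0"
    using Fm LINT_periodic_shift[OF Fm h] by simp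
  moreover have "(LINT t:?J|lborel. Fm t - Fm (?\<sigma> t)) \<le> (\<integral>t. (\<integral>x. L (t, x) \<partial>lborel) \<partial>lborel)"
    unfolding set_lebesgue_integral_def
  proof (rule integral_mono_AE[OF _ _ le])
    show "integrable lborel (\<lambda>t. indicator ?J t *\<^sub>R (Fm t - Fm (?\<sigma> t)))"
      using set_integral_diff(1)[OF Fm LINT_periodic_shift(1)[OF Fm h]] by (simp only: set_integrable_def)
    show "integrable lborel (\<lambda>t. \<integral>x. L (t, x) \<partial>lborel)" by (rule lborel_pair.integrable_fst'[OF Lint'])
  qed
  ultimately have "0 \<le> (\<integral>z. L z \<partial>lborel)"
    using lborel_pair.integral_fst'[OF Lint'] by (simp add: lborel_prod)
  also have "\<dots> = (LINT r:{0<..<h}|lborel. \<integral>z. A ((- r, 0) + z) * B z \<partial>lborel)"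
    unfolding L_def set_lebesgue_integral_restrict[OF Jh] by (rule P.Fubini_integral[OF int])
  finally show "0 \<le> (LINT r:{0<..<h}|lborel. \<integral>z. A ((- r, 0) + z) * B z \<partial>lborel)" .
qed

text \<open>Formally \<open>(u\<^sub>t, -\<Delta> u)\<close> is the time derivative of a periodic function. As \<open>u\<^sub>t\<close> need not lie in
  \<open>H\<^sup>1\<^sub>0\<close>, the argument is carried out for backward difference quotients, which give one inequality
  by convexity of \<open>grad_inner\<close>; they converge by continuity of translations in \<open>L\<^sup>2\<close>.\<close>

lemma time_deriv_source_nonneg:
  fixes u G g :: "real \<Rightarrow> 'a::euclidean_space \<Rightarrow> real"
  assumes \<Omega>: "open \<Omega>" and T: "0 < T" and \<nu>: "0 < \<nu>"
    and GL: "(\<lambda>(t, x). G t x) \<in> L2 ({0<..<T} \<times> \<Omega>)"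
    and ac: "\<And>w. w \<in> L2 \<Omega> \<Longrightarrow> ac_on T (\<lambda>t. inner_L2 \<Omega> (u t) w) (\<lambda>t. inner_L2 \<Omega> (G t) w)"
    and per: "\<And>w. w \<in> L2 \<Omega> \<Longrightarrow> inner_L2 \<Omega> (u 0) w = inner_L2 \<Omega> (u T) w"
    and gL: "(\<lambda>(t, x). g t x) \<in> L2 ({0<..<T} \<times> \<Omega>)"
    and H: "AE t\<in>{0<..<T} in lborel. u t \<in> H10 \<Omega>"
    and Gr: "(\<lambda>(t, x). Gr t x) \<in> L2 ({0<..<T} \<times> \<Omega>)" "AE t\<in>{0<..<T} in lborel. has_weak_grad \<Omega> (u t) (Gr t)"
    and eq: "AE t\<in>{0<..<T} in lborel. \<forall>w\<in>H10 \<Omega>. inner_L2 \<Omega> (g t) w = \<nu> * grad_inner \<Omega> (u t) w"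
  shows "0 \<le> (LINT t:{0<..<T}|lborel. inner_L2 \<Omega> (G t) (g t))"
proof -
  let ?J = "{0<..<T}"
  have \<Omega>': "\<Omega> \<in> sets borel" and J: "?J \<in> sets borel" using \<Omega> by auto
  define A where "A = (\<lambda>z. indicator (?J \<times> \<Omega>) z * G (fst z) (snd z)
      + indicator (?J \<times> \<Omega>) ((T, 0) + z) * G (fst ((T, 0) + z)) (snd ((T, 0) + z)))"
  define B where "B = (\<lambda>z. indicator (?J \<times> \<Omega>) z * g (fst z) (snd z))"
  define \<Phi> where "\<Phi> r = (\<integral>z. A ((- r, 0) + z) * B z \<partial>lborel)" for r
  have key: "set_integrable lborel {0<..<h} \<Phi>" "0 \<le> (LINT r:{0<..<h}|lborel. \<Phi> r)"
    if "0 < h" "h < T" for h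
    unfolding \<Phi>_def[abs_def] A_def B_def
    by (rule periodic_backward_difference_integral_nonneg[OF \<Omega> T \<nu> GL ac per gL H Gr eq that]; assumption)+
  \<comment> \<open>A function with nonnegative integral over \<open>(0, h)\<close> is nonnegative
    somewhere in it. This produces a sequence of shifts tending to 0, and one such sequence suffices
    for the limit.\<close>
  have ex: "\<exists>r. 0 < r \<and> r < h \<and> 0 \<le> \<Phi> r" if h: "0 < h" "h < T" for h
  proof (rule ccontr)
    assume "\<nexists>r. 0 < r \<and> r < h \<and> 0 \<le> \<Phi> r"
    then have neg: "\<Phi> r < 0" if "r \<in> {0<..<h}" for r using that by force
    have i: "integrable lborel (\<lambda>r. indicator {0<..<h} r *\<^sub>R - \<Phi> r)"
      using key(1)[OF h] by (simp add: set_integrable_def)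
    have "(\<integral>r. indicator {0<..<h} r *\<^sub>R - \<Phi> r \<partial>lborel) \<le> 0"
      using key(2)[OF h] by (simp add: set_lebesgue_integral_def)
    moreover have "0 \<le> (\<integral>r. indicator {0<..<h} r *\<^sub>R - \<Phi> r \<partial>lborel)"
      by (rule integral_nonneg_AE) (use neg in \<open>auto simp: indicator_def less_imp_le\<close>)
    ultimately have "AE r in lborel. indicator {0<..<h} r *\<^sub>R - \<Phi> r = 0"
      using integral_nonneg_eq_0_iff_AE[OF i] neg by (auto simp: indicator_def less_imp_le)
    \<comment> \<open>A strictly negative function with nonnegative integral would make the interval
      null; the constants 0 and 1 turn this into a case of
      \<open>continuous_AE_const\<close>.\<close>
    then have "AE r\<in>{0<..<h} in lborel. (\<lambda>_. 0) r = (1::real)"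
      by eventually_elim (use neg in force)
    from continuous_AE_const[OF h(1) continuous_on_const this, of 0] h show False by simp
  qed
  define h where "h n = min (T / 2) (1 / Suc n)" for n
  have "0 < h n" "h n < T" for n using T by (auto simp: h_def min_less_iff_disj)
  then have "\<forall>n. \<exists>r. 0 < r \<and> r < h n \<and> 0 \<le> \<Phi> r" using ex by blast
  then obtain r where r: "\<And>n. 0 < r n" "\<And>n. r n < h n" "\<And>n. 0 \<le> \<Phi> (r n)" by metis
  have r1: "r n \<le> 1 / Suc n" for n using r(2)[of n] by (simp add: h_def)
  have r2: "r n \<le> 1" for n using r1[of n] by (rule order_trans) simp
  have "r \<longlonglongrightarrow> 0"
    by (rule tendsto_sandwich[OF _ _ tendsto_const LIMSEQ_Suc[OF lim_1_over_n]])
       (use r(1) r1 in \<open>auto intro!: always_eventually less_imp_le simp del: of_nat_Suc\<close>)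
  then have "(\<lambda>n. (- r n, 0 :: 'a)) \<longlonglongrightarrow> (- 0, 0)" by (intro tendsto_intros)
  then have z: "(\<lambda>n. (- r n, 0 :: 'a)) \<longlonglongrightarrow> 0" by (simp add: zero_prod_def)
  have BL: "B \<in> L2 UNIV" unfolding B_def using L2_extend[OF gL] by (simp add: split_beta')
  have G1: "(\<lambda>z. indicator (?J \<times> \<Omega>) z * G (fst z) (snd z)) \<in> L2 UNIV"
    using L2_extend[OF GL] by (simp add: split_beta')
  interpret LU: semi_inner "L2 UNIV" "inner_L2 (UNIV :: (real \<times> 'a) set)" by (rule semi_inner_L2) simp
  have AL: "A \<in> L2 UNIV" unfolding A_def by (rule LU.add_mem[OF G1 L2_translate[OF G1, of "(T, 0)"]])
  have "(\<lambda>n. \<Phi> (r n)) \<longlonglongrightarrow> (\<integral>z. A z * B z \<partial>lborel)"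
    unfolding \<Phi>_def
    by (rule L2_correlation_tendsto[OF AL BL z]) (use r(1) r2 in \<open>auto simp: norm_Pair less_imp_le\<close>)
  then have "0 \<le> (\<integral>z. A z * B z \<partial>lborel)" using r(3) by (intro LIMSEQ_le_const) auto
  \<comment> \<open>Without a shift the second copy in A lives at negative times, where B
    vanishes.\<close>
  also have "\<dots> = (\<integral>z. indicator (?J \<times> \<Omega>) z *\<^sub>R (G (fst z) (snd z) \<bullet> g (fst z) (snd z)) \<partial>lborel)"
    by (intro Bochner_Integration.integral_cong) (auto simp: A_def B_def indicator_def)
  also have "\<dots> = (LINT t:?J|lborel. inner_L2 \<Omega> (G t) (g t))"
    using L2_prod_inner(2)[OF J \<Omega>' GL gL] by (simp add: inner_L2_def set_lebesgue_integral_def split_beta')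
  finally show ?thesis .
qed

section \<open>Orthonormal bases of finite-dimensional spaces\<close>

context semi_inner
begin

definition orthonormal :: "('a \<Rightarrow> real) set \<Rightarrow> bool" where
  "orthonormal E \<longleftrightarrow> finite E \<and> E \<subseteq> V \<and> (\<forall>b\<in>E. \<forall>c\<in>E. q b c = (if b = c then 1 else 0))"

text \<open>For a semi-inner product a basis cannot be expected to reproduce a vector exactly;
  spanning is expressed by the residual being a null vector.\<close>

definition residual :: "('a \<Rightarrow> real) set \<Rightarrow> ('a \<Rightarrow> real) \<Rightarrow> 'a \<Rightarrow> real" where
  "residual E v x = v x - (\<Sum>b\<in>E. q v b * b x)"

lemma expansion_mem: "orthonormal E \<Longrightarrow> (\<lambda>x. \<Sum>b\<in>E. c b * b x) \<in> V"
  by (rule sum_mem) (auto simp: orthonormal_def)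

lemma residual_mem: "orthonormal E \<Longrightarrow> v \<in> V \<Longrightarrow> residual E v \<in> V"
  unfolding residual_def[abs_def] by (intro diff_mem expansion_mem)

lemma expansion_inner:
  assumes E: "orthonormal E" and b: "b \<in> E"
  shows "q (\<lambda>x. \<Sum>e\<in>E. c e * e x) b = c b"
proof -
  have "q (\<lambda>x. \<Sum>e\<in>E. c e * e x) b = (\<Sum>e\<in>E. c e * q e b)"
    using E b by (intro sum_left) (auto simp: orthonormal_def)
  also have "\<dots> = (\<Sum>e\<in>E. if e = b then c b else 0)"
    using E b by (intro sum.cong) (auto simp: orthonormal_def)
  finally show ?thesis using E b by (simp add: orthonormal_def)
qed

lemma residual_orthogonal:
  assumes E: "orthonormal E" and v: "v \<in> V" and b: "b \<in> E"
  shows "q (residual E v) b = 0"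
proof -
  have "b \<in> V" using E b by (auto simp: orthonormal_def)
  then show ?thesis
    unfolding residual_def[abs_def] using diff_left[OF v expansion_mem[OF E] \<open>b \<in> V\<close>] expansion_inner[OF E b] by simp
qed

lemma residual_norm:
  assumes E: "orthonormal E" and v: "v \<in> V"
  shows "q (residual E v) (residual E v) = q v v - (\<Sum>b\<in>E. (q v b)\<^sup>2)"
proof -
  let ?s = "\<lambda>x. \<Sum>b\<in>E. q v b * b x"
  note s = expansion_mem[OF E, of "q v"]
  have sub: "\<And>b. b \<in> E \<Longrightarrow> b \<in> V" using E by (auto simp: orthonormal_def)
  have "q v ?s = (\<Sum>b\<in>E. q v b * q v b)" by (rule sum_right[OF sub v])
  moreover have "q ?s ?s = (\<Sum>b\<in>E. q v b * q ?s b)" by (rule sum_right[OF sub s])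
  ultimately show ?thesis
    unfolding residual_def[abs_def] norm_diff_sq[OF v s]
    by (simp add: expansion_inner[OF E] power2_eq_square)
qed

lemma Bessel: "orthonormal E \<Longrightarrow> v \<in> V \<Longrightarrow> (\<Sum>b\<in>E. (q v b)\<^sup>2) \<le> q v v"
  using residual_norm[of E v] nonneg[OF residual_mem[of E v]] by simp

lemma null_lin:
  assumes "v \<in> V" "w \<in> V" "q v v = 0" "q w w = 0"
  shows "q (\<lambda>x. a * v x + b * w x) (\<lambda>x. a * v x + b * w x) = 0"
  using assms lin[of v w _ a b] lin_right[of v w _ a b] lin_mem[of v w a b] null_left[of v w] null_left[of w v]
  by simp

lemma residual_lin:
  assumes E: "orthonormal E" and v: "v \<in> V" and w: "w \<in> V"
  shows "residual E (\<lambda>x. a * v x + b * w x) = (\<lambda>x. a * residual E v x + b * residual E w x)"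
proof
  fix x
  have "(\<Sum>e\<in>E. q (\<lambda>x. a * v x + b * w x) e * e x) = (\<Sum>e\<in>E. a * (q v e * e x) + b * (q w e * e x))"
    using E by (intro sum.cong) (auto simp: orthonormal_def lin[OF v w] subset_iff algebra_simps)
  then show "residual E (\<lambda>x. a * v x + b * w x) x = a * residual E v x + b * residual E w x"
    by (simp add: residual_def sum.distrib sum_distrib_left[symmetric] algebra_simps)
qed

text \<open>A new generator either has a null residual, and the family stays, or contributes its
  normalised residual. The conclusion speaks of coefficient functions because that is how
  \<open>finite_dim_subspace\<close> presents its elements.\<close>

lemma Gram_Schmidt:
  assumes "finite B" "B \<subseteq> V"
  shows "\<exists>E. orthonormal E \<and> (\<forall>c. let v = (\<lambda>x. \<Sum>b\<in>B. c b * b x) in q (residual E v) (residual E v) = 0)"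
  using assms
proof (induction B rule: finite_induct)
  case empty
  show ?case
    by (rule exI[of _ "{}"]) (simp add: orthonormal_def residual_def[abs_def] zero_left zero_mem)
next
  case (insert y B)
  then obtain E where E: "orthonormal E"
    and null: "\<And>c. q (residual E (\<lambda>x. \<Sum>b\<in>B. c b * b x)) (residual E (\<lambda>x. \<Sum>b\<in>B. c b * b x)) = 0"
    by (auto simp: Let_def)
  have y: "y \<in> V" and B: "\<And>b. b \<in> B \<Longrightarrow> b \<in> V" using insert.prems by auto
  have sub: "\<And>b. b \<in> E \<Longrightarrow> b \<in> V" using E by (auto simp: orthonormal_def)
  define r where "r = residual E y"
  have r: "r \<in> V" unfolding r_def by (rule residual_mem[OF E y])
  define w where "w c x = (\<Sum>b\<in>B. c b * b x)" for c x
  have w: "w c \<in> V" for c unfolding w_def by (rule sum_mem[OF B])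
  have split: "(\<lambda>x. \<Sum>b\<in>insert y B. c b * b x) = (\<lambda>x. 1 * w c x + c y * y x)" for c
    using insert.hyps by (auto simp: w_def)
  have res: "residual E (\<lambda>x. \<Sum>b\<in>insert y B. c b * b x) = (\<lambda>x. 1 * residual E (w c) x + c y * r x)" for c
    unfolding split r_def by (rule residual_lin[OF E w y])
  have nw: "q (residual E (w c)) (residual E (w c)) = 0" for c
    unfolding w_def by (rule null)
  show ?case
  proof (cases "q r r = 0")
    case True
    then have "q (residual E (\<lambda>x. \<Sum>b\<in>insert y B. c b * b x)) (residual E (\<lambda>x. \<Sum>b\<in>insert y B. c b * b x)) = 0" for c
      unfolding res by (intro null_lin residual_mem[OF E w] r nw)
    then show ?thesis using E by (intro exI[of _ E]) (simp add: Let_def)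
  next
    case False
    define s where "s = sqrt (q r r)"
    have s: "0 < s" "s * s = q r r" using False nonneg[OF r] by (auto simp: s_def)
    define n where "n x = (1 / s) * r x" for x
    have n: "n \<in> V" unfolding n_def by (rule scale_mem[OF r])
    have re: "q r e = 0" if "e \<in> E" for e unfolding r_def by (rule residual_orthogonal[OF E y that])
    have ne: "q n e = 0" if "e \<in> E" for e
      using scale_left[OF r sub[OF that], of "1 / s"] re[OF that] by (simp add: n_def[abs_def])
    have "q r n = 1 / s * q r r" unfolding n_def[abs_def] by (rule scale_right[OF r r])
    then have rn: "q r n = s" using s(1) by (simp add: s(2)[symmetric])
    have nn: "q n n = 1"
      using scale_left[OF r n, of "1 / s"] rn s by (simp add: n_def[abs_def])
    have nE: "n \<notin> E" using ne[of n] nn by auto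
    have en: "q e n = 0" if "e \<in> E" for e using ne[OF that] sym[OF n sub[OF that]] by simp
    have E': "orthonormal (insert n E)"
      unfolding orthonormal_def
    proof (intro conjI ballI)
      fix b c assume "b \<in> insert n E" "c \<in> insert n E"
      then consider "b = n" "c = n" | "b = n" "c \<in> E" | "b \<in> E" "c = n" | "b \<in> E" "c \<in> E" by blast
      then show "q b c = (if b = c then 1 else 0)"
      proof cases
        case 2 then show ?thesis using nE ne[of c] by metis
      next
        case 3 then show ?thesis using nE en[of b] by metis
      next
        case 4 then show ?thesis using E unfolding orthonormal_def by blast
      qed (simp add: nn)
    qed (use E n in \<open>auto simp: orthonormal_def\<close>)
    \<comment> \<open>The new vector n removes exactly the contribution \<open>c y * r\<close> of
      the new generator, leaving the residual of the old combination.\<close>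
    have "residual (insert n E) (\<lambda>x. \<Sum>b\<in>insert y B. c b * b x) = residual E (w c)" for c
    proof
      fix x
      let ?v = "\<lambda>x. \<Sum>b\<in>insert y B. c b * b x"
      have v: "?v \<in> V" by (rule sum_mem) (use y B in auto)
      note re' = residual_mem[OF E v]
      have "q (residual E ?v) n = q ?v n - q (\<lambda>x. \<Sum>e\<in>E. q ?v e * e x) n"
        unfolding residual_def[abs_def] by (rule diff_left[OF v expansion_mem[OF E] n])
      also have "q (\<lambda>x. \<Sum>e\<in>E. q ?v e * e x) n = (\<Sum>e\<in>E. q ?v e * q e n)"
        by (rule sum_left[OF sub n])
      also have "\<dots> = 0" using en by (intro sum.neutral) simp
      finally have "q ?v n = q (residual E ?v) n" by simp
      also have "\<dots> = q (residual E (w c)) n + c y * q r n"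
        unfolding res using lin[OF residual_mem[OF E w] r n, of 1] by simp
      also have "\<dots> = c y * s" using null_left[OF residual_mem[OF E w] n nw] rn by simp
      finally have qn: "q ?v n = c y * s" .
      have "residual (insert n E) ?v x = residual E ?v x - q ?v n * n x"
        using E nE by (simp add: residual_def orthonormal_def)
      also have "\<dots> = residual E (w c) x"
        unfolding res qn using s by (simp add: n_def)
      finally show "residual (insert n E) ?v x = residual E (w c) x" .
    qed
    then show ?thesis using E' nw by (intro exI[of _ "insert n E"]) (simp add: Let_def)
  qed
qed

lemma exists_orthonormal_basis:
  assumes "finite_dim_subspace V"
  shows "\<exists>E. orthonormal E \<and> (\<forall>v\<in>V. q (residual E v) (residual E v) = 0)"
proof -
  obtain B where B: "finite B" "V = {v. \<exists>c. v = (\<lambda>x. \<Sum>b\<in>B. c b * b x)}"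
    using assms by (auto simp: finite_dim_subspace_def)
  have "B \<subseteq> V"
  proof
    fix b assume "b \<in> B"
    then have "b = (\<lambda>x. \<Sum>a\<in>B. (if a = b then 1 else 0) * a x)"
      using B(1) by (auto simp: if_distrib[of "\<lambda>z. z * _"] cong: if_cong)
    then show "b \<in> V" unfolding B(2) mem_Collect_eq by (rule exI[of _ "\<lambda>a. if a = b then 1 else 0"])
  qed
  from Gram_Schmidt[OF B(1) this] obtain E where E: "orthonormal E"
    "\<And>c. q (residual E (\<lambda>x. \<Sum>b\<in>B. c b * b x)) (residual E (\<lambda>x. \<Sum>b\<in>B. c b * b x)) = 0"
    by (auto simp: Let_def)
  have "q (residual E v) (residual E v) = 0" if "v \<in> V" for v
  proof -
    have "\<exists>c. v = (\<lambda>x. \<Sum>b\<in>B. c b * b x)" using that unfolding B(2) by (rule CollectD)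
    then show ?thesis using E(2) by fastforce
  qed
  then show ?thesis using E(1) by blast
qed

lemma Parseval:
  assumes E: "orthonormal E" and null: "q (residual E v) (residual E v) = 0" and v: "v \<in> V" and w: "w \<in> V"
  shows "q v w = (\<Sum>b\<in>E. q v b * q b w)"
proof -
  have "0 = q (residual E v) w" by (rule null_left[OF residual_mem[OF E v] w null, symmetric])
  also have "\<dots> = q v w - q (\<lambda>x. \<Sum>b\<in>E. q v b * b x) w"
    unfolding residual_def[abs_def] by (rule diff_left[OF v expansion_mem[OF E] w])
  also have "q (\<lambda>x. \<Sum>b\<in>E. q v b * b x) w = (\<Sum>b\<in>E. q v b * q b w)"
    using E w by (intro sum_left) (auto simp: orthonormal_def)
  finally show ?thesis by simp
qed

end

section \<open>Galerkin spaces\<close>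

lemma finite_dim_subspace_lin:
  assumes "finite_dim_subspace S" "v \<in> S" "w \<in> S"
  shows "(\<lambda>x. a * v x + b * w x) \<in> S"
proof -
  obtain B where B: "S = {v. \<exists>c. v = (\<lambda>x. \<Sum>b\<in>B. c b * b x)}"
    using assms(1) by (auto simp: finite_dim_subspace_def)
  obtain c d where "v = (\<lambda>x. \<Sum>b\<in>B. c b * b x)" "w = (\<lambda>x. \<Sum>b\<in>B. d b * b x)" using assms(2,3) B by auto
  then have "(\<lambda>x. a * v x + b * w x) = (\<lambda>x. \<Sum>e\<in>B. (a * c e + b * d e) * e x)"
    by (auto simp: sum.distrib sum_distrib_left algebra_simps)
  then show ?thesis unfolding B mem_Collect_eq by (rule exI[of _ "\<lambda>e. a * c e + b * d e"])
qed

lemma finite_dim_subspace_zero: "finite_dim_subspace S \<Longrightarrow> (\<lambda>x. 0) \<in> S"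
  by (auto simp: finite_dim_subspace_def intro!: exI[of _ "\<lambda>_. 0"])

locale galerkin =
  fixes \<Omega> :: "'a::euclidean_space set" and S :: "('a \<Rightarrow> real) set"
  assumes open_\<Omega>: "open \<Omega>" and bounded_\<Omega>: "bounded \<Omega>"
    and fin_dim: "finite_dim_subspace S" and S_H10: "S \<subseteq> H10 \<Omega>"
begin

lemma borel_\<Omega>: "\<Omega> \<in> sets borel"
  using open_\<Omega> by simp

sublocale L: semi_inner "L2 \<Omega>" "inner_L2 \<Omega>"
  by (rule semi_inner_L2[OF borel_\<Omega>])

sublocale G: semi_inner "H10 \<Omega>" "grad_inner \<Omega>"
  by (rule semi_inner_H10_grad[OF open_\<Omega>])

sublocale SL: semi_inner S "inner_L2 \<Omega>"
  by (rule semi_inner_subset[OF semi_inner_H10_L2[OF open_\<Omega>] S_H10])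
     (auto intro: finite_dim_subspace_zero finite_dim_subspace_lin fin_dim)

sublocale SG: semi_inner S "grad_inner \<Omega>"
  by (rule semi_inner_subset[OF semi_inner_H10_grad[OF open_\<Omega>] S_H10])
     (auto intro: finite_dim_subspace_zero finite_dim_subspace_lin fin_dim)

lemma S_L2: "v \<in> S \<Longrightarrow> v \<in> L2 \<Omega>"
  using S_H10 H10_L2 by blast

lemma S_in_H10: "v \<in> S \<Longrightarrow> v \<in> H10 \<Omega>"
  using S_H10 by blast

text \<open>An L2-null function is 0 almost everywhere, and so is its weak gradient. With
  \<open>grad_null_L2_null\<close> this identifies the null vectors of the two forms, so a residual
  that is null for one may be dropped in the other.\<close>

lemma L2_null_grad_null:
  assumes v: "v \<in> H10 \<Omega>" and w: "w \<in> H10 \<Omega>" and null: "inner_L2 \<Omega> v v = 0"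
  shows "grad_inner \<Omega> v w = 0"
proof -
  have "AE x\<in>\<Omega> in lborel. v x = 0" by (rule inner_L2_eq_0_AE[OF borel_\<Omega> H10_L2[OF v] null])
  then have "AE x\<in>\<Omega> in lborel. wgrad \<Omega> v x = wgrad \<Omega> (\<lambda>x. 0) x"
    by (intro H10_grad_cong_AE[OF open_\<Omega> v G.zero_mem]) auto
  then have "grad_inner \<Omega> v w = grad_inner \<Omega> (\<lambda>x. 0) w"
    unfolding grad_inner_def
    by (intro inner_L2_cong_AE[OF borel_\<Omega>] wgrad_L2 H10_H1 v w G.zero_mem) auto
  then show ?thesis using G.zero_left[OF w] by simp
qed

lemma grad_null_L2_null:
  assumes v: "v \<in> H10 \<Omega>" and w: "w \<in> L2 \<Omega>" and null: "grad_inner \<Omega> v v = 0"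
  shows "inner_L2 \<Omega> v w = 0"
proof -
  have "AE x\<in>\<Omega> in lborel. v x = 0" by (rule H10_grad_null_AE[OF open_\<Omega> bounded_\<Omega> v null])
  then have "inner_L2 \<Omega> v w = inner_L2 \<Omega> (\<lambda>x. 0) w"
    by (intro inner_L2_cong_AE[OF borel_\<Omega>] H10_L2 v w L.zero_mem) auto
  then show ?thesis using L.zero_left[OF w] by simp
qed

definition L_basis :: "('a \<Rightarrow> real) set" where
  "L_basis = (SOME E. SL.orthonormal E \<and> (\<forall>v\<in>S. inner_L2 \<Omega> (SL.residual E v) (SL.residual E v) = 0))"

definition G_basis :: "('a \<Rightarrow> real) set" where
  "G_basis = (SOME E. SG.orthonormal E \<and> (\<forall>v\<in>S. grad_inner \<Omega> (SG.residual E v) (SG.residual E v) = 0))"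

lemma L_basis: "SL.orthonormal L_basis" "v \<in> S \<Longrightarrow> inner_L2 \<Omega> (SL.residual L_basis v) (SL.residual L_basis v) = 0"
  using someI_ex[OF SL.exists_orthonormal_basis[OF fin_dim]] unfolding L_basis_def by blast+

lemma G_basis: "SG.orthonormal G_basis" "v \<in> S \<Longrightarrow> grad_inner \<Omega> (SG.residual G_basis v) (SG.residual G_basis v) = 0"
  using someI_ex[OF SG.exists_orthonormal_basis[OF fin_dim]] unfolding G_basis_def by blast+

lemma L_basis_S: "b \<in> L_basis \<Longrightarrow> b \<in> S" and finite_L_basis: "finite L_basis"
  using L_basis(1) by (auto simp: SL.orthonormal_def)

lemma G_basis_S: "b \<in> G_basis \<Longrightarrow> b \<in> S" and finite_G_basis: "finite G_basis"
  using G_basis(1) by (auto simp: SG.orthonormal_def)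

lemma L_basis_orthonormal: "L.orthonormal L_basis"
  using L_basis(1) S_L2 by (auto simp: SL.orthonormal_def L.orthonormal_def)

lemma L_Parseval: "v \<in> S \<Longrightarrow> w \<in> S \<Longrightarrow> inner_L2 \<Omega> v w = (\<Sum>b\<in>L_basis. inner_L2 \<Omega> v b * inner_L2 \<Omega> b w)"
  by (rule SL.Parseval[OF L_basis(1) L_basis(2)])

lemma G_Parseval: "v \<in> S \<Longrightarrow> w \<in> S \<Longrightarrow> grad_inner \<Omega> v w = (\<Sum>b\<in>G_basis. grad_inner \<Omega> v b * grad_inner \<Omega> b w)"
  by (rule SG.Parseval[OF G_basis(1) G_basis(2)])

lemma grad_inner_L_expansion:
  assumes v: "v \<in> S" and w: "w \<in> H10 \<Omega>"
  shows "grad_inner \<Omega> v w = (\<Sum>b\<in>L_basis. inner_L2 \<Omega> v b * grad_inner \<Omega> b w)"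
proof -
  have "0 = grad_inner \<Omega> (SL.residual L_basis v) w"
    by (rule L2_null_grad_null[symmetric, OF S_in_H10[OF SL.residual_mem[OF L_basis(1) v]] w L_basis(2)[OF v]])
  also have "\<dots> = grad_inner \<Omega> v w - grad_inner \<Omega> (\<lambda>x. \<Sum>b\<in>L_basis. inner_L2 \<Omega> v b * b x) w"
    unfolding SL.residual_def[abs_def]
    by (rule G.diff_left[OF S_in_H10[OF v] S_in_H10[OF SL.expansion_mem[OF L_basis(1)]] w])
  also have "grad_inner \<Omega> (\<lambda>x. \<Sum>b\<in>L_basis. inner_L2 \<Omega> v b * b x) w = (\<Sum>b\<in>L_basis. inner_L2 \<Omega> v b * grad_inner \<Omega> b w)"
    by (rule G.sum_left[OF S_in_H10[OF L_basis_S] w])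
  finally show ?thesis by simp
qed

lemma inner_L2_L_expansion:
  assumes w: "w \<in> L2 \<Omega>" and v: "v \<in> S"
  shows "inner_L2 \<Omega> w v = (\<Sum>b\<in>L_basis. inner_L2 \<Omega> w b * inner_L2 \<Omega> b v)"
proof -
  have res: "SL.residual L_basis v \<in> L2 \<Omega>" by (rule S_L2[OF SL.residual_mem[OF L_basis(1) v]])
  have "0 = inner_L2 \<Omega> (SL.residual L_basis v) w"
    by (rule L.null_left[OF res w L_basis(2)[OF v], symmetric])
  also have "\<dots> = inner_L2 \<Omega> v w - inner_L2 \<Omega> (\<lambda>x. \<Sum>b\<in>L_basis. inner_L2 \<Omega> v b * b x) w"
    unfolding SL.residual_def[abs_def]
    by (rule L.diff_left[OF S_L2[OF v] S_L2[OF SL.expansion_mem[OF L_basis(1)]] w])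
  also have "inner_L2 \<Omega> (\<lambda>x. \<Sum>b\<in>L_basis. inner_L2 \<Omega> v b * b x) w = (\<Sum>b\<in>L_basis. inner_L2 \<Omega> v b * inner_L2 \<Omega> b w)"
    by (rule L.sum_left[OF S_L2[OF L_basis_S] w])
  finally show ?thesis
    by (simp add: inner_L2_commute[of \<Omega> w] inner_L2_commute[of \<Omega> _ v] mult.commute)
qed

text \<open>A mixed expansion: the coefficients of v come from the Dirichlet form, but the pairing
  is in L2 and w is arbitrary there. This fits an equation that determines the Dirichlet
  coefficients of v.\<close>

lemma inner_L2_G_expansion:
  assumes v: "v \<in> S" and w: "w \<in> L2 \<Omega>"
  shows "inner_L2 \<Omega> v w = (\<Sum>b\<in>G_basis. grad_inner \<Omega> v b * inner_L2 \<Omega> b w)"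
proof -
  have "0 = inner_L2 \<Omega> (SG.residual G_basis v) w"
    by (rule grad_null_L2_null[symmetric, OF S_in_H10[OF SG.residual_mem[OF G_basis(1) v]] w G_basis(2)[OF v]])
  also have "\<dots> = inner_L2 \<Omega> v w - inner_L2 \<Omega> (\<lambda>x. \<Sum>b\<in>G_basis. grad_inner \<Omega> v b * b x) w"
    unfolding SG.residual_def[abs_def]
    by (rule L.diff_left[OF S_L2[OF v] S_L2[OF SG.expansion_mem[OF G_basis(1)]] w])
  also have "inner_L2 \<Omega> (\<lambda>x. \<Sum>b\<in>G_basis. grad_inner \<Omega> v b * b x) w = (\<Sum>b\<in>G_basis. grad_inner \<Omega> v b * inner_L2 \<Omega> b w)"
    by (rule L.sum_left[OF S_L2[OF G_basis_S] w])
  finally show ?thesis by simp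
qed

text \<open>The L2 representative in S of the functional \<open>grad_inner \<Omega> v w\<close> of
  v, that is, the negative discrete Laplacian of w. It rewrites Dirichlet pairings as L2 pairings,
  whose absolute continuity in time is known.\<close>

definition riesz :: "('a \<Rightarrow> real) \<Rightarrow> 'a \<Rightarrow> real" where
  "riesz w x = (\<Sum>b\<in>L_basis. grad_inner \<Omega> w b * b x)"

lemma riesz_mem: "riesz w \<in> S"
  unfolding riesz_def[abs_def] by (rule SL.expansion_mem[OF L_basis(1)])

lemma riesz_inner:
  assumes v: "v \<in> S" and w: "w \<in> H10 \<Omega>"
  shows "inner_L2 \<Omega> v (riesz w) = grad_inner \<Omega> v w"
proof -
  have "inner_L2 \<Omega> v (riesz w) = (\<Sum>b\<in>L_basis. grad_inner \<Omega> w b * inner_L2 \<Omega> v b)"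
    unfolding riesz_def[abs_def] by (rule SL.sum_right[OF L_basis_S v])
  also have "\<dots> = (\<Sum>b\<in>L_basis. inner_L2 \<Omega> v b * grad_inner \<Omega> b w)"
    using w by (intro sum.cong) (auto simp: G.sym[OF w S_in_H10[OF L_basis_S]])
  finally show ?thesis using grad_inner_L_expansion[OF v w] by simp
qed

text \<open>Cauchy-Schwarz in the mixed expansion of \<open>(v, v)\<close>, then Bessel for the
  Dirichlet coefficients and Cauchy-Schwarz for the L2 ones; K is the sum of the squared L2 norms of
  the basis. The added 1 makes the constant positive even for an empty basis.\<close>

lemma Poincare:
  obtains K where "0 < K" "\<And>v. v \<in> S \<Longrightarrow> inner_L2 \<Omega> v v \<le> K * grad_inner \<Omega> v v"
proof
  let ?n = "\<lambda>b. inner_L2 \<Omega> b b" and ?K = "\<Sum>b\<in>G_basis. inner_L2 \<Omega> b b"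
  have K: "0 \<le> ?K" by (intro sum_nonneg inner_L2_nonneg)
  then show "0 < 1 + ?K" by simp
  fix v assume v: "v \<in> S"
  have "inner_L2 \<Omega> v v = (\<Sum>b\<in>G_basis. grad_inner \<Omega> v b * inner_L2 \<Omega> b v)"
    by (rule inner_L2_G_expansion[OF v S_L2[OF v]])
  then have "(inner_L2 \<Omega> v v)\<^sup>2 \<le> (\<Sum>b\<in>G_basis. (grad_inner \<Omega> v b)\<^sup>2) * (\<Sum>b\<in>G_basis. (inner_L2 \<Omega> b v)\<^sup>2)"
    by (simp only: Cauchy_Schwarz_ineq_sum)
  also have "\<dots> \<le> grad_inner \<Omega> v v * (?K * inner_L2 \<Omega> v v)"
  proof (rule mult_mono)
    show "(\<Sum>b\<in>G_basis. (grad_inner \<Omega> v b)\<^sup>2) \<le> grad_inner \<Omega> v v" by (rule SG.Bessel[OF G_basis(1) v])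
    show "(\<Sum>b\<in>G_basis. (inner_L2 \<Omega> b v)\<^sup>2) \<le> ?K * inner_L2 \<Omega> v v"
      unfolding sum_distrib_right using v G_basis_S by (intro sum_mono SL.Cauchy_Schwarz) auto
  qed (auto intro: sum_nonneg SG.nonneg v)
  finally have "inner_L2 \<Omega> v v * inner_L2 \<Omega> v v \<le> inner_L2 \<Omega> v v * (?K * grad_inner \<Omega> v v)"
    by (simp add: power2_eq_square mult_ac)
  then have "inner_L2 \<Omega> v v \<le> ?K * grad_inner \<Omega> v v"
    using K SG.nonneg[OF v] inner_L2_nonneg[of \<Omega> v]
    by (cases "inner_L2 \<Omega> v v = 0") (auto simp: mult_le_cancel_left)
  also have "\<dots> \<le> (1 + ?K) * grad_inner \<Omega> v v"
    using SG.nonneg[OF v] by (intro mult_right_mono) auto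
  finally show "inner_L2 \<Omega> v v \<le> (1 + ?K) * grad_inner \<Omega> v v" .
qed

end

section \<open>The semidiscrete evolution is a strict contraction\<close>

lemma time_deriv_has_time_deriv: "has_time_deriv \<Omega> T u g \<Longrightarrow> has_time_deriv \<Omega> T u (time_deriv \<Omega> T u)"
  unfolding time_deriv_def by (rule someI[of "has_time_deriv \<Omega> T u"])

lemma H1J_time_deriv:
  assumes "u \<in> H1J \<Omega> T X"
  shows "has_time_deriv \<Omega> T u (time_deriv \<Omega> T u)"
proof -
  obtain g where "has_time_deriv \<Omega> T u g" using assms by (auto simp: H1J_def)
  then show ?thesis by (rule time_deriv_has_time_deriv)
qed

lemma has_time_derivD:
  assumes "has_time_deriv \<Omega> T u g"
  shows "(\<lambda>(t, x). u t x) \<in> L2 ({0<..<T} \<times> \<Omega>)" "(\<lambda>(t, x). g t x) \<in> L2 ({0<..<T} \<times> \<Omega>)"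
  using assms by (auto simp: has_time_deriv_def L2J_L2_def)

lemma H1J_pairing_ac:
  assumes "\<Omega> \<in> sets borel" "0 < T" "u \<in> H1J \<Omega> T X" "X \<subseteq> L2 \<Omega>" "w \<in> L2 \<Omega>"
  shows "ac_on T (\<lambda>t. inner_L2 \<Omega> (u t) w) (\<lambda>t. inner_L2 \<Omega> (time_deriv \<Omega> T u t) w)"
  using assms(3,4) by (intro time_deriv_pairing_ac assms(1,2,5) H1J_time_deriv[OF assms(3)]) (auto simp: H1J_def)

text \<open>The Dirichlet energy Q satisfies \<open>Q' = - 2 \<nu> (\<psi>, \<psi>)\<close> with
  \<psi> the negative discrete Laplacian of the solution, and \<open>Q = (\<phi>, \<psi>)\<close>
  with the Poincare inequality gives \<open>Q \<le> K (\<psi>, \<psi>)\<close>. Instead of an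
  exponential from a Gronwall argument, a linear factor is obtained by integrating
  \<open>Q' \<le> - (2 \<nu> / K) Q\<close>; for a strict contraction this is enough.\<close>

lemma (in galerkin) evolution_decay:
  assumes T: "0 < T" and \<nu>: "0 < \<nu>" and K: "0 < K" "\<And>v. v \<in> S \<Longrightarrow> inner_L2 \<Omega> v v \<le> K * grad_inner \<Omega> v v"
    and \<phi>: "\<phi> \<in> H1J \<Omega> T S"
    and eq: "AE t\<in>{0<..<T} in lborel. \<forall>\<eta>\<in>S. inner_L2 \<Omega> (time_deriv \<Omega> T \<phi> t) \<eta> + \<nu> * grad_inner \<Omega> (\<phi> t) \<eta> = 0"
  shows "(1 + 2 * \<nu> / K * T) * grad_inner \<Omega> (\<phi> T) (\<phi> T) \<le> grad_inner \<Omega> (\<phi> 0) (\<phi> 0)"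
proof -
  let ?d = "time_deriv \<Omega> T \<phi>" and ?J = "{0<..<T}"
  have \<phi>S: "\<phi> t \<in> S" if "t \<in> {0..T}" for t using \<phi> that by (simp add: H1J_def)
  have dL: "AE t\<in>?J in lborel. ?d t \<in> L2 \<Omega>"
    by (rule L2_prod_AE[OF _ borel_\<Omega> has_time_derivD(2)[OF H1J_time_deriv[OF \<phi>]]]) simp
  define c where "c b t = inner_L2 \<Omega> (\<phi> t) (riesz b)" for b t
  define c' where "c' b t = inner_L2 \<Omega> (?d t) (riesz b)" for b t
  have c: "c b t = grad_inner \<Omega> (\<phi> t) b" if "b \<in> G_basis" "t \<in> {0..T}" for b t
    unfolding c_def by (rule riesz_inner[OF \<phi>S[OF that(2)] S_in_H10[OF G_basis_S[OF that(1)]]])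
  have ac: "ac_on T (c b) (c' b)" for b
    unfolding c_def[abs_def] c'_def[abs_def]
    using S_L2 by (intro H1J_pairing_ac[OF borel_\<Omega> T \<phi>] S_L2 riesz_mem) auto
  define Q where "Q t = (\<Sum>b\<in>G_basis. c b t * c b t)" for t
  define Q' where "Q' t = (\<Sum>b\<in>G_basis. c b t * c' b t + c' b t * c b t)" for t
  have acQ: "ac_on T Q Q'"
    unfolding Q_def[abs_def] Q'_def[abs_def] using T by (intro ac_on_sum ac_on_mult ac) auto
  have Q: "Q t = grad_inner \<Omega> (\<phi> t) (\<phi> t)" if "t \<in> {0..T}" for t
    unfolding G_Parseval[OF \<phi>S[OF that] \<phi>S[OF that]] Q_def
    using that \<phi>S[OF that] by (intro sum.cong) (auto simp: c SG.sym[OF \<phi>S[OF that] G_basis_S])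
  have dec: "AE t\<in>?J in lborel. Q' t \<le> - (2 * \<nu> / K) * Q t"
    using eq dL
  proof eventually_elim
    case (elim t)
    show ?case
    proof
      assume tJ: "t \<in> ?J"
      then have t: "t \<in> {0..T}" by simp
      have e: "inner_L2 \<Omega> (?d t) \<eta> = - \<nu> * grad_inner \<Omega> (\<phi> t) \<eta>" if "\<eta> \<in> S" for \<eta>
      proof -
        have "inner_L2 \<Omega> (?d t) \<eta> + \<nu> * grad_inner \<Omega> (\<phi> t) \<eta> = 0" using elim(1) tJ that by blast
        then show ?thesis by simp
      qed
      have dt: "?d t \<in> L2 \<Omega>" using elim(2) tJ by blast
      \<comment> \<open>Assembled from the representatives of the basis elements so that its pairing
        with the time derivative is the sum of products occurring in \<open>Q'\<close>.\<close>
      define \<psi> where "\<psi> x = (\<Sum>b\<in>G_basis. c b t * riesz b x)" for x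
      have \<psi>: "\<psi> \<in> S" unfolding \<psi>_def[abs_def] by (rule SG.sum_mem) (rule riesz_mem)
      have \<psi>v: "inner_L2 \<Omega> v \<psi> = grad_inner \<Omega> (\<phi> t) v" if v: "v \<in> S" for v
      proof -
        have "inner_L2 \<Omega> v \<psi> = (\<Sum>b\<in>G_basis. c b t * inner_L2 \<Omega> v (riesz b))"
          unfolding \<psi>_def[abs_def] by (rule SL.sum_right[OF riesz_mem v])
        also have "\<dots> = (\<Sum>b\<in>G_basis. grad_inner \<Omega> (\<phi> t) b * grad_inner \<Omega> b v)"
          using t v by (intro sum.cong) (auto simp: c riesz_inner S_in_H10 G_basis_S SG.sym[OF v])
        finally show ?thesis using G_Parseval[OF \<phi>S[OF t] v] by simp
      qed
      have "inner_L2 \<Omega> (?d t) \<psi> = (\<Sum>b\<in>G_basis. c b t * c' b t)"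
        unfolding \<psi>_def[abs_def] c'_def by (rule L.sum_right[OF S_L2[OF riesz_mem] dt])
      then have "Q' t = 2 * inner_L2 \<Omega> (?d t) \<psi>"
        by (simp add: Q'_def sum.distrib mult.commute sum_distrib_left)
      also have "\<dots> = - (2 * \<nu>) * inner_L2 \<Omega> \<psi> \<psi>" using e[OF \<psi>] \<psi>v[OF \<psi>] by simp
      finally have Q': "Q' t = - (2 * \<nu>) * inner_L2 \<Omega> \<psi> \<psi>" .
      have "Q t * Q t = (inner_L2 \<Omega> (\<phi> t) \<psi>)\<^sup>2"
        using \<psi>v[OF \<phi>S[OF t]] Q[OF t] by (simp add: power2_eq_square)
      also have "\<dots> \<le> inner_L2 \<Omega> (\<phi> t) (\<phi> t) * inner_L2 \<Omega> \<psi> \<psi>" by (rule SL.Cauchy_Schwarz[OF \<phi>S[OF t] \<psi>])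
      also have "\<dots> \<le> (K * Q t) * inner_L2 \<Omega> \<psi> \<psi>"
        using K(2)[OF \<phi>S[OF t]] Q[OF t] by (intro mult_right_mono inner_L2_nonneg) simp
      finally have "Q t * Q t \<le> Q t * (K * inner_L2 \<Omega> \<psi> \<psi>)" by (simp add: mult_ac)
      moreover have "0 \<le> Q t" unfolding Q_def by (intro sum_nonneg) simp
      moreover have "0 \<le> K * inner_L2 \<Omega> \<psi> \<psi>" using K(1) inner_L2_nonneg[of \<Omega> \<psi>] by simp
      ultimately have "Q t \<le> K * inner_L2 \<Omega> \<psi> \<psi>" by (cases "Q t = 0") (auto simp: mult_le_cancel_left)
      then have "(2 * \<nu> / K) * Q t \<le> (2 * \<nu> / K) * (K * inner_L2 \<Omega> \<psi> \<psi>)"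
        using \<nu> K(1) by (intro mult_left_mono) auto
      then show "Q' t \<le> - (2 * \<nu> / K) * Q t" using Q' K(1) by simp
    qed
  qed
  have Q0: "0 \<le> Q t" for t unfolding Q_def by (intro sum_nonneg) simp
  \<comment> \<open>The energy is nonincreasing, so on the whole interval Q can be bounded below by
    its final value.\<close>
  have mono: "Q T \<le> Q t" if t: "t \<in> {0..T}" for t
  proof -
    have sub: "set_integrable lborel {t<..<T} Q'"
      using t by (intro set_integrable_subset[OF ac_onD(1)[OF acQ]]) auto
    have "Q T - Q t = (LINT s:{t<..<T}|lborel. Q' s)" using ac_on_increment[OF acQ, of t T] t by simp
    also have "\<dots> \<le> (LINT s:{t<..<T}|lborel. 0)"
    proof (rule set_integral_mono_AE[OF sub])
      show "AE s\<in>{t<..<T} in lborel. Q' s \<le> 0"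
        using dec
      proof eventually_elim
        case (elim s)
        have "- (2 * \<nu> / K) * Q s \<le> 0" using Q0[of s] \<nu> K(1) by (simp add: mult_nonneg_nonneg)
        then show ?case using elim t by auto
      qed
    qed (simp add: set_integrable_def)
    finally show ?thesis by simp
  qed
  have iQ: "set_integrable lborel {0<..<T} Q"
    using borel_integrable_atLeastAtMost'[OF ac_onD(2)[OF acQ]] by (rule set_integrable_subset) auto
  have "Q T - Q 0 = (LINT s:?J|lborel. Q' s)" using ac_on_increment[OF acQ, of 0 T] T by simp
  also have "\<dots> \<le> (LINT s:?J|lborel. - (2 * \<nu> / K) * Q s)"
    by (rule set_integral_mono_AE[OF ac_onD(1)[OF acQ] _ dec]) (rule set_integrable_mult_right, rule iQ)
  also have "\<dots> \<le> (LINT s:?J|lborel. - (2 * \<nu> / K) * Q T)"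
  proof (rule set_integral_mono_AE)
    show "set_integrable lborel ?J (\<lambda>s. - (2 * \<nu> / K) * Q s)" by (rule set_integrable_mult_right, rule iQ)
    show "set_integrable lborel ?J (\<lambda>s. - (2 * \<nu> / K) * Q T)"
      by (simp only: set_integrable_def) (intro integrable_scaleR_left integrable_real_indicator; use T in simp)
    show "AE s\<in>?J in lborel. - (2 * \<nu> / K) * Q s \<le> - (2 * \<nu> / K) * Q T"
    proof (intro AE_I2 impI)
      fix s assume "s \<in> ?J"
      then have "(2 * \<nu> / K) * Q T \<le> (2 * \<nu> / K) * Q s"
        using mono[of s] \<nu> K(1) by (intro mult_left_mono) auto
      then show "- (2 * \<nu> / K) * Q s \<le> - (2 * \<nu> / K) * Q T" by simp
    qed
  qed
  also have "\<dots> = - (2 * \<nu> / K * T) * Q T"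
    using T by (simp add: set_lebesgue_integral_def)
  finally have "(1 + 2 * \<nu> / K * T) * Q T \<le> Q 0" by (simp add: algebra_simps)
  then show ?thesis using Q[of 0] Q[of T] T by simp
qed

text \<open>The bound \<open>1 / sqrt a\<close> does not depend on v, so strictness survives the
  supremum; quotients with denominator 0 are 0 by convention and obey it too.\<close>

lemma (in galerkin) opnorm_evolution_less_1:
  assumes T: "0 < T" and \<nu>: "0 < \<nu>" and E: "is_evolution_operator \<nu> \<Omega> T S E"
  shows "opnorm_H10 \<Omega> S E < 1"
proof -
  obtain K where K: "0 < K" "\<And>v. v \<in> S \<Longrightarrow> inner_L2 \<Omega> v v \<le> K * grad_inner \<Omega> v v"
    using Poincare by blast
  define a where "a = 1 + 2 * \<nu> / K * T"
  have a: "1 < a" using T \<nu> K(1) by (simp add: a_def)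
  have "norm_H10 \<Omega> (E v) / norm_H10 \<Omega> v \<le> 1 / sqrt a" if v: "v \<in> S" for v
  proof -
    obtain \<phi> where \<phi>: "\<phi> \<in> H1J \<Omega> T S" "\<phi> 0 = v" "E v = \<phi> T"
      "AE t\<in>{0<..<T} in lborel. \<forall>\<eta>\<in>S. inner_L2 \<Omega> (time_deriv \<Omega> T \<phi> t) \<eta> + \<nu> * grad_inner \<Omega> (\<phi> t) \<eta> = 0"
      using E v unfolding is_evolution_operator_def grad_inner_def by fastforce
    have "a * grad_inner \<Omega> (E v) (E v) \<le> grad_inner \<Omega> v v"
      using evolution_decay[OF T \<nu> K \<phi>(1,4)] \<phi>(2,3) by (simp add: a_def)
    then have "sqrt (a * grad_inner \<Omega> (E v) (E v)) \<le> norm_H10 \<Omega> v"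
      unfolding norm_H10_eq by (rule real_sqrt_le_mono)
    then have le: "sqrt a * norm_H10 \<Omega> (E v) \<le> norm_H10 \<Omega> v"
      by (simp add: real_sqrt_mult norm_H10_eq)
    have nn: "0 \<le> norm_H10 \<Omega> v" unfolding norm_H10_def by (rule norm_L2_nonneg)
    show ?thesis
    proof (cases "norm_H10 \<Omega> v = 0")
      case False
      then show ?thesis using le nn a by (simp add: divide_simps mult.commute)
    qed (use a in simp)
  qed
  then have "opnorm_H10 \<Omega> S E \<le> 1 / sqrt a"
    unfolding opnorm_H10_def using SL.zero_mem by (intro cSUP_least) auto
  also have "\<dots> < 1" using a by simp
  finally show ?thesis .
qed

section \<open>Error estimates\<close>

lemma bounded_measurable_L2_Ioo:
  fixes y :: "real \<Rightarrow> real"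
  assumes "y \<in> borel_measurable (lebesgue_in {0<..<T})" "\<And>t. t \<in> {0<..<T} \<Longrightarrow> \<bar>y t\<bar> \<le> M"
  shows "y \<in> L2 {0<..<T}"
proof -
  have "integrable (lebesgue_in {0<..<T}) (\<lambda>t. M\<^sup>2)"
    by (auto simp: integrable_restrict_space
        intro!: integrable_mult_left integrable_real_indicator emeasure_bounded_finite)
  then have "integrable (lebesgue_in {0<..<T}) (\<lambda>t. (y t)\<^sup>2)"
  proof (rule Bochner_Integration.integrable_bound)
    show "(\<lambda>t. (y t)\<^sup>2) \<in> borel_measurable (lebesgue_in {0<..<T})" using assms(1) by (rule borel_measurable_power)
    show "AE t in lebesgue_in {0<..<T}. norm ((y t)\<^sup>2) \<le> norm (M\<^sup>2)"
    proof (rule AE_I2)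
      fix t assume "t \<in> space (lebesgue_in {0<..<T})"
      then have "\<bar>y t\<bar> \<le> \<bar>M\<bar>" using assms(2)[of t] by (simp add: space_restrict_space)
      then show "norm ((y t)\<^sup>2) \<le> norm (M\<^sup>2)" by (simp add: abs_le_square_iff)
    qed
  qed
  then show ?thesis using assms(1) by (simp add: L2_iff)
qed

lemma continuous_bounded_Icc:
  fixes y :: "real \<Rightarrow> real"
  assumes "continuous_on {0..T} y"
  obtains M where "\<And>t. t \<in> {0..T} \<Longrightarrow> \<bar>y t\<bar> \<le> M"
proof -
  have "\<exists>M. \<forall>t\<in>{0..T}. \<bar>y t\<bar> \<le> M"
    using compact_imp_bounded[OF compact_continuous_image[OF assms]] by (auto simp: bounded_iff)
  then show ?thesis using that by blast
qed

lemma continuous_L2_Ioo: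
  fixes y :: "real \<Rightarrow> real"
  assumes "continuous_on {0..T} y"
  shows "y \<in> L2 {0<..<T}"
proof -
  obtain M where M: "\<And>t. t \<in> {0..T} \<Longrightarrow> \<bar>y t\<bar> \<le> M" using continuous_bounded_Icc[OF assms] by blast
  have "continuous_on {0<..<T} y" by (rule continuous_on_subset[OF assms]) auto
  then have "y \<in> borel_measurable (lebesgue_in {0<..<T})"
    using borel_measurable_continuous_on_indicator[of "{0<..<T}" y]
    by (simp add: borel_measurable_restrict_space_iff)
  then show ?thesis by (rule bounded_measurable_L2_Ioo[of _ _ M]) (use M in auto)
qed

lemma ac_on_has_weak_grad:
  assumes T: "0 < T" and ac: "ac_on T y q" and q: "q \<in> L2 {0<..<T}"
  shows "has_weak_grad {0<..<T} y q"
  unfolding has_weak_grad_def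
proof (intro conjI ballI)
  show "y \<in> L2 {0<..<T}" by (rule continuous_L2_Ioo[OF ac_onD(2)[OF ac]])
  show "q \<in> L2 {0<..<T}" by (rule q)
  fix \<phi> and b :: real assume \<phi>: "\<phi> \<in> test_functions {0<..<T}" and "b \<in> Basis"
  then have b: "b = 1" by simp
  note C = test_functionsD(1)[OF \<phi>, of "Suc 0"]
  have z: "\<phi> 0 = 0" "\<phi> T = 0"
    by (rule test_functionsD(4)[OF \<phi>]; use test_functionsD(3)[OF \<phi>] in force)+
  show "(LINT t:{0<..<T}|lborel. y t * frechet_derivative \<phi> (at t) b) = - (LINT t:{0<..<T}|lborel. (q t \<bullet> b) * \<phi> t)"
    using ac_on_parts[OF _ ac ac_on_C1[OF C]] T z by (simp add: b deriv_eq_frechet(1)[OF C, symmetric])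
qed

text \<open>Translates between absolute continuity with a square-integrable density and the space
  \<open>V1\<close>, in whose terms interpolation errors are measured.\<close>

lemma ac_on_V1:
  assumes T: "0 < T" and ac: "ac_on T y q" and q: "q \<in> L2 {0<..<T}" and per: "y 0 = y T"
  shows "y \<in> V1 T" "norm_L2 {0<..<T} (wgrad {0<..<T} y) = norm_L2 {0<..<T} q"
proof -
  note w = ac_on_has_weak_grad[OF T ac q]
  note H = has_weak_grad_H1[OF w]
  show "y \<in> V1 T" using H ac_onD(2)[OF ac] per by (simp add: V1_def)
  have "inner_L2 {0<..<T} (wgrad {0<..<T} y) (wgrad {0<..<T} y) = inner_L2 {0<..<T} q q"
    by (intro inner_L2_cong_AE wgrad_AE[OF _ w] wgrad_L2[OF H] q) auto
  then show "norm_L2 {0<..<T} (wgrad {0<..<T} y) = norm_L2 {0<..<T} q" by (simp add: norm_L2_eq)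
qed

lemma mesh_interval:
  assumes M: "is_mesh T m \<tau>" and T: "0 < T" and t: "t \<in> {0<..<T}"
  obtains i where "i < m" "\<tau> i \<le> t" "t \<le> \<tau> (Suc i)" "\<tau> i \<in> {0..T}" "\<tau> (Suc i) \<in> {0..T}"
proof -
  have ends: "\<tau> 0 = 0" "\<tau> m = T" using M by (auto simp: is_mesh_def)
  then have m: "0 < m" using T by (cases m) auto
  define i where "i = (LEAST i. t \<le> \<tau> (Suc i))"
  have top: "t \<le> \<tau> (Suc (m - 1))" using m ends t by simp
  have "t \<le> \<tau> (Suc i)" unfolding i_def by (rule LeastI[of _ "m - 1"]) (rule top)
  moreover have "i < m"
  proof -
    have "i \<le> m - 1" unfolding i_def by (rule Least_le) (rule top)
    then show ?thesis using m by simp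
  qed
  moreover have "\<tau> i \<le> t"
  proof (cases i)
    case (Suc j)
    then have "\<not> t \<le> \<tau> (Suc j)" using not_less_Least[of j "\<lambda>i. t \<le> \<tau> (Suc i)"] by (simp add: i_def)
    then show ?thesis using Suc by simp
  qed (use ends t in simp)
  moreover have "\<tau> j \<in> {0..T}" if "j \<le> m" for j
    using is_mesh_mono[OF M, of 0 j] is_mesh_mono[OF M, of j m] that ends T by (cases "j = 0"; cases "j = m") auto
  ultimately show ?thesis using that by simp
qed

text \<open>The index of the mesh interval is a measurable function of t with values in the natural
  numbers, and the interpolant is affine in t with coefficients depending on that index.\<close>

lemma interpolant_measurable: "interpolant \<tau> w \<in> borel_measurable borel"
proof -
  define n where "n t = (LEAST i. t \<le> \<tau> (Suc i))" for t
  have n: "n \<in> measurable borel (count_space UNIV)"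
    unfolding n_def[abs_def] by measurable
  have c: "(\<lambda>t. f (n t)) \<in> borel_measurable borel" for f :: "nat \<Rightarrow> real"
    by (rule measurable_compose[OF n]) simp
  have "(\<lambda>t. w (\<tau> (n t)) + (t - \<tau> (n t)) / (\<tau> (Suc (n t)) - \<tau> (n t)) * (w (\<tau> (Suc (n t))) - w (\<tau> (n t)))) \<in> borel_measurable borel"
    using c[of "\<lambda>i. w (\<tau> i)"] c[of \<tau>] c[of "\<lambda>i. \<tau> (Suc i)"] c[of "\<lambda>i. w (\<tau> (Suc i))"] by measurable
  then show ?thesis by (simp add: interpolant_def[abs_def] Let_def n_def)
qed

lemma interpolant_L2:
  assumes M: "is_mesh T m \<tau>" and T: "0 < T" and w: "continuous_on {0..T} w"
  shows "interpolant \<tau> w \<in> L2 {0<..<T}"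
proof -
  obtain K where K: "\<And>t. t \<in> {0..T} \<Longrightarrow> \<bar>w t\<bar> \<le> K" using continuous_bounded_Icc[OF w] by blast
  show ?thesis
  \<comment> \<open>K bounds the value at the left node, \<open>2 * K\<close> the increment to the
    right node.\<close>
  proof (rule bounded_measurable_L2_Ioo[of _ _ "3 * K"])
    show "interpolant \<tau> w \<in> borel_measurable (lebesgue_in {0<..<T})"
      using interpolant_measurable by (intro measurable_restrict_space1) simp
    fix t assume "t \<in> {0<..<T}"
    then obtain i where i: "i < m" "\<tau> i \<le> t" "t \<le> \<tau> (Suc i)" "\<tau> i \<in> {0..T}" "\<tau> (Suc i) \<in> {0..T}"
      using mesh_interval[OF M T] by blast
    define l where "l = (t - \<tau> i) / (\<tau> (Suc i) - \<tau> i)"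
    have "\<tau> i < \<tau> (Suc i)" using is_mesh_mono[OF M, of i "Suc i"] i by simp
    then have l: "\<bar>l\<bar> \<le> 1" using i by (simp add: l_def)
    have d: "\<bar>w (\<tau> (Suc i)) - w (\<tau> i)\<bar> \<le> 2 * K" using K[OF i(4)] K[OF i(5)] by linarith
    have "\<bar>l * (w (\<tau> (Suc i)) - w (\<tau> i))\<bar> \<le> 1 * (2 * K)"
      unfolding abs_mult using l d by (intro mult_mono) auto
    then show "\<bar>interpolant \<tau> w t\<bar> \<le> 3 * K"
      unfolding interpolant_on_interval[OF M i(1-3)] l_def[symmetric] using K[OF i(4)] by linarith
  qed
qed

context galerkin
begin

text \<open>Linearity of the time integrals is needed at almost every x, hence integrability of
  \<open>c t * v t x\<close> in t for almost every x. It comes from the Fubini theorem after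
  multiplying by the constant 1, which is in L2 as the domain is bounded.\<close>

lemma has_time_deriv_diff:
  assumes u: "has_time_deriv \<Omega> T u g" and p: "has_time_deriv \<Omega> T p k"
  shows "has_time_deriv \<Omega> T (\<lambda>t x. u t x - p t x) (\<lambda>t x. g t x - k t x)"
proof -
  let ?J = "{0<..<T}"
  have J: "?J \<in> sets borel" by simp
  interpret P: pair_sigma_finite "lebesgue_in ?J" "lebesgue_in \<Omega>" by (rule pair_sigma_finite_lebesgue_in[OF J borel_\<Omega>])
  interpret LP: semi_inner "L2 (?J \<times> \<Omega>)" "inner_L2 (?J \<times> \<Omega>)"
    by (rule semi_inner_L2[OF borel_Times[OF J borel_\<Omega>]])
  note one = const_L2[OF borel_\<Omega> bounded_\<Omega>]
  have int: "AE x in lebesgue_in \<Omega>. set_integrable lborel ?J (\<lambda>t. c t * v t x)"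
    if v: "(\<lambda>(t, x). v t x) \<in> L2 (?J \<times> \<Omega>)" and c: "c \<in> L2 ?J" for v and c :: "real \<Rightarrow> real"
  proof -
    have "integrable (lebesgue_in ?J \<Otimes>\<^sub>M lebesgue_in \<Omega>) (\<lambda>(t, x). v t x \<bullet> (c t * 1))"
      by (rule L2_prod_integrable[OF J borel_\<Omega> v L2_tensor[OF J borel_\<Omega> c one]])
    from P.AE_integrable_snd[OF this] show ?thesis
      by (simp add: set_integrable_restrict mult.commute)
  qed
  have diff: "(\<lambda>(t, x). v t x - w t x) \<in> L2 (?J \<times> \<Omega>)"
    if "(\<lambda>(t, x). v t x) \<in> L2 (?J \<times> \<Omega>)" "(\<lambda>(t, x). w t x) \<in> L2 (?J \<times> \<Omega>)" for v w :: "real \<Rightarrow> 'a \<Rightarrow> real"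
    using LP.diff_mem[OF that] by (simp add: split_beta')
  note L = has_time_derivD[OF u] has_time_derivD[OF p]
  show ?thesis
    unfolding has_time_deriv_def L2J_L2_def mem_Collect_eq
  proof (intro conjI ballI diff L)
    fix \<phi> assume \<phi>: "\<phi> \<in> test_functions ?J"
    have \<phi>L: "\<phi> \<in> L2 ?J" by (rule test_function_L2[OF J \<phi>])
    have d\<phi>L: "deriv \<phi> \<in> L2 ?J"
      using test_function_partial_L2[OF J \<phi>, of 1] by (simp add: deriv_eq_frechet(1)[OF test_functionsD(1)[OF \<phi>], abs_def])
    have "AE x in lebesgue_in \<Omega>. (LINT t:?J|lborel. deriv \<phi> t * u t x) = - (LINT t:?J|lborel. \<phi> t * g t x)"
      "AE x in lebesgue_in \<Omega>. (LINT t:?J|lborel. deriv \<phi> t * p t x) = - (LINT t:?J|lborel. \<phi> t * k t x)"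
      using u p \<phi> by (simp_all add: has_time_deriv_def AE_restrict[OF borel_\<Omega>])
    then show "AE x\<in>\<Omega> in lborel. (LINT t:?J|lborel. deriv \<phi> t * (u t x - p t x)) = - (LINT t:?J|lborel. \<phi> t * (g t x - k t x))"
      unfolding AE_restrict[OF borel_\<Omega>]
      using int[OF L(1) d\<phi>L] int[OF L(2) \<phi>L] int[OF L(3) d\<phi>L] int[OF L(4) \<phi>L]
      by eventually_elim (simp add: right_diff_distrib)
  qed
qed

text \<open>The error equation involves \<open>time_deriv\<close> of the difference; this guarantees
  that the choice behind it selects a genuine derivative.\<close>

lemma H1J_diff:
  assumes u: "u \<in> H1J \<Omega> T (L2 \<Omega>)" and p: "p \<in> H1J \<Omega> T S"
  shows "(\<lambda>t x. u t x - p t x) \<in> H1J \<Omega> T (L2 \<Omega>)"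
proof -
  let ?J = "{0<..<T}"
  obtain g k where gk: "has_time_deriv \<Omega> T u g" "has_time_deriv \<Omega> T p k"
    using u p by (auto simp: H1J_def)
  have d: "has_time_deriv \<Omega> T (\<lambda>t x. u t x - p t x) (\<lambda>t x. g t x - k t x)" by (rule has_time_deriv_diff[OF gk])
  have "AE t\<in>?J in lborel. (\<lambda>x. g t x - k t x) \<in> L2 \<Omega>"
    by (rule L2_prod_AE[OF _ borel_\<Omega> has_time_derivD(2)[OF d]]) simp
  moreover have mem: "u t \<in> L2 \<Omega>" "p t \<in> L2 \<Omega>" if "t \<in> {0..T}" for t
    using u p S_L2 that by (auto simp: H1J_def)
  moreover have "((\<lambda>t. norm_L2 \<Omega> (\<lambda>x. (u t x - p t x) - (u s x - p s x))) \<longlongrightarrow> 0) (at s within {0..T})"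
    if s: "s \<in> {0..T}" for s
  proof (rule tendsto_sandwich[OF _ _ tendsto_const])
    have "((\<lambda>t. norm_L2 \<Omega> (\<lambda>x. u t x - u s x)) \<longlongrightarrow> 0) (at s within {0..T})"
      "((\<lambda>t. norm_L2 \<Omega> (\<lambda>x. p t x - p s x)) \<longlongrightarrow> 0) (at s within {0..T})"
      using u p s by (auto simp: H1J_def)
    from tendsto_add[OF this]
    show "((\<lambda>t. norm_L2 \<Omega> (\<lambda>x. u t x - u s x) + norm_L2 \<Omega> (\<lambda>x. p t x - p s x)) \<longlongrightarrow> 0) (at s within {0..T})" by simp
    show "\<forall>\<^sub>F t in at s within {0..T}. 0 \<le> norm_L2 \<Omega> (\<lambda>x. (u t x - p t x) - (u s x - p s x))"
      by (simp add: norm_L2_nonneg)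
    show "\<forall>\<^sub>F t in at s within {0..T}. norm_L2 \<Omega> (\<lambda>x. (u t x - p t x) - (u s x - p s x))
        \<le> norm_L2 \<Omega> (\<lambda>x. u t x - u s x) + norm_L2 \<Omega> (\<lambda>x. p t x - p s x)"
      unfolding eventually_at_filter
    proof (intro always_eventually allI impI)
      fix t assume t: "t \<in> {0..T}"
      let ?a = "\<lambda>x. u t x - u s x" and ?b = "\<lambda>x. (-1) * (p t x - p s x)"
      have ab: "?a \<in> L2 \<Omega>" "(\<lambda>x. p t x - p s x) \<in> L2 \<Omega>" using mem[OF s] mem[OF t] by (auto intro: L.diff_mem)
      then have b: "?b \<in> L2 \<Omega>" using L.scale_mem[of _ "-1"] by blast
      have "inner_L2 \<Omega> ?b ?b = inner_L2 \<Omega> (\<lambda>x. p t x - p s x) (\<lambda>x. p t x - p s x)"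
        by (simp add: inner_L2_def algebra_simps)
      moreover have "(\<lambda>x. ?a x + ?b x) = (\<lambda>x. (u t x - p t x) - (u s x - p s x))" by auto
      ultimately show "norm_L2 \<Omega> (\<lambda>x. (u t x - p t x) - (u s x - p s x))
        \<le> norm_L2 \<Omega> (\<lambda>x. u t x - u s x) + norm_L2 \<Omega> (\<lambda>x. p t x - p s x)"
        using L.triangle[OF ab(1) b] by (simp only: norm_L2_eq)
    qed
  qed
  ultimately show ?thesis
    using d by (auto simp: H1J_def intro: L.diff_mem)
qed

text \<open>With \<open>\<theta> = P u - p\<close> and \<open>\<rho> = u - P u\<close>, the error \<open>e = u - p\<close> satisfies
  \<open>\<parallel>e\<parallel>\<^sup>2 = \<parallel>\<rho>\<parallel>\<^sup>2 + 2 (\<theta>, e) - \<parallel>\<theta>\<parallel>\<^sup>2\<close>, and \<open>\<theta>\<close> is determined by \<open>e\<^sub>t\<close> through the error equation.\<close>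

lemma spatial_error:
  assumes \<nu>: "0 < \<nu>" and C: "0 < C" and P: "is_H10_projection \<Omega> S P"
    and approx: "\<And>v g. v \<in> H10 \<Omega> \<Longrightarrow> has_laplacian \<Omega> v g \<Longrightarrow>
      norm_H10 \<Omega> (\<lambda>x. v x - P v x) \<le> C * norm_L2 \<Omega> g"
    and Nitsche: "\<And>v. v \<in> H10 \<Omega> \<Longrightarrow>
      norm_L2 \<Omega> (\<lambda>x. v x - P v x) \<le> C * norm_H10 \<Omega> (\<lambda>x. v x - P v x)"
    and u: "u \<in> H10 \<Omega>" and p: "p \<in> S" and g: "g \<in> L2 \<Omega>" and e': "e' \<in> L2 \<Omega>"
    and eqg: "\<And>w. w \<in> H10 \<Omega> \<Longrightarrow> inner_L2 \<Omega> g w = \<nu> * grad_inner \<Omega> u w"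
    and eqe: "\<And>v. v \<in> S \<Longrightarrow> inner_L2 \<Omega> e' v + \<nu> * grad_inner \<Omega> (\<lambda>x. u x - p x) v = 0"
  defines "e \<equiv> \<lambda>x. u x - p x"
  shows "inner_L2 \<Omega> e e \<le> (C\<^sup>2 / \<nu>)\<^sup>2 * inner_L2 \<Omega> g g - 2 / \<nu> * (\<Sum>b\<in>G_basis. inner_L2 \<Omega> e b * inner_L2 \<Omega> e' b)"
proof -
  have Pu: "P u \<in> S" and Po: "\<And>v. v \<in> S \<Longrightarrow> grad_inner \<Omega> (\<lambda>x. u x - P u x) v = 0"
    using P u by (auto simp: is_H10_projection_def grad_inner_def)
  define \<rho> where "\<rho> x = u x - P u x" for x
  define \<theta> where "\<theta> x = P u x - p x" for x
  have e: "e \<in> H10 \<Omega>" unfolding e_def by (intro G.diff_mem u S_in_H10 p)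
  have \<rho>: "\<rho> \<in> H10 \<Omega>" unfolding \<rho>_def by (intro G.diff_mem u S_in_H10 Pu)
  have \<theta>: "\<theta> \<in> S" unfolding \<theta>_def by (intro SL.diff_mem Pu p)
  have \<rho>e: "\<rho> = (\<lambda>x. e x - \<theta> x)" by (auto simp: e_def \<rho>_def \<theta>_def)
  have eL: "e \<in> L2 \<Omega>" "\<theta> \<in> L2 \<Omega>" using e \<theta> by (auto intro: H10_L2 S_L2)
  have \<theta>b: "grad_inner \<Omega> \<theta> b = - (1 / \<nu>) * inner_L2 \<Omega> e' b" if b: "b \<in> S" for b
  proof -
    have "grad_inner \<Omega> e b - grad_inner \<Omega> \<theta> b = 0"
      using Po[OF b] G.diff_left[OF e S_in_H10[OF \<theta>] S_in_H10[OF b]] \<rho>e by (simp add: \<rho>_def[abs_def])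
    moreover have "inner_L2 \<Omega> e' b + \<nu> * grad_inner \<Omega> e b = 0"
      using eqe[OF b] by (simp add: e_def)
    ultimately show ?thesis using \<nu> by (simp add: field_simps)
  qed
  \<comment> \<open>The equation for g says that the Laplacian of u is \<open>- g / \<nu>\<close> in
    the sense of distributions, which is the form required by the approximation hypothesis.\<close>
  have lap: "has_laplacian \<Omega> u (\<lambda>x. - (1 / \<nu>) * g x)"
    unfolding has_laplacian_def
  proof (intro conjI ballI)
    show "u \<in> H1 \<Omega>" by (rule H10_H1[OF u])
    show "(\<lambda>x. - (1 / \<nu>) * g x) \<in> L2 \<Omega>" by (rule L.scale_mem[OF g])
    fix \<phi> assume \<phi>: "\<phi> \<in> test_functions \<Omega>"
    have "inner_L2 \<Omega> (\<lambda>x. - (1 / \<nu>) * g x) \<phi> = - (1 / \<nu>) * inner_L2 \<Omega> g \<phi>"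
      by (rule L.scale_left[OF g test_function_L2[OF borel_\<Omega> \<phi>]])
    then show "inner_L2 \<Omega> (wgrad \<Omega> u) (wgrad \<Omega> \<phi>) = - inner_L2 \<Omega> (\<lambda>x. - (1 / \<nu>) * g x) \<phi>"
      using eqg[OF test_function_H10[OF open_\<Omega> \<phi>]] \<nu> by (simp add: grad_inner_def)
  qed
  have "inner_L2 \<Omega> (\<lambda>x. - (1 / \<nu>) * g x) (\<lambda>x. - (1 / \<nu>) * g x) = (1 / \<nu>)\<^sup>2 * inner_L2 \<Omega> g g"
    using L.scale_left[OF g L.scale_mem[OF g], of "- (1 / \<nu>)" "- (1 / \<nu>)"] L.scale_right[OF g g, of "- (1 / \<nu>)"]
    by (simp add: power2_eq_square)
  then have "norm_L2 \<Omega> (\<lambda>x. - (1 / \<nu>) * g x) = 1 / \<nu> * norm_L2 \<Omega> g"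
    using \<nu> by (simp add: norm_L2_eq real_sqrt_mult)
  then have "norm_H10 \<Omega> \<rho> \<le> C * (1 / \<nu> * norm_L2 \<Omega> g)"
    using approx[OF u lap] by (simp add: \<rho>_def[abs_def])
  \<comment> \<open>One factor C comes from the energy estimate, the other from the duality
    estimate; this is the origin of the square.\<close>
  then have "C * norm_H10 \<Omega> \<rho> \<le> C * (C * (1 / \<nu> * norm_L2 \<Omega> g))"
    using C by (intro mult_left_mono) auto
  then have "norm_L2 \<Omega> \<rho> \<le> C\<^sup>2 / \<nu> * norm_L2 \<Omega> g"
    using Nitsche[OF u] by (simp add: \<rho>_def[abs_def] power2_eq_square mult_ac)
  then have "(norm_L2 \<Omega> \<rho>)\<^sup>2 \<le> (C\<^sup>2 / \<nu> * norm_L2 \<Omega> g)\<^sup>2"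
    by (intro power_mono norm_L2_nonneg)
  then have \<rho>g: "inner_L2 \<Omega> \<rho> \<rho> \<le> (C\<^sup>2 / \<nu>)\<^sup>2 * inner_L2 \<Omega> g g"
    by (simp only: power_mult_distrib norm_L2_sq)
  \<comment> \<open>The Dirichlet coefficients of \<theta> are those of e, since \<rho> is
    orthogonal to S, and the error equation expresses them by the time derivative of e.\<close>
  have "inner_L2 \<Omega> \<theta> e = (\<Sum>b\<in>G_basis. grad_inner \<Omega> \<theta> b * inner_L2 \<Omega> b e)"
    by (rule inner_L2_G_expansion[OF \<theta> eL(1)])
  also have "\<dots> = - (1 / \<nu>) * (\<Sum>b\<in>G_basis. inner_L2 \<Omega> e b * inner_L2 \<Omega> e' b)"
    unfolding sum_distrib_left
    by (intro sum.cong) (simp_all add: \<theta>b G_basis_S inner_L2_commute[of \<Omega> e])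
  finally have \<theta>e: "inner_L2 \<Omega> \<theta> e = - (1 / \<nu>) * (\<Sum>b\<in>G_basis. inner_L2 \<Omega> e b * inner_L2 \<Omega> e' b)" .
  have "inner_L2 \<Omega> \<rho> \<rho> = inner_L2 \<Omega> e e - 2 * inner_L2 \<Omega> e \<theta> + inner_L2 \<Omega> \<theta> \<theta>"
    unfolding \<rho>e by (rule L.norm_diff_sq[OF eL])
  then have "inner_L2 \<Omega> e e \<le> inner_L2 \<Omega> \<rho> \<rho> + 2 * inner_L2 \<Omega> \<theta> e"
    using inner_L2_nonneg[of \<Omega> \<theta>] by (simp add: inner_L2_commute)
  then show ?thesis using \<rho>g \<theta>e by simp
qed

text \<open>Interpolation in time commutes with pairing against a fixed basis element, so the scalar
  estimate applies to each coefficient, and Parseval in an L2-orthonormal basis adds up the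
  squares.\<close>

lemma interpolation_error:
  assumes T: "0 < T" and M: "is_mesh T m \<tau>" and C: "0 < C"
    and interp: "\<And>w. w \<in> V1 T \<Longrightarrow>
      norm_L2 {0<..<T} (\<lambda>t. w t - interpolant \<tau> w t) \<le> C * norm_L2 {0<..<T} (wgrad {0<..<T} w)"
    and p: "\<And>t. t \<in> {0..T} \<Longrightarrow> p t \<in> S"
    and ac: "\<And>b. b \<in> L_basis \<Longrightarrow> ac_on T (\<lambda>t. inner_L2 \<Omega> (p t) b) (d b)"
    and d: "\<And>b. b \<in> L_basis \<Longrightarrow> d b \<in> L2 {0<..<T}"
    and per: "\<And>b. b \<in> L_basis \<Longrightarrow> inner_L2 \<Omega> (p 0) b = inner_L2 \<Omega> (p T) b"
  defines "\<delta> \<equiv> \<lambda>t x. p t x - full_discrete \<tau> p t x"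
  shows "\<And>t. t \<in> {0<..<T} \<Longrightarrow> \<delta> t \<in> S"
    and "set_integrable lborel {0<..<T} (\<lambda>t. inner_L2 \<Omega> (\<delta> t) (\<delta> t))"
    and "(LINT t:{0<..<T}|lborel. inner_L2 \<Omega> (\<delta> t) (\<delta> t)) \<le> C\<^sup>2 * (\<Sum>b\<in>L_basis. inner_L2 {0<..<T} (d b) (d b))"
proof -
  let ?J = "{0<..<T}"
  have J: "?J \<in> sets borel" by simp
  interpret LJ: semi_inner "L2 ?J" "inner_L2 ?J" by (rule semi_inner_L2[OF J])
  define c where "c b t = inner_L2 \<Omega> (p t) b" for b t
  define r where "r b t = c b t - interpolant \<tau> (c b) t" for b t
  have ac': "ac_on T (c b) (d b)" if "b \<in> L_basis" for b unfolding c_def[abs_def] by (rule ac[OF that])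
  have \<delta>: "\<delta> t \<in> S" "\<And>b. b \<in> L_basis \<Longrightarrow> inner_L2 \<Omega> (\<delta> t) b = r b t" if t: "t \<in> ?J" for t
  proof -
    obtain i where i: "i < m" "\<tau> i \<le> t" "t \<le> \<tau> (Suc i)" "\<tau> i \<in> {0..T}" "\<tau> (Suc i) \<in> {0..T}"
      using mesh_interval[OF M T t] .
    define l where "l = (t - \<tau> i) / (\<tau> (Suc i) - \<tau> i)"
    \<comment> \<open>As a combination of two nodal values, with weights independent of x, the
      interpolant of p stays in S although \<open>full_discrete\<close> acts pointwise in x.\<close>
    have I: "interpolant \<tau> w t = (1 - l) * w (\<tau> i) + l * w (\<tau> (Suc i))" for w
      unfolding interpolant_on_interval[OF M i(1-3)] l_def[symmetric] by (simp add: algebra_simps)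
    have pt: "p t \<in> S" using p t by simp
    define z where "z x = (1 - l) * p (\<tau> i) x + l * p (\<tau> (Suc i)) x" for x
    have z: "z \<in> S" unfolding z_def by (rule SL.lin_mem[OF p[OF i(4)] p[OF i(5)]])
    have \<delta>z: "\<delta> t = (\<lambda>x. p t x - z x)"
      by (simp add: \<delta>_def full_discrete_def I z_def)
    show "\<delta> t \<in> S" unfolding \<delta>z by (rule SL.diff_mem[OF pt z])
    fix b assume "b \<in> L_basis"
    then have b: "b \<in> S" by (rule L_basis_S)
    have "inner_L2 \<Omega> z b = (1 - l) * c b (\<tau> i) + l * c b (\<tau> (Suc i))"
      unfolding z_def c_def by (rule SL.lin[OF p[OF i(4)] p[OF i(5)] b])
    then show "inner_L2 \<Omega> (\<delta> t) b = r b t"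
      unfolding \<delta>z SL.diff_left[OF pt z b] by (simp add: r_def I c_def)
  qed
  show "\<And>t. t \<in> ?J \<Longrightarrow> \<delta> t \<in> S" by (rule \<delta>(1))
  have rL: "r b \<in> L2 ?J" if b: "b \<in> L_basis" for b
    unfolding r_def[abs_def]
    by (intro LJ.diff_mem continuous_L2_Ioo interpolant_L2[OF M T] ac_onD(2)[OF ac'[OF b]])
  have rint: "set_integrable lborel ?J (\<lambda>t. r b t * r b t)" if b: "b \<in> L_basis" for b
    using integrable_inner_L2[OF J rL[OF b] rL[OF b]] by (simp add: set_integrable_restrict)
  have sq: "inner_L2 \<Omega> (\<delta> t) (\<delta> t) = (\<Sum>b\<in>L_basis. r b t * r b t)" if t: "t \<in> ?J" for t
    unfolding L_Parseval[OF \<delta>(1)[OF t] \<delta>(1)[OF t]]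
    by (intro sum.cong) (simp_all add: inner_L2_commute[of \<Omega> _ "\<delta> t"] \<delta>(2)[OF t])
  have "set_integrable lborel ?J (\<lambda>t. \<Sum>b\<in>L_basis. r b t * r b t)"
    using rint by (rule set_integrable_sum)
  then show "set_integrable lborel ?J (\<lambda>t. inner_L2 \<Omega> (\<delta> t) (\<delta> t))"
    by (subst set_integrable_cong[OF refl refl sq]) auto
  have "(LINT t:?J|lborel. inner_L2 \<Omega> (\<delta> t) (\<delta> t)) = (LINT t:?J|lborel. \<Sum>b\<in>L_basis. r b t * r b t)"
    by (rule set_lebesgue_integral_cong) (use sq in auto)
  also have "\<dots> = (\<Sum>b\<in>L_basis. LINT t:?J|lborel. r b t * r b t)"
    using rint by (rule set_integral_sum_eq)
  also have "\<dots> = (\<Sum>b\<in>L_basis. inner_L2 ?J (r b) (r b))" by (simp add: inner_L2_def)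
  also have "\<dots> \<le> (\<Sum>b\<in>L_basis. C\<^sup>2 * inner_L2 ?J (d b) (d b))"
  proof (rule sum_mono)
    fix b assume b: "b \<in> L_basis"
    have per': "c b 0 = c b T" using per[OF b] by (simp add: c_def)
    note V = ac_on_V1[OF T ac'[OF b] d[OF b] per']
    have "norm_L2 ?J (r b) \<le> C * norm_L2 ?J (d b)"
      using interp[OF V(1)] unfolding V(2) r_def[abs_def] .
    then have "(norm_L2 ?J (r b))\<^sup>2 \<le> (C * norm_L2 ?J (d b))\<^sup>2" by (intro power_mono norm_L2_nonneg)
    then show "inner_L2 ?J (r b) (r b) \<le> C\<^sup>2 * inner_L2 ?J (d b) (d b)"
      by (simp only: power_mult_distrib norm_L2_sq)
  qed
  finally show "(LINT t:?J|lborel. inner_L2 \<Omega> (\<delta> t) (\<delta> t)) \<le> C\<^sup>2 * (\<Sum>b\<in>L_basis. inner_L2 ?J (d b) (d b))"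
    by (simp add: sum_distrib_left)
qed

text \<open>Testing the semidiscrete equation for \<open>p\<close> with \<open>p\<^sub>t\<close>; the stiffness term integrates to \<open>0\<close>
  by symmetry and periodicity.\<close>

lemma semidiscrete_time_deriv_bound:
  assumes T: "0 < T"
    and ac: "\<And>b. b \<in> L_basis \<Longrightarrow> ac_on T (\<lambda>t. inner_L2 \<Omega> (p t) b) (d b)"
    and d: "\<And>b. b \<in> L_basis \<Longrightarrow> d b \<in> L2 {0<..<T}"
    and per: "\<And>b. b \<in> L_basis \<Longrightarrow> inner_L2 \<Omega> (p 0) b = inner_L2 \<Omega> (p T) b"
    and p: "\<And>t. t \<in> {0..T} \<Longrightarrow> p t \<in> S"
    and f: "(\<lambda>(t, x). f t x) \<in> L2 ({0<..<T} \<times> \<Omega>)"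
    and eq: "AE t\<in>{0<..<T} in lborel. \<forall>v\<in>S. (\<Sum>b\<in>L_basis. d b t * inner_L2 \<Omega> b v)
      + \<nu> * grad_inner \<Omega> (p t) v = inner_L2 \<Omega> (f t) v"
  shows "(\<Sum>b\<in>L_basis. inner_L2 {0<..<T} (d b) (d b)) \<le> (LINT t:{0<..<T}|lborel. inner_L2 \<Omega> (f t) (f t))"
proof -
  let ?J = "{0<..<T}" and ?B = L_basis
  have J: "?J \<in> sets borel" by simp
  define c where "c b t = inner_L2 \<Omega> (p t) b" for b t
  have ac': "ac_on T (c b) (d b)" if "b \<in> ?B" for b unfolding c_def[abs_def] by (rule ac[OF that])
  define s where "s b b' = (LINT t:?J|lborel. c b t * d b' t)" for b b'
  have cd: "set_integrable lborel ?J (\<lambda>t. c b t * d b' t)" if "b \<in> ?B" "b' \<in> ?B" for b b'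
    by (rule set_integrable_continuous_mult[OF ac_onD(2)[OF ac'[OF that(1)]] ac_onD(1)[OF ac'[OF that(2)]]])
  have anti: "s b b' = - s b' b" if "b \<in> ?B" "b' \<in> ?B" for b b'
    using ac_on_parts[OF _ ac'[OF that(1)] ac'[OF that(2)]] T per that
    by (simp add: s_def c_def mult.commute)
  define a where "a b b' = grad_inner \<Omega> b b'" for b b'
  have sym_a: "a b b' = a b' b" for b b' by (simp add: a_def grad_inner_def inner_L2_commute)
  \<comment> \<open>The matrix a is symmetric and s antisymmetric; exchanging the indices shows the
    sum to be its own negative.\<close>
  have "(\<Sum>b\<in>?B. \<Sum>b'\<in>?B. a b b' * s b b') = (\<Sum>b'\<in>?B. \<Sum>b\<in>?B. a b b' * s b b')" by (rule sum.swap)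
  also have "\<dots> = (\<Sum>b'\<in>?B. \<Sum>b\<in>?B. - (a b' b * s b' b))"
  proof (intro sum.cong refl)
    fix b b' assume "b \<in> ?B" "b' \<in> ?B"
    from anti[OF this(2,1)] sym_a[of b' b] show "a b' b * s b' b = - (a b b' * s b b')" by simp
  qed
  finally have stiff0: "(\<Sum>b\<in>?B. \<Sum>b'\<in>?B. a b b' * s b b') = 0" by (simp add: sum_negf)
  have dd: "set_integrable lborel ?J (\<lambda>t. d b t * d b t)" if "b \<in> ?B" for b
    using integrable_inner_L2[OF J d[OF that] d[OF that]] by (simp add: set_integrable_restrict)
  have ff: "set_integrable lborel ?J (\<lambda>t. inner_L2 \<Omega> (f t) (f t))"
    by (rule L2_prod_inner(1)[OF J borel_\<Omega> f f])
  let ?X = "\<lambda>t. \<Sum>b\<in>?B. d b t * d b t" and ?Y = "\<lambda>t. \<Sum>b\<in>?B. \<Sum>b'\<in>?B. a b b' * (c b t * d b' t)"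
  have iX: "set_integrable lborel ?J ?X" using dd by (rule set_integrable_sum)
  have iYb: "set_integrable lborel ?J (\<lambda>t. \<Sum>b'\<in>?B. a b b' * (c b t * d b' t))" if "b \<in> ?B" for b
    using cd[OF that] by (intro set_integrable_sum set_integrable_mult_right)
  then have iY: "set_integrable lborel ?J ?Y" by (rule set_integrable_sum)
  have "(LINT t:?J|lborel. ?Y t) = (\<Sum>b\<in>?B. LINT t:?J|lborel. \<Sum>b'\<in>?B. a b b' * (c b t * d b' t))"
    by (rule set_integral_sum_eq[OF iYb])
  also have "\<dots> = (\<Sum>b\<in>?B. \<Sum>b'\<in>?B. LINT t:?J|lborel. a b b' * (c b t * d b' t))"
    using cd by (intro sum.cong refl set_integral_sum_eq set_integrable_mult_right)
  also have "\<dots> = (\<Sum>b\<in>?B. \<Sum>b'\<in>?B. a b b' * s b b')" by (simp add: s_def)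
  finally have Y0: "(LINT t:?J|lborel. ?Y t) = 0" using stiff0 by simp
  have iXY: "set_integrable lborel ?J (\<lambda>t. ?X t + 2 * \<nu> * ?Y t)"
    by (rule set_integral_add(1)[OF iX set_integrable_mult_right]) (rule iY)
  have "(LINT t:?J|lborel. ?X t + 2 * \<nu> * ?Y t) \<le> (LINT t:?J|lborel. inner_L2 \<Omega> (f t) (f t))"
  proof (rule set_integral_mono_AE[OF iXY ff])
    have fL: "AE t\<in>?J in lborel. f t \<in> L2 \<Omega>" by (rule L2_prod_AE[OF J borel_\<Omega> f])
    show "AE t\<in>?J in lborel. ?X t + 2 * \<nu> * ?Y t \<le> inner_L2 \<Omega> (f t) (f t)"
      using eq fL
    proof eventually_elim
      case (elim t)
      show ?case
      proof
        assume tJ: "t \<in> ?J"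
        then have t: "t \<in> {0..T}" by simp
        have ft: "f t \<in> L2 \<Omega>" using elim(2) tJ by blast
        \<comment> \<open>The time derivative of p at t, rebuilt from the derivatives of its
          coefficients.\<close>
        define \<eta> where "\<eta> x = (\<Sum>b\<in>?B. d b t * b x)" for x
        have \<eta>: "\<eta> \<in> S" unfolding \<eta>_def[abs_def] by (rule SL.expansion_mem[OF L_basis(1)])
        have b\<eta>: "inner_L2 \<Omega> \<eta> b = d b t" if "b \<in> ?B" for b
          unfolding \<eta>_def[abs_def] by (rule SL.expansion_inner[OF L_basis(1) that])
        have f\<eta>: "inner_L2 \<Omega> (f t) \<eta> = (\<Sum>b\<in>?B. d b t * inner_L2 \<Omega> (f t) b)"
          unfolding \<eta>_def[abs_def] by (rule L.sum_right[OF S_L2[OF L_basis_S] ft])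
        have "grad_inner \<Omega> (p t) \<eta> = (\<Sum>b\<in>?B. c b t * grad_inner \<Omega> b \<eta>)"
          unfolding c_def by (rule grad_inner_L_expansion[OF p[OF t] S_in_H10[OF \<eta>]])
        also have "\<dots> = (\<Sum>b\<in>?B. c b t * (\<Sum>b'\<in>?B. d b' t * a b b'))"
          unfolding a_def \<eta>_def[abs_def]
          by (intro sum.cong refl arg_cong2[where f = "(*)"] G.sum_right S_in_H10 L_basis_S) auto
        also have "\<dots> = ?Y t" by (simp add: sum_distrib_left mult_ac)
        finally have gY: "grad_inner \<Omega> (p t) \<eta> = ?Y t" .
        have "(\<Sum>b\<in>?B. d b t * inner_L2 \<Omega> b \<eta>) + \<nu> * grad_inner \<Omega> (p t) \<eta> = inner_L2 \<Omega> (f t) \<eta>"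
          using elim(1) tJ \<eta> by blast
        then have en: "?X t + \<nu> * ?Y t = (\<Sum>b\<in>?B. d b t * inner_L2 \<Omega> (f t) b)"
          unfolding gY f\<eta> by (simp add: inner_L2_commute[of \<Omega> _ \<eta>] b\<eta> cong: sum.cong)
        \<comment> \<open>Young's inequality for each coefficient, so that one copy of the sum of
          the squares \<open>d b t * d b t\<close> remains on the left; Bessel returns to the norm
          of \<open>f t\<close>.\<close>
        have "2 * (\<Sum>b\<in>?B. d b t * inner_L2 \<Omega> (f t) b) \<le> (\<Sum>b\<in>?B. d b t * d b t + (inner_L2 \<Omega> (f t) b)\<^sup>2)"
          unfolding sum_distrib_left
        proof (rule sum_mono)
          fix b
          have "0 \<le> (d b t - inner_L2 \<Omega> (f t) b)\<^sup>2" by simp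
          then show "2 * (d b t * inner_L2 \<Omega> (f t) b) \<le> d b t * d b t + (inner_L2 \<Omega> (f t) b)\<^sup>2"
            by (simp add: power2_eq_square algebra_simps)
        qed
        also have "\<dots> \<le> ?X t + inner_L2 \<Omega> (f t) (f t)"
          using L.Bessel[OF L_basis_orthonormal ft] by (simp add: sum.distrib)
        finally show "?X t + 2 * \<nu> * ?Y t \<le> inner_L2 \<Omega> (f t) (f t)" using en by simp
      qed
    qed
  qed
  moreover have "(LINT t:?J|lborel. ?X t + 2 * \<nu> * ?Y t) = (LINT t:?J|lborel. ?X t) + 2 * \<nu> * (LINT t:?J|lborel. ?Y t)"
    using set_integral_add(2)[OF iX set_integrable_mult_right, of "2 * \<nu>" ?Y] iY by simp
  moreover have "(LINT t:?J|lborel. ?X t) = (\<Sum>b\<in>?B. LINT t:?J|lborel. d b t * d b t)"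
    by (rule set_integral_sum_eq[OF dd])
  ultimately show ?thesis using Y0 by (simp add: inner_L2_def)
qed

end

lemma K2_nonneg: "0 < \<nu> \<Longrightarrow> 0 \<le> K2 \<nu> \<mu> T \<kappa>"
proof -
  assume "0 < \<nu>"
  moreover have "0 \<le> x powi (- 2)" for x :: real by (simp add: power_int_def)
  ultimately show ?thesis unfolding K2_def by (intro mult_nonneg_nonneg real_sqrt_ge_zero add_nonneg_nonneg) auto
qed

theorem theorem4p2:
  fixes \<Omega> :: "'a::euclidean_space set"
    and \<nu> T C\<^sub>\<Omega> C\<^sub>J \<kappa>\<^sub>1 :: real
    and S\<^sub>h :: "('a \<Rightarrow> real) set"
    and P\<^sub>h\<^sub>1 E\<^sub>h :: "('a \<Rightarrow> real) \<Rightarrow> ('a \<Rightarrow> real)"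
    and m :: nat and \<tau> :: "nat \<Rightarrow> real"
    and f u P\<^sub>hu :: "real \<Rightarrow> 'a \<Rightarrow> real"
  assumes "0 < \<nu>" and "0 < T"
    and "DIM('a) \<in> {1, 2, 3}" and "convex_polyhedral_domain \<Omega>"
    and "finite_dim_subspace S\<^sub>h" and "S\<^sub>h \<subseteq> H10 \<Omega>"
    and "is_H10_projection \<Omega> S\<^sub>h P\<^sub>h\<^sub>1"
    and "0 < C\<^sub>\<Omega>"
    and "\<And>v g. v \<in> H10 \<Omega> \<Longrightarrow> has_laplacian \<Omega> v g \<Longrightarrow>
           norm_H10 \<Omega> (\<lambda>x. v x - P\<^sub>h\<^sub>1 v x) \<le> C\<^sub>\<Omega> * norm_L2 \<Omega> g"
    and "\<And>v. v \<in> H10 \<Omega> \<Longrightarrow>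
           norm_L2 \<Omega> (\<lambda>x. v x - P\<^sub>h\<^sub>1 v x) \<le> C\<^sub>\<Omega> * norm_H10 \<Omega> (\<lambda>x. v x - P\<^sub>h\<^sub>1 v x)"
    and "is_mesh T m \<tau>"
    and "0 < C\<^sub>J"
    and "\<And>w. w \<in> V1 T \<Longrightarrow>
           norm_L2 {0<..<T} (\<lambda>t. w t - interpolant \<tau> w t) \<le> C\<^sub>J * norm_L2 {0<..<T} (wgrad {0<..<T} w)"
    and "is_evolution_operator \<nu> \<Omega> T S\<^sub>h E\<^sub>h"
    and "\<kappa>\<^sub>1 = opnorm_H10 \<Omega> S\<^sub>h E\<^sub>h"
    and "f \<in> L2J_L2 \<Omega> T"
    and "periodic_heat_solution \<nu> \<Omega> T f u"
    and "is_semidiscrete_projection \<nu> \<Omega> T S\<^sub>h u P\<^sub>hu"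
  shows "norm_L2J_L2 \<Omega> T (\<lambda>t x. u t x - full_discrete \<tau> P\<^sub>hu t x)
     \<le> (((3 - 2 * \<kappa>\<^sub>1) / (1 - \<kappa>\<^sub>1) * (2 / \<nu>) + 2 * K2 \<nu> (lambda1 \<Omega>) T \<kappa>\<^sub>1) * C\<^sub>\<Omega>\<^sup>2
          + (2 - \<kappa>\<^sub>1) / (1 - \<kappa>\<^sub>1) * C\<^sub>J) * norm_L2J_L2 \<Omega> T f"
proof -
  let ?J = "{0<..<T}"
  have "bounded \<Omega>"
    using assms(4) bounded_subset[OF polytope_imp_bounded closure_subset] by (auto simp: convex_polyhedral_domain_def)
  then interpret galerkin \<Omega> S\<^sub>h
    using assms(4-6) by unfold_locales (auto simp: convex_polyhedral_domain_def)
  note \<nu> = assms(1) and T = assms(2)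
  have J: "?J \<in> sets borel" by simp
  interpret LP: semi_inner "L2 (?J \<times> \<Omega>)" "inner_L2 (?J \<times> \<Omega>)"
    by (rule semi_inner_L2[OF borel_Times[OF J borel_\<Omega>]])
  \<comment> \<open>Contractivity is derived from the evolution itself; it makes
    \<open>1 - \<kappa>\<^sub>1\<close> positive in the comparison of constants.\<close>
  have \<kappa>: "\<kappa>\<^sub>1 < 1" unfolding assms(15) by (rule opnorm_evolution_less_1[OF T \<nu> assms(14)])

  \<comment> \<open>The error, the source and their pairings\<close>
  define p where "p = P\<^sub>hu"
  define e where "e t x = u t x - p t x" for t x
  define u' where "u' = time_deriv \<Omega> T u"
  define e' where "e' = time_deriv \<Omega> T e"
  define g where "g t x = f t x - u' t x" for t x
  have uV: "u \<in> H1J \<Omega> T (L2 \<Omega>)" "u \<in> L2J_H10 \<Omega> T" "u 0 \<in> H10 \<Omega>" "u T \<in> H10 \<Omega>"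
      "AE x\<in>\<Omega> in lborel. u 0 x = u T x"
    and eq_u: "AE t\<in>?J in lborel. \<forall>w\<in>H10 \<Omega>. inner_L2 \<Omega> (u' t) w + \<nu> * grad_inner \<Omega> (u t) w = inner_L2 \<Omega> (f t) w"
    using assms(17) by (auto simp: periodic_heat_solution_def V_space_def u'_def grad_inner_def)
  have pH: "p \<in> H1J \<Omega> T S\<^sub>h" and p_per: "AE x\<in>\<Omega> in lborel. p 0 x = p T x"
    and eq_e: "AE t\<in>?J in lborel. \<forall>v\<in>S\<^sub>h. inner_L2 \<Omega> (e' t) v + \<nu> * grad_inner \<Omega> (\<lambda>x. u t x - p t x) v = 0"
    using assms(18) by (auto simp: is_semidiscrete_projection_def e'_def e_def[abs_def] p_def grad_inner_def)
  have eH: "e \<in> H1J \<Omega> T (L2 \<Omega>)" unfolding e_def[abs_def] by (rule H1J_diff[OF uV(1) pH])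
  have uL: "u t \<in> L2 \<Omega>" and eL: "e t \<in> L2 \<Omega>" and pS: "p t \<in> S\<^sub>h" if "t \<in> {0..T}" for t
    using uV(1) eH pH that by (auto simp: H1J_def)
  have prod: "(\<lambda>(t, x). u' t x) \<in> L2 (?J \<times> \<Omega>)" "(\<lambda>(t, x). e t x) \<in> L2 (?J \<times> \<Omega>)" "(\<lambda>(t, x). e' t x) \<in> L2 (?J \<times> \<Omega>)"
    unfolding u'_def e'_def
    using has_time_derivD[OF H1J_time_deriv[OF uV(1)]] has_time_derivD[OF H1J_time_deriv[OF eH]] by blast+
  have f: "(\<lambda>(t, x). f t x) \<in> L2 (?J \<times> \<Omega>)" using assms(16) by (simp add: L2J_L2_def)
  have g: "(\<lambda>(t, x). g t x) \<in> L2 (?J \<times> \<Omega>)"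
    using LP.diff_mem[OF f prod(1)] by (simp add: g_def split_beta')
  note slices = L2_prod_AE[OF J borel_\<Omega>]
  have ac_u: "ac_on T (\<lambda>t. inner_L2 \<Omega> (u t) w) (\<lambda>t. inner_L2 \<Omega> (u' t) w)" if "w \<in> L2 \<Omega>" for w
    unfolding u'_def by (rule H1J_pairing_ac[OF borel_\<Omega> T uV(1) order_refl that])
  have ac_e: "ac_on T (\<lambda>t. inner_L2 \<Omega> (e t) w) (\<lambda>t. inner_L2 \<Omega> (e' t) w)" if "w \<in> L2 \<Omega>" for w
    unfolding e'_def by (rule H1J_pairing_ac[OF borel_\<Omega> T eH order_refl that])
  have per_u: "inner_L2 \<Omega> (u 0) w = inner_L2 \<Omega> (u T) w" if "w \<in> L2 \<Omega>" for w
    using uV(5) uL[of 0] uL[of T] T that by (intro inner_L2_cong_AE[OF borel_\<Omega>]) auto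
  have per_e: "inner_L2 \<Omega> (e 0) w = inner_L2 \<Omega> (e T) w" if "w \<in> L2 \<Omega>" for w
  proof (rule inner_L2_cong_AE[OF borel_\<Omega> _ _ _ _ that that])
    show "AE x\<in>\<Omega> in lborel. e 0 x = e T x"
      using uV(5) p_per by eventually_elim (simp add: e_def)
  qed (use eL T in auto)
  have eq_g: "AE t\<in>?J in lborel. \<forall>w\<in>H10 \<Omega>. inner_L2 \<Omega> (g t) w = \<nu> * grad_inner \<Omega> (u t) w"
    using eq_u slices[OF f] slices[OF prod(1)]
  proof eventually_elim
    case (elim t)
    show ?case
    proof (intro impI ballI)
      fix w assume t: "t \<in> ?J" and w: "w \<in> H10 \<Omega>"
      have "inner_L2 \<Omega> (g t) w = inner_L2 \<Omega> (f t) w - inner_L2 \<Omega> (u' t) w"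
        unfolding g_def using elim t by (intro L.diff_left H10_L2[OF w]) auto
      moreover have "inner_L2 \<Omega> (u' t) w + \<nu> * grad_inner \<Omega> (u t) w = inner_L2 \<Omega> (f t) w"
        using elim(1) t w by blast
      ultimately show "inner_L2 \<Omega> (g t) w = \<nu> * grad_inner \<Omega> (u t) w" by simp
    qed
  qed
  have uH: "AE t\<in>?J in lborel. u t \<in> H10 \<Omega>" using uV(2) by (simp add: L2J_H10_def)
  obtain Gr where Gr: "(\<lambda>(t, x). Gr t x) \<in> L2 (?J \<times> \<Omega>)" "AE t\<in>?J in lborel. has_weak_grad \<Omega> (u t) (Gr t)"
    using uV(2) by (auto simp: L2J_H10_def L2J_L2_def)
  have nonneg: "0 \<le> (LINT t:?J|lborel. inner_L2 \<Omega> (u' t) (g t))"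
    by (rule time_deriv_source_nonneg[OF open_\<Omega> T \<nu> prod(1) ac_u per_u g uH Gr eq_g])

  \<comment> \<open>Bound of the elliptic source by the data\<close>
  let ?F = "LINT t:?J|lborel. inner_L2 \<Omega> (f t) (f t)"
  have F: "norm_L2J_L2 \<Omega> T f = sqrt ?F" by (rule norm_L2J_L2_eq)
  have g_le: "(LINT t:?J|lborel. inner_L2 \<Omega> (g t) (g t)) \<le> ?F"
  proof -
    have i: "set_integrable lborel ?J (\<lambda>t. inner_L2 \<Omega> (g t) (g t))"
      "set_integrable lborel ?J (\<lambda>t. 2 * inner_L2 \<Omega> (u' t) (g t))"
      "set_integrable lborel ?J (\<lambda>t. inner_L2 \<Omega> (f t) (f t))"
      using L2_prod_inner(1)[OF J borel_\<Omega> g g] L2_prod_inner(1)[OF J borel_\<Omega> prod(1) g]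
        L2_prod_inner(1)[OF J borel_\<Omega> f f] by (auto intro: set_integrable_mult_right)
    \<comment> \<open>Since \<open>f = g + u'\<close>, the two sides differ by the squared norm of
      \<open>u'\<close>, which is dropped.\<close>
    have "(LINT t:?J|lborel. inner_L2 \<Omega> (g t) (g t) + 2 * inner_L2 \<Omega> (u' t) (g t)) \<le> ?F"
    proof (rule set_integral_mono_AE[OF set_integral_add(1)[OF i(1,2)] i(3)])
      show "AE t\<in>?J in lborel. inner_L2 \<Omega> (g t) (g t) + 2 * inner_L2 \<Omega> (u' t) (g t) \<le> inner_L2 \<Omega> (f t) (f t)"
        using slices[OF f] slices[OF prod(1)]
      proof eventually_elim
        case (elim t)
        show ?case
        proof
          assume "t \<in> ?J"
          then have m: "f t \<in> L2 \<Omega>" "u' t \<in> L2 \<Omega>" using elim by auto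
          have gt: "g t = (\<lambda>x. f t x - u' t x)" by (simp add: g_def[abs_def])
          show "inner_L2 \<Omega> (g t) (g t) + 2 * inner_L2 \<Omega> (u' t) (g t) \<le> inner_L2 \<Omega> (f t) (f t)"
            unfolding gt L.norm_diff_sq[OF m] L.diff_right[OF m m(2)]
            using inner_L2_nonneg[of \<Omega> "u' t"] inner_L2_commute[of \<Omega> "f t" "u' t"] by simp
        qed
      qed
    qed
    then show ?thesis using nonneg set_integral_add(2)[OF i(1,2)] by simp
  qed

  \<comment> \<open>Spatial error\<close>
  have ie: "set_integrable lborel ?J (\<lambda>t. inner_L2 \<Omega> (e t) (e t))"
    by (rule L2_prod_inner(1)[OF J borel_\<Omega> prod(2) prod(2)])
  have e_le: "(LINT t:?J|lborel. inner_L2 \<Omega> (e t) (e t)) \<le> (C\<^sub>\<Omega>\<^sup>2 / \<nu>)\<^sup>2 * ?F"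
  proof -
    let ?s = "\<lambda>b t. inner_L2 \<Omega> (e t) b * inner_L2 \<Omega> (e' t) b"
    have s: "set_integrable lborel ?J (?s b)" "(LINT t:?J|lborel. ?s b t) = 0" if b: "b \<in> G_basis" for b
    proof -
      note ac = ac_e[OF S_L2[OF G_basis_S[OF b]]]
      show "set_integrable lborel ?J (?s b)"
        by (rule set_integrable_continuous_mult[OF ac_onD(2)[OF ac] ac_onD(1)[OF ac]])
      \<comment> \<open>The integrand is half the derivative of the square of a periodic
        function.\<close>
      show "(LINT t:?J|lborel. ?s b t) = 0"
        using ac_on_parts[OF _ ac ac] T per_e[OF S_L2[OF G_basis_S[OF b]]] by (simp add: mult.commute)
    qed
    have i1: "set_integrable lborel ?J (\<lambda>t. (C\<^sub>\<Omega>\<^sup>2 / \<nu>)\<^sup>2 * inner_L2 \<Omega> (g t) (g t))"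
      by (intro set_integrable_mult_right L2_prod_inner(1)[OF J borel_\<Omega> g g])
    have i2: "set_integrable lborel ?J (\<lambda>t. 2 / \<nu> * (\<Sum>b\<in>G_basis. ?s b t))"
      by (intro set_integrable_mult_right set_integrable_sum s)
    have "(LINT t:?J|lborel. inner_L2 \<Omega> (e t) (e t))
        \<le> (LINT t:?J|lborel. (C\<^sub>\<Omega>\<^sup>2 / \<nu>)\<^sup>2 * inner_L2 \<Omega> (g t) (g t) - 2 / \<nu> * (\<Sum>b\<in>G_basis. ?s b t))"
    proof (rule set_integral_mono_AE[OF ie set_integral_diff(1)[OF i1 i2]])
      show "AE t\<in>?J in lborel. inner_L2 \<Omega> (e t) (e t)
          \<le> (C\<^sub>\<Omega>\<^sup>2 / \<nu>)\<^sup>2 * inner_L2 \<Omega> (g t) (g t) - 2 / \<nu> * (\<Sum>b\<in>G_basis. ?s b t)"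
        using uH eq_g eq_e slices[OF g] slices[OF prod(3)]
      proof eventually_elim
        case (elim t)
        show ?case
        proof
          assume t: "t \<in> ?J"
          show "inner_L2 \<Omega> (e t) (e t) \<le> (C\<^sub>\<Omega>\<^sup>2 / \<nu>)\<^sup>2 * inner_L2 \<Omega> (g t) (g t) - 2 / \<nu> * (\<Sum>b\<in>G_basis. ?s b t)"
            unfolding e_def[abs_def]
            by (rule spatial_error[OF \<nu> assms(8,7,9,10)]) (use elim t pS in auto)
        qed
      qed
    qed
    also have "\<dots> = (C\<^sub>\<Omega>\<^sup>2 / \<nu>)\<^sup>2 * (LINT t:?J|lborel. inner_L2 \<Omega> (g t) (g t))"
      using set_integral_diff(2)[OF i1 i2] set_integral_sum_eq[OF s(1), of G_basis] s(2) by simp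
    also have "\<dots> \<le> (C\<^sub>\<Omega>\<^sup>2 / \<nu>)\<^sup>2 * ?F" by (intro mult_left_mono g_le) simp
    finally show ?thesis .
  qed

  \<comment> \<open>Time derivative of the semidiscrete projection and temporal error\<close>
  define d where "d b t = inner_L2 \<Omega> (u' t) b - inner_L2 \<Omega> (e' t) b" for b t
  have p_split: "inner_L2 \<Omega> (p t) b = inner_L2 \<Omega> (u t) b - inner_L2 \<Omega> (e t) b" if "b \<in> L2 \<Omega>" "t \<in> {0..T}" for b t
    using L.diff_left[OF uL[OF that(2)] eL[OF that(2)] that(1)] by (simp add: e_def)
  \<comment> \<open>The equations involve only the derivatives of u and of e, so the coefficients of
    p are differentiated as differences of those of u and e.\<close>
  have ac_p: "ac_on T (\<lambda>t. inner_L2 \<Omega> (p t) b) (d b)" if b: "b \<in> L_basis" for b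
  proof -
    have bL: "b \<in> L2 \<Omega>" by (rule S_L2[OF L_basis_S[OF b]])
    have "ac_on T (\<lambda>t. 1 * inner_L2 \<Omega> (u t) b + (-1) * inner_L2 \<Omega> (e t) b) (\<lambda>t. 1 * inner_L2 \<Omega> (u' t) b + (-1) * inner_L2 \<Omega> (e' t) b)"
      by (rule ac_on_lin[OF ac_u[OF bL] ac_e[OF bL]])
    then have ac: "ac_on T (\<lambda>t. inner_L2 \<Omega> (u t) b - inner_L2 \<Omega> (e t) b) (d b)" by (simp add: d_def[abs_def])
    show ?thesis by (rule ac_on_cong[OF ac less_imp_le[OF T] p_split[OF bL]])
  qed
  have d: "d b \<in> L2 ?J" if b: "b \<in> L_basis" for b
  proof -
    interpret LJ: semi_inner "L2 ?J" "inner_L2 ?J" by (rule semi_inner_L2[OF J])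
    have bL: "b \<in> L2 \<Omega>" by (rule S_L2[OF L_basis_S[OF b]])
    show ?thesis
      unfolding d_def[abs_def]
      by (intro LJ.diff_mem L2_pairing[OF J borel_\<Omega> _ bL] prod)
  qed
  have per_p: "inner_L2 \<Omega> (p 0) b = inner_L2 \<Omega> (p T) b" if b: "b \<in> L_basis" for b
  proof -
    have bL: "b \<in> L2 \<Omega>" by (rule S_L2[OF L_basis_S[OF b]])
    show ?thesis using p_split[OF bL, of 0] p_split[OF bL, of T] T per_u[OF bL] per_e[OF bL] by simp
  qed
  \<comment> \<open>Subtracting the error equation from the heat equation tested in S leaves the
    semidiscrete equation for p.\<close>
  have "AE t\<in>?J in lborel. \<forall>v\<in>S\<^sub>h. (\<Sum>b\<in>L_basis. d b t * inner_L2 \<Omega> b v) + \<nu> * grad_inner \<Omega> (p t) v = inner_L2 \<Omega> (f t) v"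
    using uH eq_u eq_e slices[OF prod(1)] slices[OF prod(3)]
  proof eventually_elim
    case (elim t)
    show ?case
    proof (intro impI ballI)
      fix v assume t: "t \<in> ?J" and v: "v \<in> S\<^sub>h"
      have m: "u t \<in> H10 \<Omega>" "u' t \<in> L2 \<Omega>" "e' t \<in> L2 \<Omega>" "p t \<in> H10 \<Omega>" using elim t pS[of t] S_in_H10 by auto
      have "(\<Sum>b\<in>L_basis. d b t * inner_L2 \<Omega> b v) = inner_L2 \<Omega> (u' t) v - inner_L2 \<Omega> (e' t) v"
        unfolding inner_L2_L_expansion[OF m(2) v] inner_L2_L_expansion[OF m(3) v]
        by (simp add: d_def left_diff_distrib sum_subtractf)
      moreover have "inner_L2 \<Omega> (u' t) v + \<nu> * grad_inner \<Omega> (u t) v = inner_L2 \<Omega> (f t) v"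
        using elim(2) t S_in_H10[OF v] by blast
      moreover have "inner_L2 \<Omega> (e' t) v + \<nu> * (grad_inner \<Omega> (u t) v - grad_inner \<Omega> (p t) v) = 0"
        using elim(3) t v G.diff_left[OF m(1,4) S_in_H10[OF v]] by fastforce
      ultimately show "(\<Sum>b\<in>L_basis. d b t * inner_L2 \<Omega> b v) + \<nu> * grad_inner \<Omega> (p t) v = inner_L2 \<Omega> (f t) v"
        by (simp add: algebra_simps)
    qed
  qed
  from semidiscrete_time_deriv_bound[OF T ac_p d per_p pS f this]
  have d_le: "(\<Sum>b\<in>L_basis. inner_L2 ?J (d b) (d b)) \<le> ?F" .
  define \<delta> where "\<delta> t x = p t x - full_discrete \<tau> p t x" for t x
  note interp = interpolation_error[OF T assms(11,12,13) pS ac_p d per_p]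
  have \<delta>S: "\<delta> t \<in> S\<^sub>h" if "t \<in> ?J" for t
    unfolding \<delta>_def by (rule interp(1)[OF _ _ _ _ _ that])
  have i\<delta>: "set_integrable lborel ?J (\<lambda>t. inner_L2 \<Omega> (\<delta> t) (\<delta> t))"
    unfolding \<delta>_def by (rule interp(2))
  have \<delta>_le: "(LINT t:?J|lborel. inner_L2 \<Omega> (\<delta> t) (\<delta> t)) \<le> C\<^sub>J\<^sup>2 * ?F"
    unfolding \<delta>_def using interp(3) mult_left_mono[OF d_le, of "C\<^sub>J\<^sup>2"] by simp

  \<comment> \<open>Sum of the errors and comparison of constants\<close>
  have sq: "sqrt X \<le> c * norm_L2J_L2 \<Omega> T f" if "X \<le> c\<^sup>2 * ?F" "0 < c" for X c
    using real_sqrt_le_mono[OF that(1)] that(2) by (simp add: F real_sqrt_mult)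
  have "norm_L2J_L2 \<Omega> T (\<lambda>t x. u t x - full_discrete \<tau> P\<^sub>hu t x) \<le> norm_L2J_L2 \<Omega> T e + norm_L2J_L2 \<Omega> T \<delta>"
    by (rule norm_L2J_L2_triangle[OF borel_\<Omega> _ _ _ ie i\<delta>])
       (use eL \<delta>S S_L2 in \<open>auto simp: e_def \<delta>_def p_def\<close>)
  also have "\<dots> \<le> C\<^sub>\<Omega>\<^sup>2 / \<nu> * norm_L2J_L2 \<Omega> T f + C\<^sub>J * norm_L2J_L2 \<Omega> T f"
    unfolding norm_L2J_L2_eq[of _ _ e] norm_L2J_L2_eq[of _ _ \<delta>]
    using \<nu> assms(8,12) by (intro add_mono sq e_le \<delta>_le) auto
  also have "\<dots> = (1 / \<nu> * C\<^sub>\<Omega>\<^sup>2 + 1 * C\<^sub>J) * norm_L2J_L2 \<Omega> T f" by (simp add: algebra_simps)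
  also have "\<dots> \<le> (((3 - 2 * \<kappa>\<^sub>1) / (1 - \<kappa>\<^sub>1) * (2 / \<nu>) + 2 * K2 \<nu> (lambda1 \<Omega>) T \<kappa>\<^sub>1) * C\<^sub>\<Omega>\<^sup>2
          + (2 - \<kappa>\<^sub>1) / (1 - \<kappa>\<^sub>1) * C\<^sub>J) * norm_L2J_L2 \<Omega> T f"
  proof (intro mult_right_mono add_mono)
    \<comment> \<open>The two numerators exceed the denominator \<open>1 - \<kappa>\<^sub>1\<close>
      by \<open>2 - \<kappa>\<^sub>1\<close> and by 1, and all of these are positive.\<close>
    have "1 \<le> (3 - 2 * \<kappa>\<^sub>1) / (1 - \<kappa>\<^sub>1)" using \<kappa> by (simp add: field_simps)
    then have "1 * (1 / \<nu>) \<le> (3 - 2 * \<kappa>\<^sub>1) / (1 - \<kappa>\<^sub>1) * (2 / \<nu>)"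
      using \<nu> by (intro mult_mono) (auto simp: divide_right_mono)
    then show "1 / \<nu> \<le> (3 - 2 * \<kappa>\<^sub>1) / (1 - \<kappa>\<^sub>1) * (2 / \<nu>) + 2 * K2 \<nu> (lambda1 \<Omega>) T \<kappa>\<^sub>1"
      using K2_nonneg[OF \<nu>, of "lambda1 \<Omega>" T \<kappa>\<^sub>1] by simp
    show "1 \<le> (2 - \<kappa>\<^sub>1) / (1 - \<kappa>\<^sub>1)" using \<kappa> by (simp add: field_simps)
  qed (use assms(12) in \<open>auto simp: norm_L2J_L2_eq intro!: real_sqrt_ge_zero integral_nonneg_AE
        simp: set_lebesgue_integral_def inner_L2_nonneg indicator_def\<close>)
  finally show ?thesis .
qed

end
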